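(* Let $\delta:\mathbb{N}_0\to\mathbb{Q}$ be defined by $\delta(n)=\tfrac14\,\#\{(x,y)\in\mathbb{Z}\times\mathbb{Z} : x^2+y^2=n\}$. Then, as $x\to\infty$, \[ \max_{n\le x}\log \delta(\delta(n)) = \frac{\sqrt{\log x}}{\log_2 x}\left(\frac{c}{\sqrt 2}+\mathcal{O}\!\left(\frac{\log_3 x}{\log_2 x}\right)\right), \qquad c=\left(8\sum_{l=1}^{\infty}\left(\log\left(1+\frac1l\right)\right)^2\right)^{1/2}. \]
   Context: $\log$ is the natural logarithm and $\log_k$ denotes the $k$-fold iterated natural logarithm ($\log_2 x=\log\log x$, $\log_3 x=\log\log\log x$). The maximum is over positive integers $n\le x$. Note $\delta$ is a positive integer for $n\ge1$ with $x^2+y^2=n$ solvable, $\delta(n)=0$ otherwise for $n\geq 1$, and $\delta(0)=1/4$. *)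

theory Defs
  imports Complex_Main "HOL-Library.Landau_Symbols"
begin

definition delta :: "nat \<Rightarrow> rat" where
  "delta n = (1 / 4) * of_nat (card {(x :: int, y :: int). x\<^sup>2 + y\<^sup>2 = int n})"

text \<open>
  The iterate \<open>\<delta>(\<delta>(n))\<close>. For \<open>n \<ge> 1\<close> the rational number \<open>\<delta>(n)\<close> is a
  natural number, and \<open>nat \<lfloor>delta n\<rfloor>\<close> is that natural number; see
  \<open>delta_eq_of_nat\<close> below. Since \<open>\<delta>(0) = 1/4\<close>, the value of \<open>delta_delta 0\<close> is
  meaningless.
\<close>

definition delta_delta :: "nat \<Rightarrow> rat" where
  "delta_delta n = delta (nat \<lfloor>delta n\<rfloor>)"

lemma finite_sum_two_squares:
  "finite {(x :: int, y :: int). x\<^sup>2 + y\<^sup>2 = int n}"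
proof (rule finite_subset)
  have bound: "\<bar>x\<bar> \<le> int n" if "x\<^sup>2 \<le> int n" for x :: int
  proof -
    have "\<bar>x\<bar> \<le> \<bar>x\<bar> ^ 2"
    proof (cases "x = 0")
      case False
      then show ?thesis
        by (intro self_le_power) auto
    qed simp
    then show ?thesis
      using that by simp
  qed
  show "{(x :: int, y :: int). x\<^sup>2 + y\<^sup>2 = int n} \<subseteq> {- int n..int n} \<times> {- int n..int n}"
  proof clarify
    fix x y :: int
    assume eq: "x\<^sup>2 + y\<^sup>2 = int n"
    have "x\<^sup>2 \<ge> 0" "y\<^sup>2 \<ge> 0"
      by simp_all
    with eq have "x\<^sup>2 \<le> int n" "y\<^sup>2 \<le> int n"
      by linarith+
    from this[THEN bound] show "x \<in> {- int n..int n} \<and> y \<in> {- int n..int n}"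
      by auto
  qed
qed simp

lemma delta_eq_of_nat:
  assumes "n \<ge> 1"
  shows "delta n = of_nat (nat \<lfloor>delta n\<rfloor>)"
proof -
  define S where "S = {(x :: int, y :: int). x\<^sup>2 + y\<^sup>2 = int n}"
  define A where "A = {(x, y). (x, y) \<in> S \<and> x > 0 \<and> y \<ge> 0}"
  define B where "B = {(x, y). (x, y) \<in> S \<and> y > 0 \<and> x \<le> 0}"
  define C where "C = {(x, y). (x, y) \<in> S \<and> x < 0 \<and> y \<le> 0}"
  define D where "D = {(x, y). (x, y) \<in> S \<and> y < 0 \<and> x \<ge> 0}"
  note defs = S_def A_def B_def C_def D_def
  have fin: "finite S"
    unfolding S_def by (rule finite_sum_two_squares)
  then have finABCD: "finite A" "finite B" "finite C" "finite D"
    by (auto intro!: finite_subset[OF _ fin] simp: A_def B_def C_def D_def)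
  have S: "S = (A \<union> B) \<union> (C \<union> D)"
  proof (intro equalityI subsetI)
    fix p assume p: "p \<in> S"
    then have "fst p \<noteq> 0 \<or> snd p \<noteq> 0"
      using assms by (auto simp: S_def)
    then show "p \<in> (A \<union> B) \<union> (C \<union> D)"
      using p by (cases p) (auto simp: A_def B_def C_def D_def)
  qed (auto simp: A_def B_def C_def D_def)
  have "bij_betw (\<lambda>(x, y). (- y, x)) A B"
    by (rule bij_betw_byWitness[where f' = "\<lambda>(x, y). (y, - x)"])
       (auto simp: defs add.commute)
  then have "card A = card B"
    by (rule bij_betw_same_card)
  moreover have "bij_betw (\<lambda>(x, y). (- x, - y)) A C"
    by (rule bij_betw_byWitness[where f' = "\<lambda>(x, y). (- x, - y)"])
       (auto simp: defs)
  then have "card A = card C"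
    by (rule bij_betw_same_card)
  moreover have "bij_betw (\<lambda>(x, y). (y, - x)) A D"
    by (rule bij_betw_byWitness[where f' = "\<lambda>(x, y). (- y, x)"])
       (auto simp: defs add.commute)
  then have "card A = card D"
    by (rule bij_betw_same_card)
  moreover have "card S = card (A \<union> B) + card (C \<union> D)"
    unfolding S using finABCD
    by (intro card_Un_disjoint) (auto simp: A_def B_def C_def D_def)
  moreover have "card (A \<union> B) = card A + card B"
    using finABCD by (intro card_Un_disjoint) (auto simp: A_def B_def)
  moreover have "card (C \<union> D) = card C + card D"
    using finABCD by (intro card_Un_disjoint) (auto simp: C_def D_def)
  ultimately have "card S = 4 * card A"
    by simp
  then have "delta n = of_nat (card A)"
    unfolding delta_def S_def by simp
  then show ?thesis
    by simp
qed

end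

theory Submission
  imports Defs "HOL-Number_Theory.Number_Theory" "HOL-Complex_Analysis.Complex_Analysis"
    "HOL-Probability.Probability" "HOL-Real_Asymp.Real_Asymp"
begin

text \<open>
  Let \<open>P\<close> be the set of primes congruent to \<open>1\<close> modulo \<open>4\<close> and \<open>X = log x\<close>. By Jacobi's theorem \<open>\<delta>(n)\<close>,
  if nonzero, is the product of \<open>v\<^sub>p(n) + 1\<close> over \<open>p \<in> P\<close>. Hence \<open>log \<delta>(\<delta>(n))\<close> is the sum of
  \<open>log (b\<^sub>q + 1)\<close> over \<open>q \<in> P\<close>, where \<open>b\<^sub>q\<close> is the multiplicity of \<open>q\<close> in \<open>\<delta>(n)\<close>, and each factor \<open>q\<close>
  of \<open>\<delta>(n)\<close> costs an exponent \<open>q - 1\<close> at some prime divisor \<open>p\<close> of \<open>n\<close>. Since \<open>log p\<close> is about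
  \<open>(log X)/2\<close> for all relevant \<open>p\<close>, one has to maximise \<open>\<Sum> log (b\<^sub>q + 1)\<close> subject to
  \<open>\<Sum> b\<^sub>q (q - 1) \<le> Y\<close> with \<open>Y\<close> about \<open>2 X / log X\<close>.

  Write \<open>g\<^sub>l = log (1 + 1/l)\<close>. Lagrangian duality bounds the maximum by
  \<open>(Y + \<Sum>\<^sub>l R(T g\<^sub>l + 1)) / T\<close> for every \<open>T\<close>, where \<open>R(y)\<close> is the sum of \<open>y - q\<close> over the \<open>q \<in> P\<close>
  with \<open>q \<le> y\<close>, and a greedy choice of the \<open>b\<^sub>q\<close> comes close to the bound for a suitable \<open>T\<close>. Therefore only
  the integrated form \<open>R(y) = y\<^sup>2 / (4 log y) (1 + O(1 / log y))\<close> of the prime number theorem for \<open>P\<close> is needed.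
  This form follows from the Dedekind zeta function \<open>\<zeta>(s) L(s, \<chi>\<^sub>4)\<close> of the Gaussian field: the 3-4-1
  inequality bounds its logarithmic derivative and the derivative of that by \<open>O(t\<^bsup>1/2\<^esup>)\<close> up to the
  line \<open>Re s = 1\<close>, and a Fourier argument on that line saves one logarithm.
\<close>

section \<open>Sums of two squares\<close>

definition sq_reps :: "nat \<Rightarrow> (int \<times> int) set" where
  "sq_reps n = {(x, y). x\<^sup>2 + y\<^sup>2 = int n}"

definition primes_1mod4 :: "nat set" where
  "primes_1mod4 = {q. prime q \<and> q mod 4 = 1}"

lemma mem_sq_reps [simp]: "(x, y) \<in> sq_reps n \<longleftrightarrow> x\<^sup>2 + y\<^sup>2 = int n"
  by (simp add: sq_reps_def)

lemma finite_sq_reps [simp]: "finite (sq_reps n)"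
  unfolding sq_reps_def by (rule finite_sum_two_squares)

lemma delta_sq_reps: "delta n = of_nat (card (sq_reps n)) / 4"
  by (simp add: delta_def sq_reps_def)

lemma primes_1mod4_prime: "q \<in> primes_1mod4 \<Longrightarrow> prime q"
  by (simp add: primes_1mod4_def)

lemma primes_1mod4_gt_2:
  assumes "q \<in> primes_1mod4"
  shows "q > 2"
proof -
  have "q \<ge> 2" "q \<noteq> 2" using assms prime_ge_2_nat by (auto simp: primes_1mod4_def)
  then show ?thesis by simp
qed

lemma prime_mod_4_cases:
  fixes p :: nat
  assumes "prime p"
  obtains "p = 2" | "p mod 4 = 1" | "p mod 4 = 3"
proof (cases "p = 2")
  case False
  then have "odd p" using assms primes_dvd_imp_eq two_is_prime_nat by blast
  then have "p mod 4 = 1 \<or> p mod 4 = 3" by presburger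
  then show ?thesis using that by blast
qed (rule that(1))

lemma card_sq_reps_1: "card (sq_reps 1) = 4"
proof -
  have "x = 0 \<and> (y = 1 \<or> y = -1) \<or> (x = 1 \<or> x = -1) \<and> y = 0" if "x\<^sup>2 + y\<^sup>2 = 1" for x y :: int
  proof -
    have "x\<^sup>2 = 0 \<and> y\<^sup>2 = 1 \<or> x\<^sup>2 = 1 \<and> y\<^sup>2 = 0"
      using that zero_le_power2[of x] zero_le_power2[of y] by linarith
    then show ?thesis by (auto simp: power2_eq_1_iff)
  qed
  then have "sq_reps 1 = {(1,0), (-1,0), (0,1), (0,-1)}" by (auto simp: sq_reps_def)
  then show ?thesis by simp
qed

lemma QuadRes_minus_one_iff:
  assumes "prime p" "p > 2"
  shows "QuadRes (int p) (- 1) \<longleftrightarrow> p mod 4 = 1"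
proof -
  have "int p dvd 2 \<longleftrightarrow> False" using assms(2) zdvd_imp_le by fastforce
  then have incongruent: "\<not> [1 = - 1] (mod int p)" "\<not> [- 1 = 1] (mod int p)"
    by (simp_all add: cong_iff_dvd_diff)
  have "\<not> [- 1 = 0] (mod int p)" using assms(2) by (simp add: cong_iff_dvd_diff)
  then have "[(if QuadRes (int p) (- 1) then 1 else - 1) = (- 1) ^ ((p - 1) div 2)] (mod int p)"
    using euler_criterion[OF assms, of "- 1"] by (simp add: Legendre_def)
  then have "QuadRes (int p) (- 1) \<longleftrightarrow> even ((p - 1) div 2)"
    using incongruent by (cases "even ((p - 1) div 2)") (auto split: if_splits)
  moreover have "odd p" using assms prime_odd_nat by blast
  then have "even ((p - 1) div 2) \<longleftrightarrow> p mod 4 = 1" by presburger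
  ultimately show ?thesis by simp
qed

lemma prime_3mod4_dvd_sum_squares:
  fixes x y :: int and p :: nat
  assumes p: "prime p" "p mod 4 = 3" and dvd: "int p dvd x\<^sup>2 + y\<^sup>2"
  shows "int p dvd x" "int p dvd y"
proof -
  have "p > 2" using p prime_ge_2_nat[of p] by (cases "p = 2") auto
  have dvd_right: "int p dvd v" if uv: "int p dvd u\<^sup>2 + v\<^sup>2" for u v :: int
  proof (rule ccontr)
    assume "\<not> int p dvd v"
    then have "coprime v (int p)"
      using prime_imp_coprime[of "int p" v] p(1) by (simp add: coprime_commute)
    then obtain w where w: "[v * w = 1] (mod int p)" using cong_solve_coprime_int by blast
    have "[u\<^sup>2 * w\<^sup>2 = - (v * w)\<^sup>2] (mod int p)"
      using dvd_mult2[OF uv, of "w\<^sup>2"]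
      by (simp add: cong_iff_dvd_diff power_mult_distrib distrib_right)
    also have "[- (v * w)\<^sup>2 = - 1] (mod int p)"
      using cong_pow[OF w, of 2] by (simp add: cong_minus_minus_iff)
    finally have "QuadRes (int p) (- 1)"
      unfolding QuadRes_def by (intro exI[of _ "u * w"]) (simp add: power_mult_distrib)
    then show False using QuadRes_minus_one_iff[OF p(1) \<open>p > 2\<close>] p(2) by simp
  qed
  show "int p dvd y" using dvd_right[OF dvd] .
  show "int p dvd x" using dvd_right[of y x] dvd by (simp add: add.commute)
qed

text \<open>Pigeonhole principle for \<open>a - z b\<close> with \<open>0 \<le> a, b \<le> \<lfloor>\<surd>n\<rfloor>\<close>.\<close>

lemma thue_lemma:
  fixes z :: int and n :: nat
  assumes "n > 0" and nsq: "\<And>r. r\<^sup>2 \<noteq> n"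
  obtains c d :: int where "(c, d) \<noteq> (0, 0)" "c\<^sup>2 < int n" "d\<^sup>2 < int n" "[c = z * d] (mod int n)"
proof -
  define r where "r = floor_sqrt n"
  have "r\<^sup>2 \<le> n" unfolding r_def by (rule floor_sqrt_power2_le)
  then have r: "r\<^sup>2 < n" "n < (Suc r)\<^sup>2"
    using nsq[of r] Suc_floor_sqrt_power2_gt[of n] by (simp_all add: le_neq_implies_less r_def)
  define A where "A = {0..int r} \<times> {0..int r}"
  define f where "f = (\<lambda>(a, b). (a - z * b) mod int n)"
  have "f ` A \<subseteq> {0..<int n}" using assms(1) by (auto simp: f_def)
  then have "card (f ` A) \<le> n" using card_mono[of "{0..<int n}" "f ` A"] by simp
  also have "n < card A" using r(2) by (simp add: A_def power2_eq_square nat_add_distrib)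
  finally have "\<not> inj_on f A" using pigeonhole by blast
  then obtain a b a' b'
    where ab: "(a, b) \<in> A" "(a', b') \<in> A" "(a, b) \<noteq> (a', b')" "f (a, b) = f (a', b')"
    unfolding inj_on_def by auto
  have small: "u\<^sup>2 < int n" if "\<bar>u\<bar> \<le> int r" for u :: int
  proof -
    have "u\<^sup>2 \<le> (int r)\<^sup>2" using that by (metis abs_le_square_iff abs_of_nat)
    also have "\<dots> < int n" using r(1) by (metis of_nat_less_iff of_nat_power)
    finally show ?thesis .
  qed
  show ?thesis
  proof (rule that[of "a - a'" "b - b'"])
    have "int n dvd (a - z * b) - (a' - z * b')" using ab(4) by (simp add: f_def mod_eq_dvd_iff)
    then show "[a - a' = z * (b - b')] (mod int n)"
      by (simp add: cong_iff_dvd_diff algebra_simps)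
    show "(a - a')\<^sup>2 < int n" "(b - b')\<^sup>2 < int n" using ab(1,2) by (auto simp: A_def intro!: small)
  qed (use ab(3) in auto)
qed

lemma prime_1mod4_sum_squares:
  assumes "p \<in> primes_1mod4"
  obtains c d :: int where "c\<^sup>2 + d\<^sup>2 = int p"
proof -
  have p: "prime p" "p mod 4 = 1" "p > 2"
    using assms primes_1mod4_gt_2 by (auto simp: primes_1mod4_def)
  obtain z where z: "[z\<^sup>2 = - 1] (mod int p)"
    using QuadRes_minus_one_iff[OF p(1,3)] p(2) by (auto simp: QuadRes_def)
  have "r\<^sup>2 \<noteq> p" for r
    using p(1) by (metis prime_power_iff zero_neq_numeral numeral_eq_one_iff semiring_norm(85))
  then obtain c d :: int
    where cd: "(c, d) \<noteq> (0, 0)" "c\<^sup>2 < int p" "d\<^sup>2 < int p" "[c = z * d] (mod int p)"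
    using thue_lemma[of p z] p(3) by auto
  have "[c\<^sup>2 = z\<^sup>2 * d\<^sup>2] (mod int p)" using cong_pow[OF cd(4), of 2] by (simp add: power_mult_distrib)
  also have "[z\<^sup>2 * d\<^sup>2 = - 1 * d\<^sup>2] (mod int p)" using z by (rule cong_mult) simp
  finally have "int p dvd c\<^sup>2 + d\<^sup>2" by (simp add: cong_iff_dvd_diff)
  then obtain k where k: "c\<^sup>2 + d\<^sup>2 = int p * k" by (elim dvdE)
  have "c\<^sup>2 + d\<^sup>2 > 0" using cd(1) by (simp add: sum_power2_gt_zero_iff)
  then have "k > 0" using k p(3) by (simp add: zero_less_mult_iff)
  moreover have "int p * k < int p * 2" using cd(2,3) k by linarith
  then have "k < 2" using p(3) by simp
  ultimately have "k = 1" by simp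
  then show ?thesis using that k by simp
qed

lemma sum_squares_mult:
  fixes a b u v :: int
  shows "(a * u - b * v)\<^sup>2 + (a * v + b * u)\<^sup>2 = (u\<^sup>2 + v\<^sup>2) * (a\<^sup>2 + b\<^sup>2)"
  by (simp add: power2_eq_square algebra_simps)

lemma sq_reps_dvd_inner_factor:
  assumes p: "prime p" and uv: "u\<^sup>2 + v\<^sup>2 = int p"
    and xy: "(x, y) \<in> sq_reps (p * k)" "int p dvd x * u + y * v"
  obtains a b where "(a, b) \<in> sq_reps k" "x = a * u - b * v" "y = a * v + b * u"
proof -
  have p_pos: "int p > 0" using p prime_gt_0_nat by simp
  have norm: "x\<^sup>2 + y\<^sup>2 = int p * int k" using xy(1) by simp
  have "(y * u - x * v)\<^sup>2 = (x\<^sup>2 + y\<^sup>2) * (u\<^sup>2 + v\<^sup>2) - (x * u + y * v)\<^sup>2"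
    by (simp add: power2_eq_square algebra_simps)
  then have "int p dvd (y * u - x * v)\<^sup>2" using xy(2) norm by (simp add: power2_eq_square)
  then have "int p dvd y * u - x * v" using p by (simp add: prime_dvd_power_iff)
  with xy(2) obtain a b where ab: "x * u + y * v = int p * a" "y * u - x * v = int p * b"
    by (auto elim!: dvdE)
  have "int p * x = (x * u + y * v) * u - (y * u - x * v) * v"
    "int p * y = (x * u + y * v) * v + (y * u - x * v) * u"
    unfolding uv[symmetric] by (simp_all add: power2_eq_square algebra_simps)
  then have "int p * x = int p * (a * u - b * v)" "int p * y = int p * (a * v + b * u)"
    unfolding ab by (simp_all add: algebra_simps)
  then have x: "x = a * u - b * v" and y: "y = a * v + b * u" using p_pos by auto
  have "int p * (a\<^sup>2 + b\<^sup>2) = int p * int k" using norm sum_squares_mult[of a u b v] uv x y by simp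
  then have "(a, b) \<in> sq_reps k" using p_pos by simp
  then show ?thesis using that x y by blast
qed

text \<open>The bijection is multiplication by \<open>u + v \<i>\<close> in the Gaussian integers.\<close>

lemma card_sq_reps_dvd_inner:
  assumes p: "prime p" and uv: "u\<^sup>2 + v\<^sup>2 = int p"
  shows "card {(x, y) \<in> sq_reps (p * k). int p dvd x * u + y * v} = card (sq_reps k)"
proof -
  define g where "g = (\<lambda>(a, b). (a * u - b * v, a * v + b * u))"
  have inv: "(a * u - b * v) * u + (a * v + b * u) * v = int p * a"
    "(a * v + b * u) * u - (a * u - b * v) * v = int p * b" for a b
    unfolding uv[symmetric] by (simp_all add: power2_eq_square algebra_simps)
  have "g ` sq_reps k = {(x, y) \<in> sq_reps (p * k). int p dvd x * u + y * v}"
  proof (intro equalityI subrelI)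
    fix x y assume "(x, y) \<in> {(x, y) \<in> sq_reps (p * k). int p dvd x * u + y * v}"
    then obtain a b where "(a, b) \<in> sq_reps k" "x = a * u - b * v" "y = a * v + b * u"
      using sq_reps_dvd_inner_factor[OF p uv] by blast
    then show "(x, y) \<in> g ` sq_reps k" by (force simp: g_def)
  qed (auto simp: g_def sum_squares_mult uv inv)
  moreover have "inj_on g (sq_reps k)"
  proof (rule inj_onI, clarify)
    fix a b a' b' assume "g (a, b) = g (a', b')"
    then have "int p * a = int p * a'" "int p * b = int p * b'"
      unfolding g_def prod.case prod.inject using inv by metis+
    then show "a = a' \<and> b = b'" using p prime_gt_0_nat by simp
  qed
  ultimately show ?thesis using card_image by metis
qed

lemma card_sq_reps_double: "card (sq_reps (2 * k)) = card (sq_reps k)"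
proof -
  have "even (x + y)" if "x\<^sup>2 + y\<^sup>2 = int (2 * k)" for x y :: int
  proof -
    have "even (x\<^sup>2 + y\<^sup>2)" using that by simp
    then show ?thesis by simp
  qed
  then have "{(x, y) \<in> sq_reps (2 * k). int 2 dvd x * 1 + y * 1} = sq_reps (2 * k)" by auto
  then show ?thesis using card_sq_reps_dvd_inner[of 2 1 1 k] by simp
qed

definition card_sq_reps_div :: "nat \<Rightarrow> nat \<Rightarrow> nat" where
  "card_sq_reps_div k p = (if p dvd k then card (sq_reps (k div p)) else 0)"

lemma card_sq_reps_dvd_both:
  assumes "p > 0"
  shows "card {(x, y) \<in> sq_reps (p * k). int p dvd x \<and> int p dvd y} = card_sq_reps_div k p"
    (is "card ?D = _")
proof -
  have rescale: "(int p * a)\<^sup>2 + (int p * b)\<^sup>2 = int (p * k) \<longleftrightarrow> int p * (a\<^sup>2 + b\<^sup>2) = int k" for a b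
  proof -
    have "(int p * a)\<^sup>2 + (int p * b)\<^sup>2 = int p * (int p * (a\<^sup>2 + b\<^sup>2))"
      by (simp add: power2_eq_square algebra_simps)
    then show ?thesis using assms by simp
  qed
  show ?thesis
  proof (cases "p dvd k")
    case True
    then obtain j where j: "k = p * j" by (elim dvdE)
    have "(int p * a)\<^sup>2 + (int p * b)\<^sup>2 = int (p * k) \<longleftrightarrow> (a, b) \<in> sq_reps j" for a b
      unfolding rescale unfolding j using assms by simp
    then have "?D = (\<lambda>(x, y). (int p * x, int p * y)) ` sq_reps j"
      by (auto elim!: dvdE simp del: of_nat_mult)
    moreover have "inj_on (\<lambda>(x, y). (int p * x, int p * y)) (sq_reps j)"
      using assms by (auto simp: inj_on_def)
    ultimately show ?thesis using j assms by (simp add: card_image card_sq_reps_div_def)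
  next
    case False
    then have "int p * (a\<^sup>2 + b\<^sup>2) \<noteq> int k" for a b by (metis dvd_triv_left int_dvd_int_iff)
    then have "?D = {}" by (auto elim!: dvdE simp: rescale simp del: of_nat_mult)
    then show ?thesis using False by (simp only: card.empty card_sq_reps_div_def if_False)
  qed
qed

lemma card_sq_reps_3mod4:
  assumes "prime p" "p mod 4 = 3"
  shows "card (sq_reps (p * k)) = card_sq_reps_div k p"
proof -
  have "int p dvd x \<and> int p dvd y" if "(x, y) \<in> sq_reps (p * k)" for x y
  proof -
    have "int p dvd x\<^sup>2 + y\<^sup>2" using that by simp
    then show ?thesis using prime_3mod4_dvd_sum_squares[OF assms] by blast
  qed
  then have "{(x, y) \<in> sq_reps (p * k). int p dvd x \<and> int p dvd y} = sq_reps (p * k)" by blast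
  then show ?thesis using card_sq_reps_dvd_both[of p k] prime_gt_0_nat[OF assms(1)] by simp
qed

lemma prime_sum_squares_not_dvd:
  fixes u v :: int
  assumes "prime p" "u\<^sup>2 + v\<^sup>2 = int p"
  shows "\<not> int p dvd u"
proof
  assume u: "int p dvd u"
  have "int p dvd v\<^sup>2"
    using u assms(2) dvd_add_right_iff[of "int p" "u\<^sup>2" "v\<^sup>2"] by (simp add: power2_eq_square)
  then have "int p dvd v" using assms(1) by (simp add: prime_dvd_power_iff)
  with u have "(int p)\<^sup>2 dvd u\<^sup>2 + v\<^sup>2" by (intro dvd_add) simp_all
  then have "int p dvd 1" using assms prime_gt_0_nat[of p] by (simp add: power2_eq_square)
  then show False using assms(1) by (simp add: not_prime_unit)
qed

lemma prime_sum_squares_dvd_both_iff: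
  fixes c d x y :: int
  assumes p: "prime p" "p > 2" and cd: "c\<^sup>2 + d\<^sup>2 = int p"
  shows "int p dvd x * c + y * d \<and> int p dvd x * c - y * d \<longleftrightarrow> int p dvd x \<and> int p dvd y"
proof
  assume dvd: "int p dvd x * c + y * d \<and> int p dvd x * c - y * d"
  have "(x * c + y * d) + (x * c - y * d) = 2 * (x * c)"
    "(x * c + y * d) - (x * c - y * d) = 2 * (y * d)" by simp_all
  with dvd have "int p dvd 2 * (x * c)" "int p dvd 2 * (y * d)"
    by (metis dvd_add, metis dvd_diff)
  moreover have "\<not> int p dvd 2" using p(2) zdvd_imp_le[of "int p" 2] by auto
  moreover have "\<not> int p dvd c" "\<not> int p dvd d"
    using prime_sum_squares_not_dvd[OF p(1)] cd add.commute by metis+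
  ultimately show "int p dvd x \<and> int p dvd y" using p(1) by (simp add: prime_dvd_mult_iff)
qed simp

text \<open>
  With \<open>p = c\<^sup>2 + d\<^sup>2\<close>, every representation of \<open>p k\<close> is divisible by \<open>c + d \<i>\<close> or by \<open>c - d \<i>\<close>, and by both
  iff it is divisible by \<open>p\<close>.
\<close>

lemma card_sq_reps_1mod4:
  assumes "p \<in> primes_1mod4"
  shows "card (sq_reps (p * k)) + card_sq_reps_div k p = 2 * card (sq_reps k)"
proof -
  have p: "prime p" "p > 2" "prime (int p)"
    using assms primes_1mod4_gt_2 by (auto simp: primes_1mod4_def)
  obtain c d :: int where cd: "c\<^sup>2 + d\<^sup>2 = int p" using prime_1mod4_sum_squares[OF assms] .
  define A where "A = {(x, y) \<in> sq_reps (p * k). int p dvd x * c + y * d}"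
  define B where "B = {(x, y) \<in> sq_reps (p * k). int p dvd x * c - y * d}"
  have fin: "finite A" "finite B"
    by (auto intro!: finite_subset[OF _ finite_sq_reps[of "p * k"]] simp: A_def B_def)
  have "card A = card (sq_reps k)" unfolding A_def by (rule card_sq_reps_dvd_inner[OF p(1) cd])
  moreover have "card B = card (sq_reps k)"
    using card_sq_reps_dvd_inner[OF p(1), of c "- d" k] cd by (simp add: B_def)
  moreover have "A \<union> B = sq_reps (p * k)"
  proof (intro equalityI subrelI)
    fix x y assume xy: "(x, y) \<in> sq_reps (p * k)"
    then have "x\<^sup>2 + y\<^sup>2 = int p * int k" by simp
    note eqs = this cd
    have "(x * c + y * d) * (x * c - y * d) = x\<^sup>2 * (c\<^sup>2 + d\<^sup>2) - d\<^sup>2 * (x\<^sup>2 + y\<^sup>2)"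
      by (simp add: power2_eq_square algebra_simps)
    also have "\<dots> = int p * (x\<^sup>2 - d\<^sup>2 * int k)" unfolding eqs by (simp add: algebra_simps)
    finally have "int p dvd (x * c + y * d) * (x * c - y * d)" by simp
    then show "(x, y) \<in> A \<union> B" using p(3) xy by (auto simp: A_def B_def prime_dvd_mult_iff)
  qed (auto simp: A_def B_def)
  moreover have "A \<inter> B = {(x, y) \<in> sq_reps (p * k). int p dvd x \<and> int p dvd y}"
    using prime_sum_squares_dvd_both_iff[OF p(1,2) cd] by (auto simp: A_def B_def)
  ultimately show ?thesis
    using card_Un_Int[OF fin] card_sq_reps_dvd_both[of p k] p(2) by simp
qed

lemma card_sq_reps_power_2: "card (sq_reps (2 ^ a * m)) = card (sq_reps m)"
  by (induction a) (simp_all add: mult.assoc card_sq_reps_double)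

lemma card_sq_reps_div_power:
  assumes "p > 0" "\<not> p dvd m"
  shows "card_sq_reps_div (p ^ a * m) p = (if a = 0 then 0 else card (sq_reps (p ^ (a - 1) * m)))"
  using assms by (cases a) (simp_all add: card_sq_reps_div_def mult.assoc)

lemma card_sq_reps_power_1mod4:
  assumes "p \<in> primes_1mod4" "\<not> p dvd m"
  shows "card (sq_reps (p ^ a * m)) = (a + 1) * card (sq_reps m)"
proof (induction a rule: induct_nat_012)
  case 1
  show ?case
    using card_sq_reps_1mod4[OF assms(1), of m] assms(2) by (simp add: card_sq_reps_div_def)
next
  case (ge2 a)
  have "p > 0" using primes_1mod4_gt_2[OF assms(1)] by simp
  then show ?case
    using card_sq_reps_1mod4[OF assms(1), of "p ^ Suc a * m"] ge2
      card_sq_reps_div_power[OF _ assms(2), of "Suc a"]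
    by (simp add: mult.assoc algebra_simps)
qed simp

lemma card_sq_reps_power_3mod4:
  assumes "prime p" "p mod 4 = 3" "\<not> p dvd m"
  shows "card (sq_reps (p ^ a * m)) = (if even a then card (sq_reps m) else 0)"
proof (induction a rule: induct_nat_012)
  case 1
  show ?case
    using card_sq_reps_3mod4[OF assms(1,2), of m] assms(3) by (simp add: card_sq_reps_div_def)
next
  case (ge2 a)
  then show ?case
    using card_sq_reps_3mod4[OF assms(1,2), of "p ^ Suc a * m"] prime_gt_0_nat[OF assms(1)]
      card_sq_reps_div_power[OF _ assms(3), of "Suc a"]
    by (simp add: mult.assoc)
qed simp

text \<open>The number of divisors of \<open>n\<close> all of whose prime factors are \<open>1\<close> modulo \<open>4\<close>.\<close>

definition split_divisor_count :: "nat \<Rightarrow> nat" where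
  "split_divisor_count n = (\<Prod>p\<in>prime_factors n \<inter> primes_1mod4. multiplicity p n + 1)"

lemma split_divisor_count_pos: "split_divisor_count n > 0"
  unfolding split_divisor_count_def by (intro prod_pos) auto

lemma split_divisor_count_eq_prod:
  assumes "finite A" "A \<subseteq> primes_1mod4" "prime_factors n \<inter> primes_1mod4 \<subseteq> A" "n > 0"
  shows "split_divisor_count n = (\<Prod>p\<in>A. multiplicity p n + 1)"
  unfolding split_divisor_count_def
proof (rule prod.mono_neutral_left[OF assms(1,3)], rule ballI)
  fix p assume "p \<in> A - prime_factors n \<inter> primes_1mod4"
  then have "\<not> p dvd n" using assms(2,4) primes_1mod4_prime by (auto simp: in_prime_factors_iff)
  then show "multiplicity p n + 1 = 1" by (simp add: not_dvd_imp_multiplicity_0)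
qed

lemma prime_factors_prime_power_mult:
  fixes p m :: nat
  assumes "prime p" "m > 0"
  shows "prime_factors (p ^ a * m) = (if a = 0 then {} else {p}) \<union> prime_factors m"
  using assms prime_gt_0_nat[OF assms(1)]
  by (simp add: prime_factors_product prime_factors_power prime_prime_factors)

lemma split_divisor_count_prime_power_mult:
  assumes "prime p" "\<not> p dvd m" "m > 0"
  shows "split_divisor_count (p ^ a * m) =
    (if p \<in> primes_1mod4 then a + 1 else 1) * split_divisor_count m"
proof -
  have pos: "p ^ a * m > 0" using assms(1,3) prime_gt_0_nat by simp
  define A where "A = prime_factors m \<inter> primes_1mod4"
  have p_notin_A: "p \<notin> A" using assms(2) by (auto simp: A_def)
  have mult_p: "multiplicity p (p ^ a * m) = a"
    using assms by (simp add: prime_elem_multiplicity_mult_distrib not_dvd_imp_multiplicity_0)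
  have "multiplicity q (p ^ a * m) = multiplicity q m" if "q \<in> A" for q
  proof -
    have "prime q" "q \<noteq> p" using that p_notin_A by (auto simp: A_def in_prime_factors_iff)
    then show ?thesis
      using assms by (simp add: prime_elem_multiplicity_mult_distrib multiplicity_distinct_prime_power)
  qed
  then have prod_A: "(\<Prod>q\<in>A. multiplicity q (p ^ a * m) + 1) = split_divisor_count m"
    by (simp add: split_divisor_count_def A_def)
  have sub: "prime_factors (p ^ a * m) \<subseteq> insert p (prime_factors m)"
    using prime_factors_prime_power_mult[OF assms(1,3)] by auto
  show ?thesis
  proof (cases "p \<in> primes_1mod4")
    case True
    then have "split_divisor_count (p ^ a * m) = (\<Prod>q\<in>insert p A. multiplicity q (p ^ a * m) + 1)"
      using sub by (intro split_divisor_count_eq_prod pos) (auto simp: A_def)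
    then show ?thesis using True p_notin_A prod_A mult_p by (simp add: A_def)
  next
    case False
    then have "split_divisor_count (p ^ a * m) = (\<Prod>q\<in>A. multiplicity q (p ^ a * m) + 1)"
      using sub by (intro split_divisor_count_eq_prod pos) (auto simp: A_def)
    then show ?thesis using False prod_A by simp
  qed
qed

definition inert_odd :: "nat \<Rightarrow> bool" where
  "inert_odd n \<longleftrightarrow> (\<exists>p\<in>prime_factors n. p mod 4 = 3 \<and> odd (multiplicity p n))"

lemma inert_odd_prime_power_mult:
  assumes "prime p" "\<not> p dvd m" "m > 0"
  shows "inert_odd (p ^ a * m) \<longleftrightarrow> p mod 4 = 3 \<and> odd a \<or> inert_odd m"
proof -
  have "multiplicity p (p ^ a * m) = a"
    using assms by (simp add: prime_elem_multiplicity_mult_distrib not_dvd_imp_multiplicity_0)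
  moreover have "multiplicity q (p ^ a * m) = multiplicity q m" if "q \<in> prime_factors m" for q
  proof -
    have "prime q" "q \<noteq> p" using that assms(2) by (auto simp: in_prime_factors_iff)
    then show ?thesis using assms
      by (simp add: prime_elem_multiplicity_mult_distrib multiplicity_distinct_prime_power)
  qed
  ultimately show ?thesis
    unfolding inert_odd_def prime_factors_prime_power_mult[OF assms(1,3)] by auto
qed

theorem jacobi_two_squares:
  assumes "n > 0"
  shows "card (sq_reps n) = (if inert_odd n then 0 else 4 * split_divisor_count n)"
  using assms
proof (induction n rule: less_induct)
  case (less n)
  show ?case
  proof (cases "n = 1")
    case True
    then show ?thesis using card_sq_reps_1 by (simp add: split_divisor_count_def inert_odd_def)
  next
    case False
    then obtain p where p: "prime p" "p dvd n" using prime_factor_nat by blast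
    define a where "a = multiplicity p n"
    have "a > 0" using p less.prems by (simp add: a_def prime_multiplicity_gt_zero_iff)
    obtain m where n: "n = p ^ a * m" and m: "\<not> p dvd m"
      using multiplicity_decompose'[of n p] less.prems p(1) unfolding a_def
      by (metis not_prime_unit bot_nat_0.not_eq_extremum)
    have m_pos: "m > 0" using n less.prems by (cases m) auto
    have "p ^ a > 1" using \<open>a > 0\<close> p(1) by (metis one_less_power prime_gt_1_nat)
    then have "m < n" using m_pos n by simp
    note IH = less.IH[OF this m_pos]
    note inert = inert_odd_prime_power_mult[OF p(1) m m_pos, of a]
    note count = split_divisor_count_prime_power_mult[OF p(1) m m_pos, of a]
    from p(1) show ?thesis
    proof (cases rule: prime_mod_4_cases)
      assume "p = 2"
      then show ?thesis unfolding n inert count using IH card_sq_reps_power_2[of a m] by (simp add: primes_1mod4_def)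
    next
      assume "p mod 4 = 1"
      then show ?thesis unfolding n inert count using IH card_sq_reps_power_1mod4[of p m a] m p(1) by (simp add: primes_1mod4_def)
    next
      assume "p mod 4 = 3"
      then show ?thesis unfolding n inert count using IH card_sq_reps_power_3mod4[of p m a] m p(1) by (simp add: primes_1mod4_def)
    qed
  qed
qed

lemma delta_eq_split_divisor_count:
  assumes "n > 0" "delta n \<noteq> 0 \<or> prime_factors n \<subseteq> primes_1mod4"
  shows "delta n = of_nat (split_divisor_count n)"
proof -
  have "\<not> inert_odd n"
  proof
    assume inert: "inert_odd n"
    then have "delta n = 0" using jacobi_two_squares[OF assms(1)] by (simp add: delta_sq_reps)
    then have "prime_factors n \<subseteq> primes_1mod4" using assms(2) by simp
    then show False using inert by (auto simp: inert_odd_def primes_1mod4_def)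
  qed
  then show ?thesis using jacobi_two_squares[OF assms(1)] by (simp add: delta_sq_reps)
qed

lemma prod_prime_powers_multiplicity_le:
  fixes k :: nat
  assumes "k > 0" "finite A" "\<And>q. q \<in> A \<Longrightarrow> prime q"
  shows "(\<Prod>q\<in>A. q ^ multiplicity q k) \<le> k"
proof -
  have "(\<Prod>q\<in>A. q ^ multiplicity q k) = (\<Prod>q\<in>A \<inter> prime_factors k. q ^ multiplicity q k)"
  proof (rule prod.mono_neutral_right, goal_cases)
    case 3
    then show ?case
      using assms(1,3) by (auto simp: prime_factors_multiplicity)
  qed (use assms in auto)
  also have "\<dots> dvd (\<Prod>q\<in>prime_factors k. q ^ multiplicity q k)" by (intro prod_dvd_prod_subset) auto
  also have "\<dots> = k" using assms(1) prime_factorization_nat[of k] by simp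
  finally show ?thesis using assms(1) by (intro dvd_imp_le) auto
qed

lemma split_divisor_count_le:
  assumes "n > 0"
  shows "split_divisor_count n \<le> n"
proof -
  have "split_divisor_count n \<le> (\<Prod>q\<in>prime_factors n \<inter> primes_1mod4. q ^ multiplicity q n)"
    unfolding split_divisor_count_def
  proof (rule prod_mono)
    fix q assume "q \<in> prime_factors n \<inter> primes_1mod4"
    then have "q \<ge> 2" using primes_1mod4_gt_2 by force
    have "multiplicity q n < 2 ^ multiplicity q n" by (rule less_exp)
    also have "\<dots> \<le> q ^ multiplicity q n" using \<open>q \<ge> 2\<close> by (rule power_mono) simp
    finally show "0 \<le> multiplicity q n + 1 \<and> multiplicity q n + 1 \<le> q ^ multiplicity q n" by simp
  qed
  also have "\<dots> \<le> n"
    using assms primes_1mod4_prime by (intro prod_prime_powers_multiplicity_le) auto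
  finally show ?thesis .
qed

lemma split_divisor_count_mult_le:
  assumes "m > 0" "n > 0"
  shows "split_divisor_count (m * n) \<le> split_divisor_count m * split_divisor_count n"
proof -
  define A where "A = (prime_factors m \<union> prime_factors n) \<inter> primes_1mod4"
  have A: "finite A" "A \<subseteq> primes_1mod4" by (auto simp: A_def)
  have "split_divisor_count (m * n) = (\<Prod>p\<in>A. multiplicity p (m * n) + 1)"
    using assms by (intro split_divisor_count_eq_prod A) (auto simp: A_def prime_factors_product)
  also have "\<dots> \<le> (\<Prod>p\<in>A. (multiplicity p m + 1) * (multiplicity p n + 1))"
  proof (rule prod_mono)
    fix p assume "p \<in> A"
    then have "prime p" using A(2) primes_1mod4_prime by blast
    then have "multiplicity p (m * n) = multiplicity p m + multiplicity p n"
      using assms by (simp add: prime_elem_multiplicity_mult_distrib)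
    then show "0 \<le> multiplicity p (m * n) + 1 \<and>
        multiplicity p (m * n) + 1 \<le> (multiplicity p m + 1) * (multiplicity p n + 1)"
      by simp
  qed
  also have "\<dots> = (\<Prod>p\<in>A. multiplicity p m + 1) * (\<Prod>p\<in>A. multiplicity p n + 1)" by (rule prod.distrib)
  also have "(\<Prod>p\<in>A. multiplicity p m + 1) = split_divisor_count m"
    using assms by (intro split_divisor_count_eq_prod[symmetric] A) (auto simp: A_def)
  also have "(\<Prod>p\<in>A. multiplicity p n + 1) = split_divisor_count n"
    using assms by (intro split_divisor_count_eq_prod[symmetric] A) (auto simp: A_def)
  finally show ?thesis .
qed

lemma prod_prime_powers_pos:
  fixes e :: "nat \<Rightarrow> nat"
  assumes "A \<subseteq> primes_1mod4"
  shows "(\<Prod>q\<in>A. q ^ e q) > 0"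
  using assms primes_1mod4_gt_2 by (intro prod_pos) force

lemma
  assumes A: "finite A" "A \<subseteq> primes_1mod4"
  shows prime_factors_prod_split_primes: "prime_factors (\<Prod>q\<in>A. q ^ e q) \<subseteq> A"
    and split_divisor_count_prod_split_primes: "split_divisor_count (\<Prod>q\<in>A. q ^ e q) = (\<Prod>q\<in>A. e q + 1)"
proof -
  have mult: "multiplicity p (\<Prod>q\<in>A. q ^ e q) = (if p \<in> A then e p else 0)" if "prime p" for p
    using A primes_1mod4_prime that by (intro multiplicity_prod_prime_powers) auto
  show sub: "prime_factors (\<Prod>q\<in>A. q ^ e q) \<subseteq> A"
  proof
    fix p assume "p \<in> prime_factors (\<Prod>q\<in>A. q ^ e q)"
    then have "prime p" "multiplicity p (\<Prod>q\<in>A. q ^ e q) > 0" by (auto simp: prime_factors_multiplicity)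
    then show "p \<in> A" using mult by (auto split: if_splits)
  qed
  have "split_divisor_count (\<Prod>q\<in>A. q ^ e q) = (\<Prod>p\<in>A. multiplicity p (\<Prod>q\<in>A. q ^ e q) + 1)"
    using sub prod_prime_powers_pos[OF A(2)] by (intro split_divisor_count_eq_prod A) auto
  also have "\<dots> = (\<Prod>p\<in>A. e p + 1)"
    using A(2) primes_1mod4_prime mult by (intro prod.cong) auto
  finally show "split_divisor_count (\<Prod>q\<in>A. q ^ e q) = (\<Prod>q\<in>A. e q + 1)" .
qed

section \<open>Dirichlet series\<close>

definition dterm :: "(nat \<Rightarrow> real) \<Rightarrow> nat \<Rightarrow> complex \<Rightarrow> complex" where
  "dterm a n s = of_real (a n) * of_nat n powr (- s)"

definition dseries :: "(nat \<Rightarrow> real) \<Rightarrow> complex \<Rightarrow> complex" where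
  "dseries a s = (\<Sum>n. dterm a n s)"

definition abs_conv_gt1 :: "(nat \<Rightarrow> real) \<Rightarrow> bool" where
  "abs_conv_gt1 a \<longleftrightarrow> (\<forall>\<sigma>>1. summable (\<lambda>n. \<bar>a n\<bar> * real n powr (- \<sigma>)))"

lemma abs_conv_gt1D: "abs_conv_gt1 a \<Longrightarrow> \<sigma> > 1 \<Longrightarrow> summable (\<lambda>n. \<bar>a n\<bar> * real n powr (- \<sigma>))"
  by (simp add: abs_conv_gt1_def)

lemma norm_nat_powr: "norm (of_nat n powr s :: complex) = real n powr Re s"
proof (cases "n = 0")
  case False
  then show ?thesis
    using norm_powr_real_powr[of "of_nat n" s] by simp
qed simp

lemma nat_mult_powr: "of_nat (m * n) powr s = of_nat m powr s * (of_nat n powr s :: complex)"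
  using powr_times_real[of "of_nat m" "of_nat n" s] by simp

lemma Re_nat_powr: "Re (of_nat n powr (- s)) = real n powr (- Re s) * cos (Im s * ln (real n))"
proof (cases "n = 0")
  case False
  then have "Ln (of_nat n) = of_real (ln (real n))" using Ln_of_real[of "real n"] by simp
  then show ?thesis using False by (simp add: powr_def Re_exp mult.commute)
qed simp

lemma dterm_0 [simp]: "dterm a 0 s = 0"
  by (simp add: dterm_def)

lemma norm_dterm: "norm (dterm a n s) = \<bar>a n\<bar> * real n powr (- Re s)"
  by (simp add: dterm_def norm_mult norm_nat_powr)

lemma Re_dterm: "Re (dterm a n s) = a n * (real n powr (- Re s) * cos (Im s * ln (real n)))"
  by (simp add: dterm_def Re_nat_powr)

lemma norm_dterm_le:
  assumes "\<sigma> \<le> Re s"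
  shows "norm (dterm a n s) \<le> \<bar>a n\<bar> * real n powr (- \<sigma>)"
proof (cases "n = 0")
  case False
  then show ?thesis unfolding norm_dterm using assms by (intro mult_left_mono powr_mono) auto
qed simp

lemma dterm_has_field_derivative:
  "(dterm a n has_field_derivative - dterm (\<lambda>n. a n * ln (real n)) n s) (at s)"
proof (cases "n = 0")
  case False
  have "Ln (of_nat n) = of_real (ln (real n))" using False Ln_of_real[of "real n"] by simp
  then show ?thesis unfolding dterm_def[abs_def] powr_def
    using False by (auto intro!: derivative_eq_intros)
qed (simp add: dterm_def[abs_def])

lemma abs_conv_gt1_bound:
  assumes "\<And>n. n > 0 \<Longrightarrow> \<bar>a n\<bar> \<le> \<bar>b n\<bar>" "abs_conv_gt1 b"
  shows "abs_conv_gt1 a"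
  unfolding abs_conv_gt1_def
proof (intro allI impI)
  fix \<sigma> :: real assume "\<sigma> > 1"
  from abs_conv_gt1D[OF assms(2) this]
  show "summable (\<lambda>n. \<bar>a n\<bar> * real n powr (- \<sigma>))"
  proof (rule summable_comparison_test'[where N = 0])
    fix n :: nat show "norm (\<bar>a n\<bar> * real n powr (- \<sigma>)) \<le> \<bar>b n\<bar> * real n powr (- \<sigma>)"
      using assms(1)[of n] by (cases "n = 0") (auto intro!: mult_right_mono)
  qed
qed

lemma abs_conv_gt1_const: "abs_conv_gt1 (\<lambda>_. c)"
  unfolding abs_conv_gt1_def by (auto intro!: summable_mult simp: summable_real_powr_iff)

lemma abs_conv_gt1_bounded: "(\<And>n. \<bar>f n\<bar> \<le> 1) \<Longrightarrow> abs_conv_gt1 f"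
  by (rule abs_conv_gt1_bound[OF _ abs_conv_gt1_const[of 1]]) auto

lemma abs_conv_gt1_add:
  assumes "abs_conv_gt1 a" "abs_conv_gt1 b"
  shows "abs_conv_gt1 (\<lambda>n. a n + b n)"
proof -
  have "abs_conv_gt1 (\<lambda>n. \<bar>a n\<bar> + \<bar>b n\<bar>)"
    unfolding abs_conv_gt1_def
    using assms by (auto simp: abs_conv_gt1_def distrib_right intro!: summable_add)
  then show ?thesis by (rule abs_conv_gt1_bound[rotated]) auto
qed

lemma abs_conv_gt1_ln:
  assumes "abs_conv_gt1 a"
  shows "abs_conv_gt1 (\<lambda>n. a n * ln (real n))"
  unfolding abs_conv_gt1_def
proof (intro allI impI)
  fix \<sigma> :: real assume s: "\<sigma> > 1"
  define d where "d = (\<sigma> - 1) / 2"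
  have d: "d > 0" "\<sigma> - d > 1" using s by (auto simp: d_def field_simps)
  have "summable (\<lambda>n. \<bar>a n\<bar> * real n powr (- (\<sigma> - d)) / d)"
    by (intro summable_divide abs_conv_gt1D[OF assms d(2)])
  then show "summable (\<lambda>n. \<bar>a n * ln (real n)\<bar> * real n powr (- \<sigma>))"
  proof (rule summable_comparison_test'[where N = 0])
    fix n :: nat
    show "norm (\<bar>a n * ln (real n)\<bar> * real n powr (- \<sigma>)) \<le> \<bar>a n\<bar> * real n powr (- (\<sigma> - d)) / d"
    proof (cases "n = 0")
      case False
      have "\<bar>ln (real n)\<bar> * real n powr (- \<sigma>) \<le> real n powr d / d * real n powr (- \<sigma>)"
        using ln_powr_bound[of "real n" d] d False by (intro mult_right_mono) auto
      also have "\<dots> = real n powr (- (\<sigma> - d)) / d" by (simp add: powr_diff powr_minus field_simps)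
      finally have "\<bar>a n\<bar> * (\<bar>ln (real n)\<bar> * real n powr (- \<sigma>)) \<le> \<bar>a n\<bar> * (real n powr (- (\<sigma> - d)) / d)"
        by (rule mult_left_mono) simp
      then show ?thesis by (simp add: abs_mult mult.assoc)
    qed simp
  qed
qed

lemma dseries_summable:
  assumes "abs_conv_gt1 a" "Re s > 1"
  shows "summable (\<lambda>n. norm (dterm a n s))"
  unfolding norm_dterm by (rule abs_conv_gt1D[OF assms])

lemma dseries_sums:
  assumes "abs_conv_gt1 a" "Re s > 1"
  shows "(\<lambda>n. dterm a n s) sums dseries a s"
  unfolding dseries_def by (rule summable_sums[OF summable_norm_cancel[OF dseries_summable[OF assms]]])

lemma dseries_has_sum:
  assumes "abs_conv_gt1 a" "Re s > 1"
  shows "((\<lambda>n. dterm a n s) has_sum dseries a s) UNIV"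
  by (rule norm_summable_imp_has_sum[OF dseries_summable[OF assms] dseries_sums[OF assms]])

lemma dseries_add:
  assumes "abs_conv_gt1 a" "abs_conv_gt1 b" "Re s > 1"
  shows "dseries (\<lambda>n. a n + b n) s = dseries a s + dseries b s"
  using sums_add[OF dseries_sums[OF assms(1,3)] dseries_sums[OF assms(2,3)]]
  by (simp add: dseries_def[of "\<lambda>n. a n + b n"] dterm_def distrib_right sums_iff)

lemma dseries_minus:
  assumes "abs_conv_gt1 a" "Re s > 1"
  shows "dseries (\<lambda>n. - a n) s = - dseries a s"
  using sums_minus[OF dseries_sums[OF assms]]
  by (simp add: dseries_def[of "\<lambda>n. - a n"] dterm_def sums_iff)

lemma dseries_deriv:
  assumes a: "abs_conv_gt1 a" and s: "Re s > 1"
  shows "(dseries a has_field_derivative - dseries (\<lambda>n. a n * ln (real n)) s) (at s)"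
proof -
  define S where "S = {s. Re s > 1}"
  let ?f' = "\<lambda>n s. - dterm (\<lambda>n. a n * ln (real n)) n s"
  have S: "open S" unfolding S_def by (rule open_halfspace_Re_gt)
  have "\<exists>g g'. \<forall>z\<in>S. ((\<lambda>n. dterm a n z) sums g z) \<and> ((\<lambda>n. ?f' n z) sums g' z) \<and>
    (g has_field_derivative g' z) (at z)"
  proof (rule series_and_derivative_comparison_local[OF S])
    fix z assume z: "z \<in> S"
    define d where "d = (Re z - 1) / 2"
    have d: "d > 0" "Re z - d > 1" using z by (auto simp: S_def d_def field_simps)
    have "norm (dterm a n y) \<le> \<bar>a n\<bar> * real n powr (- (Re z - d))" if "y \<in> ball z d" for n y
    proof (rule norm_dterm_le)
      have "\<bar>Re z - Re y\<bar> \<le> norm (z - y)" using abs_Re_le_cmod[of "z - y"] by simp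
      then show "Re z - d \<le> Re y" using that by (auto simp: dist_norm)
    qed
    then show "\<exists>d h. 0 < d \<and> summable h \<and> (\<forall>\<^sub>F n in sequentially. \<forall>y\<in>ball z d \<inter> S. norm (dterm a n y) \<le> h n)"
      using d(1) abs_conv_gt1D[OF a d(2)]
      by (intro exI[of _ d] exI[of _ "\<lambda>n. \<bar>a n\<bar> * real n powr (- (Re z - d))"]) auto
  qed (rule dterm_has_field_derivative)
  then obtain g g' where g: "\<And>z. z \<in> S \<Longrightarrow> (\<lambda>n. dterm a n z) sums g z"
    "\<And>z. z \<in> S \<Longrightarrow> (\<lambda>n. ?f' n z) sums g' z" "\<And>z. z \<in> S \<Longrightarrow> (g has_field_derivative g' z) (at z)"
    by metis
  have s_in_S: "s \<in> S" using s by (simp add: S_def)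
  have "g' s = - dseries (\<lambda>n. a n * ln (real n)) s"
    using g(2)[OF s_in_S] sums_minus[OF dseries_sums[OF abs_conv_gt1_ln[OF a] s]] by (rule sums_unique2)
  then have "(g has_field_derivative - dseries (\<lambda>n. a n * ln (real n)) s) (at s)"
    using g(3)[OF s_in_S] by simp
  then show ?thesis
    by (rule has_field_derivative_transform_within_open[OF _ S s_in_S]) (use g(1) in \<open>simp add: dseries_def sums_iff\<close>)
qed

lemma summable_on_times:
  fixes F :: "'a \<Rightarrow> complex" and G :: "'b \<Rightarrow> complex"
  assumes "(\<lambda>x. norm (F x)) summable_on A" "(\<lambda>y. norm (G y)) summable_on B"
  shows "(\<lambda>(x, y). F x * G y) summable_on A \<times> B"
proof (rule abs_summable_summable)
  show "(\<lambda>z. norm (case z of (x, y) \<Rightarrow> F x * G y)) summable_on A \<times> B"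
    unfolding Infinite_Sum.abs_summable_on_Sigma_iff using assms
    by (auto simp: norm_mult infsum_cmult_right' abs_mult abs_of_nonneg[OF infsum_nonneg]
        intro!: summable_on_cmult_left summable_on_cmult_right)
qed

definition dirichlet_conv :: "(nat \<Rightarrow> real) \<Rightarrow> (nat \<Rightarrow> real) \<Rightarrow> nat \<Rightarrow> real" where
  "dirichlet_conv a b n = (\<Sum>d | d dvd n. a d * b (n div d))"

lemma dseries_dirichlet_conv:
  assumes a: "abs_conv_gt1 a" and b: "abs_conv_gt1 b" and s: "Re s > 1"
  shows "dseries (dirichlet_conv a b) s = dseries a s * dseries b s"
proof -
  let ?P = "dseries a s * dseries b s"
  have "((\<lambda>(d, m). dterm a d s * dterm b m s) has_sum ?P) (UNIV \<times> UNIV)"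
  proof (rule has_sum_SigmaI)
    show "(\<lambda>(d, m). dterm a d s * dterm b m s) summable_on UNIV \<times> UNIV"
      using dseries_summable[OF a s] dseries_summable[OF b s]
      by (intro summable_on_times norm_summable_imp_summable_on) auto
    show "((\<lambda>m. case (d, m) of (d, m) \<Rightarrow> dterm a d s * dterm b m s) has_sum dterm a d s * dseries b s) UNIV" for d
      using has_sum_cmult_right[OF dseries_has_sum[OF b s]] by simp
    show "((\<lambda>d. dterm a d s * dseries b s) has_sum ?P) UNIV"
      by (rule has_sum_cmult_left[OF dseries_has_sum[OF a s]])
  qed
  also have "?this \<longleftrightarrow> ((\<lambda>(d, m). dterm a d s * dterm b m s) has_sum ?P) ({0<..} \<times> {0<..})"
    by (rule has_sum_cong_neutral) (auto intro!: gr0I)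
  also have "\<dots> \<longleftrightarrow> ((\<lambda>(n, d). of_real (a d * b (n div d)) * of_nat n powr (- s)) has_sum ?P)
      (Sigma {0<..} (\<lambda>n. {d. d dvd n}))"
    by (rule has_sum_reindex_bij_witness[where i = "\<lambda>(n, d). (d, n div d)" and j = "\<lambda>(d, m). (d * m, d)"])
       (auto elim!: dvdE simp: dterm_def nat_mult_powr simp del: of_nat_mult)
  finally have "((\<lambda>n. \<Sum>d | d dvd n. of_real (a d * b (n div d)) * of_nat n powr (- s)) has_sum ?P) {0<..}"
    by (rule has_sum_SigmaD) (auto intro!: has_sum_finite)
  also have "?this \<longleftrightarrow> ((\<lambda>n. dterm (dirichlet_conv a b) n s) has_sum ?P) UNIV"
    by (rule has_sum_cong_neutral) (auto simp: dterm_def dirichlet_conv_def sum_distrib_right)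
  finally show ?thesis unfolding dseries_def by (intro sums_unique[symmetric] has_sum_imp_sums)
qed

lemma mangoldt_le_ln: "n > 0 \<Longrightarrow> \<bar>mangoldt n :: real\<bar> \<le> \<bar>ln (real n)\<bar>"
  using mangoldt_le[of n] mangoldt_nonneg[of n] by simp

lemma abs_mult_mangoldt_le:
  assumes "\<bar>c\<bar> \<le> 1" "n > 0"
  shows "\<bar>c * mangoldt n\<bar> \<le> \<bar>ln (real n)\<bar>"
  using mult_mono[OF assms(1) mangoldt_le_ln[OF assms(2)]] mangoldt_nonneg[of n] by (simp add: abs_mult)

lemma abs_conv_gt1_mangoldt:
  assumes "\<And>n. \<bar>f n\<bar> \<le> 1"
  shows "abs_conv_gt1 (\<lambda>n. f n * mangoldt n)"
proof (rule abs_conv_gt1_bound)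
  show "abs_conv_gt1 (\<lambda>n. 1 * ln (real n))" by (intro abs_conv_gt1_ln abs_conv_gt1_const)
  show "\<bar>f n * mangoldt n\<bar> \<le> \<bar>1 * ln (real n)\<bar>" if "n > 0" for n
    using abs_mult_mangoldt_le[OF assms that] by simp
qed

lemma abs_conv_gt1_mangoldt_div_ln:
  assumes "\<And>n. \<bar>f n\<bar> \<le> 1"
  shows "abs_conv_gt1 (\<lambda>n. f n * mangoldt n / ln (real n))"
proof (rule abs_conv_gt1_bounded)
  fix n :: nat
  show "\<bar>f n * mangoldt n / ln (real n)\<bar> \<le> 1"
    using abs_mult_mangoldt_le[OF assms, of n n] by (cases "n = 0") (auto simp: divide_le_eq_1)
qed

locale bounded_completely_multiplicative =
  fixes f :: "nat \<Rightarrow> real"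
  assumes mult: "f (m * n) = f m * f n" and abs_le_1: "\<bar>f n\<bar> \<le> 1"
begin

lemma abs_conv: "abs_conv_gt1 f"
  by (rule abs_conv_gt1_bounded[OF abs_le_1])

lemma dseries_mangoldt:
  assumes "Re s > 1"
  shows "dseries (\<lambda>n. f n * mangoldt n) s * dseries f s = dseries (\<lambda>n. f n * ln (real n)) s"
proof -
  have "dirichlet_conv (\<lambda>n. f n * mangoldt n) f n = f n * ln (real n)" if "n > 0" for n
  proof -
    have "dirichlet_conv (\<lambda>n. f n * mangoldt n) f n = (\<Sum>d | d dvd n. f n * mangoldt d)"
      unfolding dirichlet_conv_def by (intro sum.cong) (auto simp flip: mult elim!: dvdE)
    also have "\<dots> = f n * ln (real n)"
      using mangoldt_sum[of n, where ?'a = real] that by (simp flip: sum_distrib_left)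
    finally show ?thesis .
  qed
  then have "dterm (dirichlet_conv (\<lambda>n. f n * mangoldt n) f) n s = dterm (\<lambda>n. f n * ln (real n)) n s" for n
    by (cases "n = 0") (auto simp: dterm_def)
  then have "dseries (dirichlet_conv (\<lambda>n. f n * mangoldt n) f) s = dseries (\<lambda>n. f n * ln (real n)) s"
    by (simp add: dseries_def)
  then show ?thesis
    using dseries_dirichlet_conv[OF abs_conv_gt1_mangoldt[of f, OF abs_le_1] abs_conv assms] by simp
qed

lemma dseries_eq_exp:
  obtains K where "\<And>s. Re s > 1 \<Longrightarrow> dseries f s = K * exp (dseries (\<lambda>n. f n * mangoldt n / ln (real n)) s)"
proof -
  define b where "b = (\<lambda>n. f n * mangoldt n / ln (real n))"
  have abs_conv_b: "abs_conv_gt1 b" unfolding b_def by (rule abs_conv_gt1_mangoldt_div_ln[OF abs_le_1])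
  have bl: "b n * ln (real n) = f n * mangoldt n" for n
    by (cases "n = 0 \<or> n = 1") (auto simp: b_def)
  define h where "h = (\<lambda>s. dseries f s * exp (- dseries b s))"
  have "(h has_field_derivative 0) (at s within {s. Re s > 1})" if "Re s > 1" for s
  proof -
    have "(h has_field_derivative - dseries (\<lambda>n. f n * ln (real n)) s * exp (- dseries b s)
          + dseries f s * (exp (- dseries b s) * dseries (\<lambda>n. b n * ln (real n)) s)) (at s)"
      unfolding h_def
      by (rule derivative_eq_intros refl dseries_deriv abs_conv_b abs_conv that | simp)+
    moreover have "- dseries (\<lambda>n. f n * ln (real n)) s * exp (- dseries b s)
          + dseries f s * (exp (- dseries b s) * dseries (\<lambda>n. b n * ln (real n)) s) = 0"
      unfolding bl dseries_mangoldt[OF that, symmetric] by (simp add: algebra_simps)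
    ultimately have "(h has_field_derivative 0) (at s)" by (simp only:)
    then show ?thesis by (rule has_field_derivative_at_within)
  qed
  then obtain K where K: "\<And>s. Re s > 1 \<Longrightarrow> h s = K"
    using has_field_derivative_zero_constant[OF convex_halfspace_Re_gt[of 1], of h] by auto
  show ?thesis
  proof (rule that)
    fix s :: complex assume "Re s > 1"
    then show "dseries f s = K * exp (dseries (\<lambda>n. f n * mangoldt n / ln (real n)) s)"
      using K[of s] unfolding h_def b_def by (simp add: exp_minus field_simps)
  qed
qed

end

lemma dseries_of_real_pos:
  assumes "abs_conv_gt1 a" "\<And>n. a n \<ge> 0" "a 1 > 0" "\<sigma> > 1"
  shows "Re (dseries a (of_real \<sigma>)) > 0"
proof -
  have "(\<lambda>n. a n * real n powr (- \<sigma>)) sums Re (dseries a (of_real \<sigma>))"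
    using sums_Re[OF dseries_sums[OF assms(1), of "of_real \<sigma>"]] assms(4) by (simp add: Re_dterm)
  then show ?thesis
    using suminf_pos2[of "\<lambda>n. a n * real n powr (- \<sigma>)" 1] assms(2,3) by (auto simp: sums_iff)
qed

text \<open>The inequality is \<open>3 + 4 cos \<theta> + cos 2\<theta> = 2 (1 + cos \<theta>)\<^sup>2 \<ge> 0\<close>, applied to each term.\<close>

lemma dseries_341:
  assumes b: "abs_conv_gt1 b" "\<And>n. b n \<ge> 0" and \<sigma>: "\<sigma> > 1"
  shows "3 * Re (dseries b (of_real \<sigma>)) + 4 * Re (dseries b (Complex \<sigma> t)) + Re (dseries b (Complex \<sigma> (2 * t))) \<ge> 0"
proof -
  have cos_sums: "(\<lambda>n. b n * (real n powr (- \<sigma>) * cos (u * ln (real n)))) sums Re (dseries b (Complex \<sigma> u))" for u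
    using sums_Re[OF dseries_sums[OF b(1), of "Complex \<sigma> u"]] \<sigma> by (simp add: Re_dterm)
  have "(\<lambda>n. 3 * (b n * (real n powr (- \<sigma>) * cos (0 * ln (real n)))) + 4 * (b n * (real n powr (- \<sigma>) * cos (t * ln (real n))))
      + b n * (real n powr (- \<sigma>) * cos ((2 * t) * ln (real n)))) sums
     (3 * Re (dseries b (Complex \<sigma> 0)) + 4 * Re (dseries b (Complex \<sigma> t)) + Re (dseries b (Complex \<sigma> (2 * t))))"
    by (intro sums_add sums_mult cos_sums)
  moreover have "3 * (b n * (real n powr (- \<sigma>) * cos (0 * ln (real n)))) + 4 * (b n * (real n powr (- \<sigma>) * cos (t * ln (real n))))
      + b n * (real n powr (- \<sigma>) * cos ((2 * t) * ln (real n))) \<ge> 0" for n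
  proof -
    define c where "c = cos (t * ln (real n))"
    have cos_2t: "cos ((2 * t) * ln (real n)) = 2 * c\<^sup>2 - 1"
      unfolding c_def using cos_double_cos[of "t * ln (real n)"] by (simp add: mult.assoc)
    have "3 * (b n * (real n powr (- \<sigma>) * cos (0 * ln (real n)))) + 4 * (b n * (real n powr (- \<sigma>) * cos (t * ln (real n))))
      + b n * (real n powr (- \<sigma>) * cos ((2 * t) * ln (real n))) = (b n * real n powr (- \<sigma>)) * (2 * (1 + c)\<^sup>2)"
      unfolding cos_2t c_def[symmetric] by (simp add: power2_eq_square algebra_simps)
    then show ?thesis using b(2)[of n] by simp
  qed
  ultimately have "0 \<le> 3 * Re (dseries b (Complex \<sigma> 0)) + 4 * Re (dseries b (Complex \<sigma> t)) + Re (dseries b (Complex \<sigma> (2 * t)))"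
    by (rule sums_le[OF _ sums_zero, rotated])
  then show ?thesis by (simp add: complex_of_real_def)
qed

section \<open>A Tauberian estimate\<close>

lemma std_normal_density_le_1: "std_normal_density x \<le> 1"
proof -
  have "1 / sqrt (2 * pi) * exp (- (x\<^sup>2) / 2) \<le> 1 * 1"
    using pi_ge_two by (intro mult_mono) (auto simp: divide_simps)
  then show ?thesis by (simp add: std_normal_density_def)
qed

lemma integrable_std_normal_density: "integrable lborel std_normal_density"
  by (rule integrable_normal_density) simp

lemma std_normal_density_eq_fourier:
  "complex_of_real (std_normal_density w) =
    complex_of_real (1 / sqrt (2 * pi)) * (CLINT x|lborel. std_normal_density x *\<^sub>R iexp (w * x))"
proof -
  have "complex_of_real (exp (- (w\<^sup>2) / 2)) = char std_normal_distribution w"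
    by (simp add: char_std_normal_distribution)
  also have "\<dots> = (CLINT x|lborel. std_normal_density x *\<^sub>R iexp (w * x))"
    unfolding char_def by (subst integral_density) (auto simp: normal_density_nonneg)
  finally show ?thesis by (simp add: std_normal_density_def)
qed

lemma integrable_fourier_std_normal_density:
  fixes v :: "real \<Rightarrow> complex"
  assumes v: "integrable lborel v"
  shows "integrable (lborel \<Otimes>\<^sub>M lborel) (\<lambda>(w, x). v w * (std_normal_density x *\<^sub>R iexp (w * x)))"
proof -
  have [measurable]: "v \<in> borel_measurable borel" using v by auto
  define f where "f = (\<lambda>w x. v w * (std_normal_density x *\<^sub>R iexp (w * x)))"
  have norm_f: "norm (f w x) = norm (v w) * std_normal_density x" for w x
    by (simp add: f_def norm_mult normal_density_nonneg)
  have "integrable (lborel \<Otimes>\<^sub>M lborel) (case_prod f)"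
  proof (rule lborel_pair.Fubini_integrable)
    show "case_prod f \<in> borel_measurable (lborel \<Otimes>\<^sub>M lborel)" unfolding f_def by measurable
    show "integrable lborel (\<lambda>w. LINT x|lborel. norm (case_prod f (w, x)))"
      using v by (simp add: norm_f)
    show "AE w in lborel. integrable lborel (\<lambda>x. case_prod f (w, x))"
    proof (rule AE_I2)
      fix w
      have "integrable lborel (\<lambda>x. norm (v w) * std_normal_density x)"
        by (intro integrable_mult_right integrable_std_normal_density)
      then show "integrable lborel (\<lambda>x. case_prod f (w, x))"
        by (rule Bochner_Integration.integrable_bound)
           (auto simp: norm_f abs_mult normal_density_nonneg, auto simp: f_def)
    qed
  qed
  then show ?thesis by (simp add: f_def)
qed

text \<open>The Gaussian is its own Fourier transform, so Fubini moves the transform to \<open>v\<close>.\<close>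

lemma norm_integral_std_normal_density_le:
  fixes v :: "real \<Rightarrow> complex"
  assumes v: "integrable lborel v"
    and fourier: "\<And>t. norm (CLINT u|lborel. v u * iexp (t * u)) \<le> k t" and k: "integrable lborel k"
  shows "norm (CLINT w|lborel. v w * std_normal_density w) \<le> (LINT t|lborel. k t)"
proof -
  define f where "f = (\<lambda>w x. v w * (std_normal_density x *\<^sub>R iexp (w * x)))"
  have f_int: "integrable (lborel \<Otimes>\<^sub>M lborel) (case_prod f)"
    unfolding f_def by (rule integrable_fourier_std_normal_density[OF v])
  have inner: "norm (CLINT w|lborel. f w x) \<le> k x" for x
  proof -
    have "(CLINT w|lborel. f w x) = (CLINT w|lborel. std_normal_density x *\<^sub>R (v w * iexp (x * w)))"
      unfolding f_def by (intro Bochner_Integration.integral_cong) (simp_all add: mult.commute)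
    also have "\<dots> = std_normal_density x *\<^sub>R (CLINT w|lborel. v w * iexp (x * w))" by simp
    finally have "norm (CLINT w|lborel. f w x) = std_normal_density x * norm (CLINT w|lborel. v w * iexp (x * w))"
      by (simp add: normal_density_nonneg)
    also have "\<dots> \<le> 1 * k x"
      by (intro mult_mono fourier std_normal_density_le_1) (auto simp: normal_density_nonneg)
    finally show ?thesis by simp
  qed
  have "(CLINT x|lborel. f w x) = v w * (CLINT x|lborel. std_normal_density x *\<^sub>R iexp (w * x))" for w
    unfolding f_def by (rule integral_mult_right_zero)
  then have "(CLINT w|lborel. v w * std_normal_density w) =
    (CLINT w|lborel. complex_of_real (1 / sqrt (2 * pi)) * (CLINT x|lborel. f w x))"
    by (simp only: std_normal_density_eq_fourier mult.left_commute)
  also have "\<dots> = complex_of_real (1 / sqrt (2 * pi)) * (CLINT x|lborel. CLINT w|lborel. f w x)"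
    using lborel_pair.Fubini_integral[OF f_int] by simp
  also have "norm \<dots> \<le> 1 * (LINT x|lborel. norm (CLINT w|lborel. f w x))"
    unfolding norm_mult
  proof (intro mult_mono integral_norm_bound)
    show "norm (complex_of_real (1 / sqrt (2 * pi))) \<le> 1"
      unfolding norm_of_real using pi_ge_two by (simp add: divide_simps)
  qed auto
  also have "\<dots> \<le> 1 * (LINT t|lborel. k t)"
    using lborel_pair.integrable_snd[OF f_int] k inner by (intro mult_left_mono integral_mono) auto
  finally show ?thesis by simp
qed

lemma fourier_affine:
  fixes v :: "real \<Rightarrow> complex"
  assumes "\<epsilon> > 0"
  shows "norm (CLINT w|lborel. v (x + \<epsilon> * w) * iexp (t * w)) = norm (CLINT u|lborel. v u * iexp (t / \<epsilon> * u)) / \<epsilon>"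
proof -
  have "(CLINT u|lborel. v u * iexp (t / \<epsilon> * u)) =
    \<bar>\<epsilon>\<bar> *\<^sub>R (CLINT w|lborel. v (x + \<epsilon> * w) * iexp (t / \<epsilon> * (x + \<epsilon> * w)))"
    by (rule lborel_integral_real_affine) (use assms in simp)
  also have "(\<lambda>w. v (x + \<epsilon> * w) * iexp (t / \<epsilon> * (x + \<epsilon> * w))) =
    (\<lambda>w. iexp (t / \<epsilon> * x) * (v (x + \<epsilon> * w) * iexp (t * w)))"
  proof
    fix w
    have "t / \<epsilon> * (x + \<epsilon> * w) = t / \<epsilon> * x + t * w" using assms by (simp add: field_simps)
    then have "iexp (t / \<epsilon> * (x + \<epsilon> * w)) = iexp (t / \<epsilon> * x) * iexp (t * w)"
      by (simp only: of_real_add distrib_left exp_add)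
    then show "v (x + \<epsilon> * w) * iexp (t / \<epsilon> * (x + \<epsilon> * w)) =
      iexp (t / \<epsilon> * x) * (v (x + \<epsilon> * w) * iexp (t * w))"
      by (simp only: mult_ac)
  qed
  finally show ?thesis using assms by (simp add: norm_mult)
qed

lemma norm_std_normal_average_le:
  fixes v :: "real \<Rightarrow> complex"
  assumes v: "integrable lborel v"
    and fourier: "\<And>t. norm (CLINT u|lborel. v u * iexp (t * u)) \<le> k t" and k: "integrable lborel k"
    and "\<epsilon> > 0"
  shows "norm (CLINT w|lborel. v (x + \<epsilon> * w) * std_normal_density w) \<le> (LINT t|lborel. k t)"
proof -
  have "norm (CLINT w|lborel. v (x + \<epsilon> * w) * std_normal_density w) \<le> (LINT t|lborel. k (t / \<epsilon>) / \<epsilon>)"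
  proof (rule norm_integral_std_normal_density_le)
    show "integrable lborel (\<lambda>w. v (x + \<epsilon> * w))"
      using lborel_integrable_real_affine[OF v, of \<epsilon> x] \<open>\<epsilon> > 0\<close> by simp
    show "norm (CLINT w|lborel. v (x + \<epsilon> * w) * iexp (t * w)) \<le> k (t / \<epsilon>) / \<epsilon>" for t
      unfolding fourier_affine[OF \<open>\<epsilon> > 0\<close>] using \<open>\<epsilon> > 0\<close> by (intro divide_right_mono[OF fourier]) simp
    show "integrable lborel (\<lambda>t. k (t / \<epsilon>) / \<epsilon>)"
      using lborel_integrable_real_affine[OF k, of "1 / \<epsilon>" 0] \<open>\<epsilon> > 0\<close> by simp
  qed
  also have "\<dots> = (LINT t|lborel. k t)"
    using lborel_integral_real_affine[of "1 / \<epsilon>" k 0] \<open>\<epsilon> > 0\<close> by simp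
  finally show ?thesis .
qed

lemma norm_le_integral_fourier:
  fixes v :: "real \<Rightarrow> complex"
  assumes cont: "continuous_on UNIV v" and bdd: "\<And>u. norm (v u) \<le> B" and v: "integrable lborel v"
    and fourier: "\<And>t. norm (CLINT u|lborel. v u * iexp (t * u)) \<le> k t" and k: "integrable lborel k"
  shows "norm (v x) \<le> (LINT t|lborel. k t)"
proof -
  define A where "A = (\<lambda>n. CLINT w|lborel. v (x + 1 / real (Suc n) * w) * std_normal_density w)"
  have [measurable]: "v \<in> borel_measurable borel" using v by auto
  have "A \<longlonglongrightarrow> (CLINT w|lborel. v x * std_normal_density w)"
    unfolding A_def
  proof (rule integral_dominated_convergence[where w = "\<lambda>w. B * std_normal_density w"])
    show "integrable lborel (\<lambda>w. B * std_normal_density w)"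
      by (intro integrable_mult_right integrable_std_normal_density)
    show "AE w in lborel. norm (v (x + 1 / real (Suc n) * w) * complex_of_real (std_normal_density w)) \<le> B * std_normal_density w" for n
      using bdd by (intro AE_I2) (auto simp: norm_mult intro!: mult_right_mono)
    show "AE w in lborel. (\<lambda>n. v (x + 1 / real (Suc n) * w) * complex_of_real (std_normal_density w)) \<longlonglongrightarrow> v x * std_normal_density w"
    proof (intro AE_I2 tendsto_mult tendsto_const)
      fix w :: real
      have "(\<lambda>n. x + 1 / real (Suc n) * w) \<longlonglongrightarrow> x + 0 * w"
        by (intro tendsto_intros LIMSEQ_Suc lim_1_over_n)
      moreover have "isCont v x" using cont by (simp add: continuous_on_eq_continuous_at)
      ultimately show "(\<lambda>n. v (x + 1 / real (Suc n) * w)) \<longlonglongrightarrow> v x"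
        using isCont_tendsto_compose by force
    qed
  qed auto
  also have "(CLINT w|lborel. v x * std_normal_density w) = v x"
    by (simp add: integral_of_real[OF integrable_std_normal_density])
  finally have "(\<lambda>n. norm (A n)) \<longlonglongrightarrow> norm (v x)" by (rule tendsto_norm)
  moreover have "norm (A n) \<le> (LINT t|lborel. k t)" for n
    unfolding A_def by (rule norm_std_normal_average_le[OF v fourier k]) simp
  ultimately show ?thesis using LIMSEQ_le_const2 by blast
qed

lemma integral_mult_exp_real:
  fixes c a :: real assumes "c > 0" "a \<ge> 0"
  shows "set_integrable lborel {a<..} (\<lambda>u. u * exp (- c * u))"
    and "(LINT u:{a<..}|lborel. u * exp (- c * u)) = exp (- c * a) * (a / c + 1 / c\<^sup>2)"
proof -
  define F where "F = (\<lambda>u. - ((u / c + 1 / c\<^sup>2) * exp (- c * u)))"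
  have F_deriv: "(F has_real_derivative u * exp (- c * u)) (at u)" for u
    unfolding F_def using assms(1)
    by (auto intro!: derivative_eq_intros simp: field_simps power2_eq_square)
  have "(F \<longlongrightarrow> 0) at_top" unfolding F_def using assms(1) by real_asymp
  then have lim: "((F \<circ> real_of_ereal) \<longlongrightarrow> 0) (at_left \<infinity>)" by (simp add: ereal_tendsto_simps)
  have "isCont F a" using F_deriv by (rule DERIV_isCont)
  then have lim_a: "((F \<circ> real_of_ereal) \<longlongrightarrow> F a) (at_right (ereal a))"
    by (simp add: ereal_tendsto_simps isCont_def filterlim_at_split)
  have FTC: "set_integrable lborel (einterval (ereal a) \<infinity>) (\<lambda>u. u * exp (- c * u))"
    "(LBINT u=ereal a..\<infinity>. u * exp (- c * u)) = 0 - F a"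
    by (rule interval_integral_FTC_nonneg[OF _ F_deriv _ _ lim_a lim]; use assms in \<open>auto intro!: AE_I2 continuous_intros\<close>)+
  show "set_integrable lborel {a<..} (\<lambda>u. u * exp (- c * u))" using FTC(1) by simp
  show "(LINT u:{a<..}|lborel. u * exp (- c * u)) = exp (- c * a) * (a / c + 1 / c\<^sup>2)"
    using FTC(2) by (simp add: interval_lebesgue_integral_def F_def)
qed

lemma integral_mult_exp_complex:
  fixes z :: complex and a :: real assumes z: "Re z > 0" and "a \<ge> 0"
  shows "set_integrable lborel {a<..} (\<lambda>u. of_real u * exp (- z * of_real u))"
    and "(CLINT u:{a<..}|lborel. of_real u * exp (- z * of_real u)) = exp (- z * of_real a) * (of_real a / z + 1 / z\<^sup>2)"
proof -
  define F where "F = (\<lambda>u::complex. - ((u / z + 1 / z\<^sup>2) * exp (- z * u)))"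
  have z_nonzero: "z \<noteq> 0" using z by auto
  have "(F has_field_derivative of_real u * exp (- z * of_real u)) (at (of_real u))" for u :: real
    unfolding F_def using z_nonzero
    by (auto intro!: derivative_eq_intros simp: field_simps power2_eq_square)
  note F = has_vector_derivative_real_field[OF this]
  show int: "set_integrable lborel {a<..} (\<lambda>u. of_real u * exp (- z * of_real u))"
    unfolding set_integrable_def
    by (rule Bochner_Integration.integrable_bound[OF integral_mult_exp_real(1)[OF assms, unfolded set_integrable_def]])
       (auto simp: norm_mult)
  have "((\<lambda>u. F (of_real u)) \<longlongrightarrow> 0) at_top"
  proof (rule Lim_null_comparison)
    show "((\<lambda>u. (u / norm z + 1 / norm z ^ 2) * exp (- Re z * u)) \<longlongrightarrow> 0) at_top"
      using z z_nonzero by real_asymp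
    show "\<forall>\<^sub>F u in at_top. norm (F (of_real u)) \<le> (u / norm z + 1 / norm z ^ 2) * exp (- Re z * u)"
      using eventually_ge_at_top[of 0]
    proof eventually_elim
      case (elim u)
      have "norm (complex_of_real u / z + 1 / z\<^sup>2) \<le> u / norm z + 1 / norm z ^ 2"
        using elim by (intro order.trans[OF norm_triangle_ineq]) (simp add: norm_divide norm_power)
      then show ?case unfolding F_def by (simp add: norm_mult mult_right_mono)
    qed
  qed
  then have lim: "(((\<lambda>u. F (of_real u)) \<circ> real_of_ereal) \<longlongrightarrow> 0) (at_left \<infinity>)"
    by (simp add: ereal_tendsto_simps)
  have "isCont (\<lambda>u. F (of_real u)) a" using F by (rule has_vector_derivative_continuous)
  then have lima: "(((\<lambda>u. F (of_real u)) \<circ> real_of_ereal) \<longlongrightarrow> F (of_real a)) (at_right (ereal a))"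
    by (simp add: ereal_tendsto_simps isCont_def filterlim_at_split)
  have "(CLBINT u=ereal a..\<infinity>. of_real u * exp (- z * of_real u)) = 0 - F (of_real a)"
    by (rule interval_integral_FTC_integrable[OF _ F _ _ lima lim])
       (use int in \<open>auto intro!: continuous_intros\<close>)
  then show "(CLINT u:{a<..}|lborel. of_real u * exp (- z * of_real u)) = exp (- z * of_real a) * (of_real a / z + 1 / z\<^sup>2)"
    by (simp add: interval_lebesgue_integral_def F_def)
qed

lemma integrable_one_plus_abs_powr:
  assumes "p < -1"
  shows "integrable lborel (\<lambda>t::real. (1 + \<bar>t\<bar>) powr p)"
proof -
  define F where "F = (\<lambda>t::real. (1 + t) powr (p + 1) / (p + 1))"
  have F_deriv: "(F has_real_derivative (1 + \<bar>t\<bar>) powr p) (at t)" if "t \<ge> 0" for t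
  proof -
    have "((\<lambda>t. (1 + t) powr (p + 1)) has_real_derivative (p + 1) * (1 + t) powr p) (at t)"
      using that by (auto intro!: derivative_eq_intros)
    from DERIV_cdivide[OF this, of "p + 1"] show ?thesis using that assms by (simp add: F_def)
  qed
  have lim: "(F \<longlongrightarrow> 0) at_top" unfolding F_def using assms by real_asymp
  have "(\<integral>\<^sup>+t. ennreal ((1 + \<bar>t\<bar>) powr p) * indicator {0..} t \<partial>lborel) = ennreal (0 - F 0)"
    by (rule nn_integral_FTC_atLeast[OF _ F_deriv _ lim]) auto
  then have "(\<integral>\<^sup>+t. ennreal (indicator {0..} t *\<^sub>R (1 + \<bar>t\<bar>) powr p) \<partial>lborel) = ennreal (0 - F 0)"
    unfolding nn_integral_set_ennreal by (simp only: real_scaleR_def mult.commute)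
  then have "has_bochner_integral lborel (\<lambda>t. indicator {0..} t *\<^sub>R (1 + \<bar>t\<bar>) powr p) (0 - F 0)"
    using assms by (intro has_bochner_integral_nn_integral) (auto simp: F_def)
  from has_bochner_integral_even_function[OF this] show ?thesis
    by (auto simp: has_bochner_integral_iff)
qed

definition riesz_kernel :: "real \<Rightarrow> nat \<Rightarrow> real \<Rightarrow> real" where
  "riesz_kernel \<sigma> n u = (if n = 0 then 0 else u * exp (- \<sigma> * u) * max 0 (1 - real n * exp (- u)))"

lemma riesz_kernel_eq_0:
  assumes "exp u \<le> real n"
  shows "riesz_kernel \<sigma> n u = 0"
proof -
  have "exp (- u) * exp u \<le> exp (- u) * real n" using assms by (intro mult_left_mono) auto
  then have "1 - real n * exp (- u) \<le> 0" by (simp add: exp_minus mult.commute)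
  then show ?thesis by (simp add: riesz_kernel_def max_def)
qed

lemma riesz_kernel_cases:
  obtains "riesz_kernel \<sigma> n u = 0" "n = 0 \<or> u \<le> ln (real n)"
  | "n > 0" "ln (real n) < u" "riesz_kernel \<sigma> n u = u * exp (- \<sigma> * u) * (1 - real n * exp (- u))"
    "0 < real n * exp (- u)" "real n * exp (- u) < 1"
proof (cases "n = 0 \<or> u \<le> ln (real n)")
  case True
  then have "riesz_kernel \<sigma> n u = 0"
    using riesz_kernel_eq_0[of u n] by (cases "n = 0") (auto simp: riesz_kernel_def ln_ge_iff)
  then show ?thesis using True that(1) by blast
next
  case False
  then have n: "n > 0" and u: "ln (real n) < u" by auto
  have "real n < exp u" using n u by (metis exp_less_cancel_iff exp_ln of_nat_0_less_iff)
  then have "real n * exp (- u) < 1" by (simp add: exp_minus field_simps)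
  then show ?thesis using that(2) n u by (simp add: riesz_kernel_def)
qed

lemma
  shows riesz_kernel_nonneg: "riesz_kernel \<sigma> n u \<ge> 0"
    and riesz_kernel_le: "riesz_kernel \<sigma> n u \<le> indicator {ln (real n)<..} u * (u * exp (- \<sigma> * u))"
proof -
  have "0 \<le> riesz_kernel \<sigma> n u \<and> riesz_kernel \<sigma> n u \<le> indicator {ln (real n)<..} u * (u * exp (- \<sigma> * u))"
  proof (cases rule: riesz_kernel_cases[of \<sigma> n u])
    case 1
    then show ?thesis by (auto simp: indicator_def)
  next
    case 2
    then have "0 \<le> ln (real n)" by simp
    with 2 have "u \<ge> 0" by linarith
    then have "u * exp (- \<sigma> * u) * (1 - real n * exp (- u)) \<le> u * exp (- \<sigma> * u) * 1"
      using 2 by (intro mult_left_mono) auto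
    then show ?thesis using 2 \<open>u \<ge> 0\<close> by simp
  qed
  then show "riesz_kernel \<sigma> n u \<ge> 0"
    "riesz_kernel \<sigma> n u \<le> indicator {ln (real n)<..} u * (u * exp (- \<sigma> * u))" by auto
qed

lemma riesz_kernel_le_powr:
  assumes "\<eta> > 0"
  shows "riesz_kernel (1 + \<eta>) n u \<le> (2 / \<eta>) * real n powr (- (1 + \<eta> / 2))"
proof (cases rule: riesz_kernel_cases[of "1 + \<eta>" n u])
  case 1
  then show ?thesis using assms by simp
next
  case 2
  have "u \<le> (2 / \<eta>) * exp (u * \<eta> / 2)"
    using exp_ge_add_one_self[of "u * \<eta> / 2"] assms by (simp add: field_simps)
  then have "u * exp (- (1 + \<eta>) * u) \<le> (2 / \<eta>) * exp (u * \<eta> / 2) * exp (- (1 + \<eta>) * u)"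
    by (rule mult_right_mono) simp
  also have "(2 / \<eta>) * exp (u * \<eta> / 2) * exp (- (1 + \<eta>) * u) = (2 / \<eta>) * exp (- (1 + \<eta> / 2) * u)"
    by (simp add: mult.assoc flip: exp_add) (simp add: algebra_simps)
  also have "\<dots> \<le> (2 / \<eta>) * exp (- (1 + \<eta> / 2) * ln (real n))"
    using 2 assms by (intro mult_left_mono) auto
  also have "exp (- (1 + \<eta> / 2) * ln (real n)) = real n powr (- (1 + \<eta> / 2))"
    using 2 by (simp add: powr_def)
  finally show ?thesis using riesz_kernel_le[of "1 + \<eta>" n u] 2(2) by simp
qed

lemma isCont_riesz_kernel: "isCont (riesz_kernel \<sigma> n) u"
  unfolding riesz_kernel_def[abs_def] by (cases "n = 0") (auto intro!: continuous_intros continuous_max)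

lemma riesz_kernel_iexp:
  assumes "n > 0"
  shows "complex_of_real (riesz_kernel \<sigma> n u) * iexp (t * u) =
     indicator {ln (real n)<..} u *\<^sub>R (of_real u * exp (- Complex \<sigma> (- t) * of_real u))
      - of_nat n * (indicator {ln (real n)<..} u *\<^sub>R (of_real u * exp (- (Complex \<sigma> (- t) + 1) * of_real u)))"
proof (cases rule: riesz_kernel_cases[of \<sigma> n u])
  case 2
  have exps: "exp (- Complex \<sigma> (- t) * of_real u) = of_real (exp (- \<sigma> * u)) * iexp (t * u)"
    "exp (- (Complex \<sigma> (- t) + 1) * of_real u) = of_real (exp (- \<sigma> * u)) * of_real (exp (- u)) * iexp (t * u)"
    by (simp_all add: Complex_eq exp_of_real[symmetric] exp_add[symmetric] algebra_simps del: exp_of_real)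
  show ?thesis unfolding exps 2(3) using 2(1,2) by (simp add: algebra_simps)
qed (use assms in simp)

lemma exp_ln_nat: "n > 0 \<Longrightarrow> exp (- z * complex_of_real (ln (real n))) = of_nat n powr (- z)"
  using Ln_of_real[of "real n"] by (simp add: powr_def mult.commute)

lemma riesz_kernel_fourier:
  fixes t :: real
  assumes "\<sigma> > 1" "n > 0"
  defines "l \<equiv> ln (real n)" and "s \<equiv> Complex \<sigma> (- t)"
  shows "integrable lborel (\<lambda>u. complex_of_real (riesz_kernel \<sigma> n u) * iexp (t * u))"
    and "(CLINT u|lborel. complex_of_real (riesz_kernel \<sigma> n u) * iexp (t * u)) =
       of_nat n powr (- s) * ((of_real l / s + 1 / s\<^sup>2) - (of_real l / (s + 1) + 1 / (s + 1)\<^sup>2))"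
proof -
  let ?E = "\<lambda>z u. indicator {l<..} u *\<^sub>R (complex_of_real u * exp (- z * of_real u))"
  have l: "l \<ge> 0" using assms(2) by (simp add: l_def)
  have s: "Re s > 0" "Re (s + 1) > 0" using assms(1) by (auto simp: s_def)
  have int_E: "integrable lborel (?E z)" if "Re z > 0" for z
    using integral_mult_exp_complex(1)[OF that l] by (simp add: set_integrable_def)
  have integrable: "integrable lborel (?E s)" "integrable lborel (\<lambda>u. of_nat n * ?E (s + 1) u)"
    by (rule int_E[OF s(1)], rule integrable_mult_right[OF int_E[OF s(2)]])
  have transform: "(CLINT u|lborel. ?E z u) = of_nat n powr (- z) * (of_real l / z + 1 / z\<^sup>2)" if "Re z > 0" for z
    using integral_mult_exp_complex(2)[OF that l] exp_ln_nat[OF assms(2), of z]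
    by (simp add: set_lebesgue_integral_def l_def)
  have split_kernel: "(\<lambda>u. complex_of_real (riesz_kernel \<sigma> n u) * iexp (t * u)) = (\<lambda>u. ?E s u - of_nat n * ?E (s + 1) u)"
    unfolding l_def s_def using riesz_kernel_iexp[OF assms(2)] by blast
  show "integrable lborel (\<lambda>u. complex_of_real (riesz_kernel \<sigma> n u) * iexp (t * u))"
    unfolding split_kernel by (rule Bochner_Integration.integrable_diff[OF integrable])
  have "of_nat n powr (- (s + 1)) = of_nat n powr (- s) / (of_nat n :: complex)"
    using assms(2) by (simp add: powr_diff)
  then have "(CLINT u|lborel. of_nat n * ?E (s + 1) u) = of_nat n powr (- s) * (of_real l / (s + 1) + 1 / (s + 1)\<^sup>2)"
    unfolding integral_mult_right_zero transform[OF s(2)] using assms(2) by simp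
  then show "(CLINT u|lborel. complex_of_real (riesz_kernel \<sigma> n u) * iexp (t * u)) =
       of_nat n powr (- s) * ((of_real l / s + 1 / s\<^sup>2) - (of_real l / (s + 1) + 1 / (s + 1)\<^sup>2))"
    unfolding split_kernel Bochner_Integration.integral_diff[OF integrable] transform[OF s(1)] by (simp add: algebra_simps)
qed

lemma integral_riesz_kernel_le:
  assumes "\<sigma> > 1" "n > 0"
  shows "(LINT u|lborel. riesz_kernel \<sigma> n u) \<le> real n powr (- \<sigma>) * (ln (real n) + 1)"
proof -
  define l where "l = ln (real n)"
  have l: "l \<ge> 0" using assms(2) by (simp add: l_def)
  have \<sigma>: "\<sigma> > 0" using assms(1) by simp
  have "integrable lborel (\<lambda>u. norm (complex_of_real (riesz_kernel \<sigma> n u) * iexp (0 * u)))"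
    by (intro integrable_norm riesz_kernel_fourier(1) assms)
  then have "integrable lborel (riesz_kernel \<sigma> n)" by (simp add: riesz_kernel_nonneg)
  then have "(LINT u|lborel. riesz_kernel \<sigma> n u) \<le> (LINT u:{l<..}|lborel. u * exp (- \<sigma> * u))"
    unfolding set_lebesgue_integral_def
    using integral_mult_exp_real(1)[OF \<sigma> l] riesz_kernel_le[of \<sigma> n]
    by (intro integral_mono) (auto simp: set_integrable_def l_def)
  also have "\<dots> = real n powr (- \<sigma>) * (l / \<sigma> + 1 / \<sigma>\<^sup>2)"
    using integral_mult_exp_real(2)[OF \<sigma> l] assms(2) by (simp add: powr_def l_def)
  also have "\<dots> \<le> real n powr (- \<sigma>) * (l + 1)"
  proof (intro mult_left_mono add_mono)
    show "l / \<sigma> \<le> l" using l assms(1) mult_left_mono[of 1 \<sigma> l] by (simp add: field_simps)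
    show "1 / \<sigma>\<^sup>2 \<le> 1" using one_le_power[of \<sigma> 2] assms(1) by (simp add: divide_simps)
  qed auto
  finally show ?thesis by (simp add: l_def)
qed

definition riesz_series :: "(nat \<Rightarrow> real) \<Rightarrow> real \<Rightarrow> real \<Rightarrow> real" where
  "riesz_series a \<sigma> u = (\<Sum>n. a n * riesz_kernel \<sigma> n u)"

lemma riesz_series_eq_sum:
  assumes "finite I" "\<And>n. real n < exp u \<Longrightarrow> n > 0 \<Longrightarrow> n \<in> I"
  shows "riesz_series a \<sigma> u = (\<Sum>n\<in>I. a n * riesz_kernel \<sigma> n u)"
  unfolding riesz_series_def
proof (rule suminf_finite[OF assms(1)])
  fix n assume "n \<notin> I"
  then have "n = 0 \<or> exp u \<le> real n" using assms(2)[of n] by (meson gr0I not_less)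
  then show "a n * riesz_kernel \<sigma> n u = 0"
    using riesz_kernel_eq_0[of u n \<sigma>] by (auto simp: riesz_kernel_def[of _ 0])
qed

lemma continuous_on_riesz_series: "continuous_on UNIV (riesz_series a \<sigma>)"
proof (intro continuous_at_imp_continuous_on ballI)
  fix u
  obtain N where N: "exp (u + 1) \<le> real N" using real_arch_simple by blast
  have "\<forall>\<^sub>F y in nhds u. y < u + 1" using eventually_nhds_in_open[of "{..<u+1}" u] by simp
  then have eq: "\<forall>\<^sub>F y in nhds u. riesz_series a \<sigma> y = (\<Sum>n<N. a n * riesz_kernel \<sigma> n y)"
  proof (rule eventually_mono)
    fix y assume "y < u + 1"
    then have "exp y < exp (u + 1)" by simp
    then have "n < N" if "real n < exp y" for n using that N by linarith
    then show "riesz_series a \<sigma> y = (\<Sum>n<N. a n * riesz_kernel \<sigma> n y)"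
      by (intro riesz_series_eq_sum) auto
  qed
  have "isCont (\<lambda>y. \<Sum>n<N. a n * riesz_kernel \<sigma> n y) u" by (intro continuous_intros isCont_riesz_kernel)
  then show "isCont (riesz_series a \<sigma>) u" using isCont_cong[OF eq] by simp
qed

lemma fourier_weights_le:
  assumes "\<sigma> > 1"
  defines "s \<equiv> \<lambda>t. Complex \<sigma> (- t)" and "w \<equiv> \<lambda>t. 1 + \<bar>t\<bar>"
  shows "norm (1 / s t - 1 / (s t + 1)) \<le> 4 / (w t)\<^sup>2"
    and "norm (1 / (s t)\<^sup>2 - 1 / (s t + 1)\<^sup>2) \<le> 8 / (w t)\<^sup>2"
proof -
  have w: "w t \<ge> 1" by (simp add: w_def)
  have nonzero: "s t \<noteq> 0" "s t + 1 \<noteq> 0" using assms(1) by (auto simp: s_def complex_eq_iff)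
  have "norm (s t) \<ge> w t / 2"
    using abs_Re_le_cmod[of "s t"] abs_Im_le_cmod[of "s t"] assms(1) by (simp add: s_def w_def)
  moreover have "norm (s t + 1) \<ge> w t / 2"
    using abs_Re_le_cmod[of "s t + 1"] abs_Im_le_cmod[of "s t + 1"] assms(1) by (simp add: s_def w_def)
  ultimately have inv: "1 / norm (s t) \<le> 2 / w t" "1 / norm (s t + 1) \<le> 2 / w t"
    using w nonzero by (simp_all add: field_simps)
  have "1 / s t - 1 / (s t + 1) = (1 / s t) * (1 / (s t + 1))" using nonzero by (simp add: field_simps)
  then have "norm (1 / s t - 1 / (s t + 1)) = (1 / norm (s t)) * (1 / norm (s t + 1))"
    by (simp add: norm_divide norm_mult)
  also have "\<dots> \<le> (2 / w t) * (2 / w t)" using inv w by (intro mult_mono) auto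
  finally show "norm (1 / s t - 1 / (s t + 1)) \<le> 4 / (w t)\<^sup>2" by (simp add: power2_eq_square)
  have "norm (1 / (s t)\<^sup>2 - 1 / (s t + 1)\<^sup>2) \<le> norm (1 / (s t)\<^sup>2) + norm (1 / (s t + 1)\<^sup>2)"
    by (rule norm_triangle_ineq4)
  also have "\<dots> = (1 / norm (s t))\<^sup>2 + (1 / norm (s t + 1))\<^sup>2"
    by (simp add: norm_divide norm_power power_divide)
  also have "\<dots> \<le> (2 / w t)\<^sup>2 + (2 / w t)\<^sup>2" using inv by (intro add_mono power_mono) auto
  finally show "norm (1 / (s t)\<^sup>2 - 1 / (s t + 1)\<^sup>2) \<le> 8 / (w t)\<^sup>2" by (simp add: power_divide)
qed

context
  fixes a :: "nat \<Rightarrow> real" and \<sigma> :: real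
  assumes a: "abs_conv_gt1 a" and \<sigma>: "\<sigma> > 1"
begin

lemma riesz_series_dominated:
  obtains g where "summable g" "\<And>n u. \<bar>a n * riesz_kernel \<sigma> n u\<bar> \<le> g n"
proof
  define \<eta> where "\<eta> = \<sigma> - 1"
  have \<eta>: "\<eta> > 0" "\<sigma> = 1 + \<eta>" using \<sigma> by (auto simp: \<eta>_def)
  show "summable (\<lambda>n. (2 / \<eta>) * (\<bar>a n\<bar> * real n powr (- (1 + \<eta> / 2))))"
    using \<eta> by (intro summable_mult abs_conv_gt1D[OF a]) simp
  show "\<bar>a n * riesz_kernel \<sigma> n u\<bar> \<le> (2 / \<eta>) * (\<bar>a n\<bar> * real n powr (- (1 + \<eta> / 2)))" for n u
    using mult_left_mono[OF riesz_kernel_le_powr[OF \<eta>(1), of n u], of "\<bar>a n\<bar>"]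
    unfolding \<eta>(2) by (simp add: abs_mult riesz_kernel_nonneg mult_ac)
qed

lemma summable_abs_riesz_series: "summable (\<lambda>n. \<bar>a n * riesz_kernel \<sigma> n u\<bar>)"
proof -
  obtain g where g: "summable g" "\<And>n u. \<bar>a n * riesz_kernel \<sigma> n u\<bar> \<le> g n"
    by (rule riesz_series_dominated) blast
  then show ?thesis by (intro summable_comparison_test'[OF g(1)]) auto
qed

lemma riesz_series_bounded:
  obtains B where "\<And>u. \<bar>riesz_series a \<sigma> u\<bar> \<le> B"
proof -
  obtain g where g: "summable g" "\<And>n u. \<bar>a n * riesz_kernel \<sigma> n u\<bar> \<le> g n"
    by (rule riesz_series_dominated) blast
  have "\<bar>riesz_series a \<sigma> u\<bar> \<le> suminf g" for u
    unfolding riesz_series_def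
    using norm_suminf_le[OF _ g(1), of "\<lambda>n. a n * riesz_kernel \<sigma> n u"] g(2) by simp
  then show ?thesis using that by blast
qed

text \<open>The factor \<open>u\<close> of the kernel becomes a differentiation of the Dirichlet series.\<close>

lemma riesz_term_fourier:
  fixes t :: real
  defines "s \<equiv> Complex \<sigma> (- t)"
  shows "integrable lborel (\<lambda>u. complex_of_real (a n * riesz_kernel \<sigma> n u) * iexp (t * u))" (is "integrable _ ?f")
    and "(CLINT u|lborel. complex_of_real (a n * riesz_kernel \<sigma> n u) * iexp (t * u)) =
      dterm (\<lambda>n. a n * ln (real n)) n s * (1 / s - 1 / (s + 1)) + dterm a n s * (1 / s\<^sup>2 - 1 / (s + 1)\<^sup>2)"
      (is "_ = ?val")
proof -
  have "integrable lborel ?f \<and> (CLINT u|lborel. ?f u) = ?val"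
  proof (cases "n = 0")
    case True
    then show ?thesis by (simp add: riesz_kernel_def)
  next
    case False
    have eq: "?f = (\<lambda>u. of_real (a n) * (complex_of_real (riesz_kernel \<sigma> n u) * iexp (t * u)))"
      by (simp add: mult.assoc)
    have "integrable lborel ?f"
      unfolding eq using False \<sigma> by (intro integrable_mult_right riesz_kernel_fourier(1)) auto
    moreover have "(CLINT u|lborel. ?f u) = of_real (a n) * (of_nat n powr (- s) *
        ((of_real (ln (real n)) / s + 1 / s\<^sup>2) - (of_real (ln (real n)) / (s + 1) + 1 / (s + 1)\<^sup>2)))"
      unfolding eq s_def integral_mult_right_zero using False \<sigma> by (subst riesz_kernel_fourier(2)) auto
    ultimately show ?thesis by (simp add: dterm_def algebra_simps)
  qed
  then show "integrable lborel ?f" "(CLINT u|lborel. ?f u) = ?val" by auto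
qed

lemma summable_integral_riesz_term: "summable (\<lambda>n. LINT u|lborel. \<bar>a n * riesz_kernel \<sigma> n u\<bar>)"
proof (rule summable_comparison_test'[where N = 1])
  have "summable (\<lambda>n. \<bar>a n * ln (real n)\<bar> * real n powr (- \<sigma>) + \<bar>a n\<bar> * real n powr (- \<sigma>))"
    by (intro summable_add abs_conv_gt1D abs_conv_gt1_ln a \<sigma>)
  moreover have "\<bar>ln (real n)\<bar> * real n powr (- \<sigma>) = ln (real n) * real n powr (- \<sigma>)" for n
    by (cases "n = 0") auto
  ultimately show "summable (\<lambda>n. \<bar>a n\<bar> * (real n powr (- \<sigma>) * (ln (real n) + 1)))"
    by (simp add: abs_mult algebra_simps)
  fix n :: nat assume "n \<ge> 1"
  then show "norm (LINT u|lborel. \<bar>a n * riesz_kernel \<sigma> n u\<bar>) \<le> \<bar>a n\<bar> * (real n powr (- \<sigma>) * (ln (real n) + 1))"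
    using mult_left_mono[OF integral_riesz_kernel_le[OF \<sigma>, of n], of "\<bar>a n\<bar>"]
    by (simp add: abs_mult riesz_kernel_nonneg)
qed

lemma riesz_series_fourier:
  defines "s \<equiv> \<lambda>t. Complex \<sigma> (- t)"
  shows "integrable lborel (\<lambda>u. complex_of_real (riesz_series a \<sigma> u) * iexp (t * u))"
    and "(CLINT u|lborel. complex_of_real (riesz_series a \<sigma> u) * iexp (t * u)) =
      dseries (\<lambda>n. a n * ln (real n)) (s t) * (1 / s t - 1 / (s t + 1))
      + dseries a (s t) * (1 / (s t)\<^sup>2 - 1 / (s t + 1)\<^sup>2)"
proof -
  let ?f = "\<lambda>n u. complex_of_real (a n * riesz_kernel \<sigma> n u) * iexp (t * u)"
  have norm_f: "norm (?f n u) = \<bar>a n * riesz_kernel \<sigma> n u\<bar>" for n u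
    by (simp add: norm_mult abs_mult)
  have pointwise: "AE u in lborel. summable (\<lambda>n. norm (?f n u))"
    unfolding norm_f using summable_abs_riesz_series by simp
  have in_norm: "summable (\<lambda>n. LINT u|lborel. norm (?f n u))"
    unfolding norm_f by (rule summable_integral_riesz_term)
  have sum_eq: "(\<Sum>n. ?f n u) = of_real (riesz_series a \<sigma> u) * iexp (t * u)" for u
  proof -
    have "(\<lambda>n. a n * riesz_kernel \<sigma> n u) sums riesz_series a \<sigma> u"
      unfolding riesz_series_def using summable_rabs_cancel[OF summable_abs_riesz_series] by (rule summable_sums)
    then have "(\<lambda>n. ?f n u) sums (of_real (riesz_series a \<sigma> u) * iexp (t * u))"
      by (intro sums_mult2 sums_of_real)
    then show ?thesis by (rule sums_unique[symmetric])
  qed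
  show "integrable lborel (\<lambda>u. complex_of_real (riesz_series a \<sigma> u) * iexp (t * u))"
    using integrable_suminf[OF riesz_term_fourier(1) pointwise in_norm] unfolding sum_eq .
  have "(\<lambda>n. CLINT u|lborel. ?f n u) sums (CLINT u|lborel. complex_of_real (riesz_series a \<sigma> u) * iexp (t * u))"
    using sums_integral[OF riesz_term_fourier(1) pointwise in_norm] unfolding sum_eq .
  moreover have "(\<lambda>n. CLINT u|lborel. ?f n u) sums
      (dseries (\<lambda>n. a n * ln (real n)) (s t) * (1 / s t - 1 / (s t + 1))
      + dseries a (s t) * (1 / (s t)\<^sup>2 - 1 / (s t + 1)\<^sup>2))"
    unfolding riesz_term_fourier(2) s_def
    using \<sigma> by (intro sums_add sums_mult2 dseries_sums abs_conv_gt1_ln a) simp_all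
  ultimately show "(CLINT u|lborel. complex_of_real (riesz_series a \<sigma> u) * iexp (t * u)) =
      dseries (\<lambda>n. a n * ln (real n)) (s t) * (1 / s t - 1 / (s t + 1))
      + dseries a (s t) * (1 / (s t)\<^sup>2 - 1 / (s t + 1)\<^sup>2)"
    by (rule sums_unique2)
qed

lemma norm_riesz_series_fourier_le:
  fixes t :: real
  defines "s \<equiv> Complex \<sigma> (- t)"
  shows "norm (CLINT u|lborel. complex_of_real (riesz_series a \<sigma> u) * iexp (t * u)) \<le>
    (4 * norm (dseries (\<lambda>n. a n * ln (real n)) s) + 8 * norm (dseries a s)) / (1 + \<bar>t\<bar>)\<^sup>2"
proof -
  have "norm (CLINT u|lborel. complex_of_real (riesz_series a \<sigma> u) * iexp (t * u)) \<le>
    norm (dseries (\<lambda>n. a n * ln (real n)) s) * norm (1 / s - 1 / (s + 1))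
    + norm (dseries a s) * norm (1 / s\<^sup>2 - 1 / (s + 1)\<^sup>2)"
    unfolding riesz_series_fourier(2) s_def norm_mult[symmetric] by (rule norm_triangle_ineq)
  also have "\<dots> \<le> norm (dseries (\<lambda>n. a n * ln (real n)) s) * (4 / (1 + \<bar>t\<bar>)\<^sup>2)
    + norm (dseries a s) * (8 / (1 + \<bar>t\<bar>)\<^sup>2)"
    using fourier_weights_le[OF \<sigma>, of t] unfolding s_def by (intro add_mono mult_left_mono) auto
  finally show ?thesis by (simp add: add_divide_distrib mult.commute)
qed

end

definition vertical_growth :: "(nat \<Rightarrow> real) \<Rightarrow> real \<Rightarrow> bool" where
  "vertical_growth a \<kappa> \<longleftrightarrow>
    (\<exists>C. \<forall>s. 1 < Re s \<longrightarrow> Re s \<le> 2 \<longrightarrow> norm (dseries a s) \<le> C * (1 + \<bar>Im s\<bar>) powr \<kappa>)"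

lemma vertical_growthE:
  assumes "vertical_growth a \<kappa>"
  obtains C where "C \<ge> 0"
    "\<And>s. 1 < Re s \<Longrightarrow> Re s \<le> 2 \<Longrightarrow> norm (dseries a s) \<le> C * (1 + \<bar>Im s\<bar>) powr \<kappa>"
proof -
  obtain C where C: "\<And>s. 1 < Re s \<Longrightarrow> Re s \<le> 2 \<Longrightarrow> norm (dseries a s) \<le> C * (1 + \<bar>Im s\<bar>) powr \<kappa>"
    using assms by (auto simp: vertical_growth_def)
  have "0 \<le> norm (dseries a 2)" by simp
  also have "\<dots> \<le> C" using C[of 2] by simp
  finally show ?thesis using that C by blast
qed

lemma riesz_series_bound:
  assumes a: "abs_conv_gt1 a" and "\<kappa> < 1"
    and growth: "vertical_growth a \<kappa>" "vertical_growth (\<lambda>n. a n * ln (real n)) \<kappa>"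
  obtains K where "\<And>\<sigma> u. 1 < \<sigma> \<Longrightarrow> \<sigma> \<le> 2 \<Longrightarrow> \<bar>riesz_series a \<sigma> u\<bar> \<le> K"
proof -
  obtain C where C: "C \<ge> 0"
    "\<And>s. 1 < Re s \<Longrightarrow> Re s \<le> 2 \<Longrightarrow> norm (dseries a s) \<le> C * (1 + \<bar>Im s\<bar>) powr \<kappa>"
    using growth(1) by (rule vertical_growthE) blast
  obtain C' where C': "C' \<ge> 0"
    "\<And>s. 1 < Re s \<Longrightarrow> Re s \<le> 2 \<Longrightarrow> norm (dseries (\<lambda>n. a n * ln (real n)) s) \<le> C' * (1 + \<bar>Im s\<bar>) powr \<kappa>"
    using growth(2) by (rule vertical_growthE) blast
  define k where "k = (\<lambda>t::real. (4 * C' + 8 * C) * (1 + \<bar>t\<bar>) powr (\<kappa> - 2))"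
  have k: "integrable lborel k"
    unfolding k_def using \<open>\<kappa> < 1\<close> by (intro integrable_mult_right integrable_one_plus_abs_powr) simp
  show ?thesis
  proof (rule that)
    fix \<sigma> u :: real assume \<sigma>: "1 < \<sigma>" "\<sigma> \<le> 2"
    define v where "v = (\<lambda>u. complex_of_real (riesz_series a \<sigma> u))"
    have fourier: "norm (CLINT u|lborel. v u * iexp (t * u)) \<le> k t" for t
    proof -
      define w where "w = 1 + \<bar>t\<bar>"
      define s where "s = Complex \<sigma> (- t)"
      have s: "1 < Re s" "Re s \<le> 2" "1 + \<bar>Im s\<bar> = w" using \<sigma> by (auto simp: s_def w_def)
      have "norm (CLINT u|lborel. v u * iexp (t * u)) \<le>
        (4 * norm (dseries (\<lambda>n. a n * ln (real n)) s) + 8 * norm (dseries a s)) / w\<^sup>2"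
        unfolding v_def s_def w_def by (rule norm_riesz_series_fourier_le[OF a \<sigma>(1)])
      also have "\<dots> \<le> (4 * (C' * w powr \<kappa>) + 8 * (C * w powr \<kappa>)) / w\<^sup>2"
        using C(2)[OF s(1,2)] C'(2)[OF s(1,2)] s(3) by (intro divide_right_mono add_mono mult_left_mono) auto
      also have "\<dots> = (4 * C' + 8 * C) * (w powr \<kappa> / w\<^sup>2)"
        by (simp add: algebra_simps add_divide_distrib)
      also have "w powr \<kappa> / w\<^sup>2 = w powr (\<kappa> - 2)"
        unfolding powr_diff using powr_realpow[of w 2] by (simp add: w_def)
      finally show ?thesis by (simp add: w_def k_def)
    qed
    obtain B where "\<And>u. \<bar>riesz_series a \<sigma> u\<bar> \<le> B" using riesz_series_bounded[OF a \<sigma>(1)] by blast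
    moreover have "integrable lborel v" using riesz_series_fourier(1)[OF a \<sigma>(1), of 0] by (simp add: v_def)
    moreover have "continuous_on UNIV v"
      unfolding v_def by (intro continuous_intros continuous_on_riesz_series)
    ultimately have "norm (v u) \<le> (LINT t|lborel. k t)"
      by (intro norm_le_integral_fourier[OF _ _ _ fourier k]) (auto simp: v_def)
    then show "\<bar>riesz_series a \<sigma> u\<bar> \<le> (LINT t|lborel. k t)" by (simp add: v_def)
  qed
qed

lemma riesz_series_ln:
  assumes "x > 1"
  shows "riesz_series a \<sigma> (ln x) = ln x * x powr (- \<sigma>) * (\<Sum>n\<in>{1..nat \<lfloor>x\<rfloor>}. a n * (1 - real n / x))"
proof -
  have "riesz_series a \<sigma> (ln x) = (\<Sum>n\<in>{1..nat \<lfloor>x\<rfloor>}. a n * riesz_kernel \<sigma> n (ln x))"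
    using assms by (intro riesz_series_eq_sum) (auto simp: le_nat_floor)
  also have "\<dots> = (\<Sum>n\<in>{1..nat \<lfloor>x\<rfloor>}. ln x * x powr (- \<sigma>) * (a n * (1 - real n / x)))"
  proof (rule sum.cong[OF refl])
    fix n assume n: "n \<in> {1..nat \<lfloor>x\<rfloor>}"
    then have "n \<le> nat \<lfloor>x\<rfloor>" by simp
    then have "real n \<le> x" using assms by linarith
    then have "1 - real n * exp (- ln x) = 1 - real n / x" "1 - real n / x \<ge> 0"
      using assms by (simp_all add: exp_minus divide_inverse[symmetric] field_simps)
    then show "a n * riesz_kernel \<sigma> n (ln x) = ln x * x powr (- \<sigma>) * (a n * (1 - real n / x))"
      using n assms by (simp add: riesz_kernel_def powr_def)
  qed
  finally show ?thesis by (simp add: sum_distrib_left)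
qed

theorem cesaro_sum_bound:
  assumes "abs_conv_gt1 a" "\<kappa> < 1" "vertical_growth a \<kappa>" "vertical_growth (\<lambda>n. a n * ln (real n)) \<kappa>"
  shows "(\<lambda>x. \<Sum>n\<in>{1..nat \<lfloor>x\<rfloor>}. a n * (1 - real n / x)) \<in> O(\<lambda>x. x / ln x)"
proof -
  obtain K where K: "\<And>\<sigma> u. 1 < \<sigma> \<Longrightarrow> \<sigma> \<le> 2 \<Longrightarrow> \<bar>riesz_series a \<sigma> u\<bar> \<le> K"
    using riesz_series_bound[OF assms] by blast
  show ?thesis
  proof (rule bigoI)
    show "\<forall>\<^sub>F x in at_top. norm (\<Sum>n\<in>{1..nat \<lfloor>x\<rfloor>}. a n * (1 - real n / x)) \<le> K * norm (x / ln x)"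
      using eventually_gt_at_top[of 1]
    proof eventually_elim
      case (elim x)
      define S where "S = (\<Sum>n\<in>{1..nat \<lfloor>x\<rfloor>}. a n * (1 - real n / x))"
      have "\<bar>ln x * x powr (- (1 + 1 / real (Suc m))) * S\<bar> \<le> K" for m
        using K[of "1 + 1 / real (Suc m)" "ln x"] unfolding riesz_series_ln[OF elim] S_def by simp
      moreover have "(\<lambda>m. \<bar>ln x * x powr (- (1 + 1 / real (Suc m))) * S\<bar>) \<longlonglongrightarrow> \<bar>ln x * x powr (- (1 + 0)) * S\<bar>"
        using elim by (intro tendsto_intros LIMSEQ_Suc lim_1_over_n) auto
      ultimately have "\<bar>ln x * x powr (- (1 + 0)) * S\<bar> \<le> K"
        using LIMSEQ_le_const2 by blast
      then have "ln x * \<bar>S\<bar> / x \<le> K" using elim by (simp add: abs_mult powr_minus divide_inverse mult_ac)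
      then show ?case using elim by (simp add: S_def field_simps)
    qed
  qed
qed

section \<open>The Dedekind zeta function of the Gaussian field near the line Re s = 1\<close>

lemma norm_real_powr: "u > 0 \<Longrightarrow> norm (complex_of_real u powr s) = u powr Re s"
  using norm_powr_real_powr[of "of_real u" s] by simp

lemma has_field_derivative_powr_of_real:
  "x > 0 \<Longrightarrow> ((\<lambda>z. z powr s) has_field_derivative s * complex_of_real x powr (s - 1)) (at (of_real x) within S)"
  by (rule has_field_derivative_at_within, rule has_field_derivative_powr)
     (auto simp: complex_nonpos_Reals_iff)

lemma closed_segment_of_realE:
  fixes a b :: real
  assumes "z \<in> closed_segment (complex_of_real a) (of_real b)" "a \<le> b"
  obtains x where "a \<le> x" "x \<le> b" "z = of_real x"
  using assms unfolding closed_segment_of_real by (auto simp: closed_segment_eq_real_ivl)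

lemma norm_powr_diff_le_mean_value:
  assumes n: "0 < n" "n \<le> u" and s: "Re s > 0"
  shows "norm (complex_of_real u powr (- s) - of_real n powr (- s)) \<le> norm s * n powr (- Re s - 1) * (u - n)"
proof -
  let ?S = "closed_segment (complex_of_real n) (of_real u)"
  have "norm (complex_of_real u powr (- s) - of_real n powr (- s))
    \<le> norm s * n powr (- Re s - 1) * norm (complex_of_real u - of_real n)"
  proof (rule field_differentiable_bound[of ?S _ "\<lambda>z. - s * z powr (- s - 1)"])
    fix z assume "z \<in> ?S"
    then obtain x where x: "n \<le> x" "z = of_real x" using n(2) by (elim closed_segment_of_realE)
    show "((\<lambda>z. z powr (- s)) has_field_derivative - s * z powr (- s - 1)) (at z within ?S)"
      unfolding x(2) using x n by (intro has_field_derivative_powr_of_real) simp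
    show "norm (- s * z powr (- s - 1)) \<le> norm s * n powr (- Re s - 1)"
      using x n s by (auto simp: norm_mult norm_real_powr intro!: mult_left_mono powr_mono2')
  qed auto
  also have "norm (complex_of_real u - of_real n) = u - n"
    using n(2) by (simp flip: of_real_diff)
  finally show ?thesis .
qed

text \<open>Interpolation between the trivial bound (\<open>\<theta> = 0\<close>) and the mean value theorem (\<open>\<theta> = 1\<close>).\<close>

lemma norm_powr_diff_le:
  assumes n: "0 < n" and u: "n \<le> u" "u \<le> n + 1" and s: "Re s > 0" and \<theta>: "0 \<le> \<theta>" "\<theta> \<le> 1"
  shows "norm (complex_of_real u powr (- s) - of_real n powr (- s)) \<le> 2 * norm s powr \<theta> * n powr (- Re s - \<theta>)"
proof -
  let ?X = "norm (complex_of_real u powr (- s) - of_real n powr (- s))"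
  define q where "q = norm s / n"
  have "s \<noteq> 0" using s by auto
  then have q: "q > 0" using n by (simp add: q_def)
  have "?X \<le> norm (complex_of_real u powr (- s)) + norm (complex_of_real n powr (- s))"
    by (rule norm_triangle_ineq4)
  also have "\<dots> = u powr (- Re s) + n powr (- Re s)" using n u by (simp add: norm_real_powr)
  also have "u powr (- Re s) \<le> n powr (- Re s)" using n u s by (intro powr_mono2') auto
  finally have trivial: "?X \<le> n powr (- Re s) * 2" by simp
  have "?X \<le> norm s * n powr (- Re s - 1) * (u - n)"
    using n u s by (intro norm_powr_diff_le_mean_value) auto
  also have "\<dots> \<le> norm s * n powr (- Re s - 1) * 1" using u by (intro mult_left_mono) auto
  also have "\<dots> = n powr (- Re s) * q" using n by (simp add: powr_diff q_def)
  finally have mean_value: "?X \<le> n powr (- Re s) * q" .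
  have "min 2 q \<le> 2 * q powr \<theta>"
  proof (cases "q \<le> 1")
    case True
    then have "q powr 1 \<le> q powr \<theta>" using q \<theta> by (intro powr_mono') auto
    then show ?thesis using q powr_ge_zero[of q \<theta>] by simp
  next
    case False
    then have "1 \<le> q powr \<theta>" using \<theta> by (intro ge_one_powr_ge_zero) auto
    then show ?thesis by simp
  qed
  then have "n powr (- Re s) * min 2 q \<le> n powr (- Re s) * (2 * q powr \<theta>)"
    by (intro mult_left_mono) auto
  moreover have "?X \<le> n powr (- Re s) * min 2 q" using trivial mean_value by (simp add: min_def)
  moreover have "n powr (- Re s) * (2 * q powr \<theta>) = 2 * norm s powr \<theta> * n powr (- Re s - \<theta>)"
    using n q by (simp add: q_def powr_divide powr_diff)
  ultimately show ?thesis by linarith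
qed

lemma summable_Suc_powr: "p > 1 \<Longrightarrow> summable (\<lambda>n. real (Suc n) powr (- p))"
  using summable_real_powr_iff[of "- p"] summable_Suc_iff[of "\<lambda>n. real n powr (- p)"] by simp

lemma norm_suminf_powr_le:
  fixes f :: "nat \<Rightarrow> complex"
  assumes "p > 1" "\<And>n. norm (f n) \<le> B * real (Suc n) powr (- p)"
  shows "norm (suminf f) \<le> B * (\<Sum>n. real (Suc n) powr (- p))"
proof -
  have "norm (suminf f) \<le> (\<Sum>n. B * real (Suc n) powr (- p))"
    by (intro norm_suminf_le assms summable_mult summable_Suc_powr)
  also have "\<dots> = B * (\<Sum>n. real (Suc n) powr (- p))"
    by (intro suminf_mult summable_Suc_powr assms)
  finally show ?thesis .
qed

lemma half_plane_locally_dominated: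
  fixes f :: "nat \<Rightarrow> complex \<Rightarrow> complex"
  assumes B: "continuous_on UNIV B" and z: "Re z > 0"
    and bound: "\<And>n s. Re s > 0 \<Longrightarrow> norm (f n s) \<le> B s * real (Suc n) powr (- Re s - 1)"
  shows "\<exists>d h. 0 < d \<and> summable h \<and> (\<forall>\<^sub>F n in sequentially. \<forall>y\<in>ball z d \<inter> {s. Re s > 0}. norm (f n y) \<le> h n)"
proof -
  define d where "d = Re z / 2"
  have d: "d > 0" using z by (simp add: d_def)
  have "bounded (B ` cball z d)"
    by (intro compact_imp_bounded compact_continuous_image continuous_on_subset[OF B]) auto
  then obtain M where M: "\<forall>y\<in>cball z d. \<bar>B y\<bar> \<le> M"
    unfolding bounded_iff by auto
  have "norm (f n y) \<le> M * real (Suc n) powr (- (1 + d))" if "y \<in> ball z d \<inter> {s. Re s > 0}" for n y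
  proof -
    have "\<bar>B y\<bar> \<le> M" using M that by (meson IntD1 ball_subset_cball subsetD)
    have "\<bar>Re z - Re y\<bar> \<le> norm (z - y)" using abs_Re_le_cmod[of "z - y"] by simp
    moreover have "norm (z - y) < d" using that by (simp add: dist_norm)
    ultimately have "d \<le> Re y" unfolding d_def by linarith
    have "norm (f n y) \<le> B y * real (Suc n) powr (- Re y - 1)" using bound that by simp
    also have "\<dots> \<le> M * real (Suc n) powr (- (1 + d))"
      using \<open>\<bar>B y\<bar> \<le> M\<close> \<open>d \<le> Re y\<close> by (intro mult_mono powr_mono) auto
    finally show ?thesis .
  qed
  then show ?thesis
    using d by (intro exI[of _ d] exI[of _ "\<lambda>n. M * real (Suc n) powr (- (1 + d))"] conjI
        summable_mult summable_Suc_powr) auto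
qed

lemma
  fixes f :: "nat \<Rightarrow> complex \<Rightarrow> complex"
  assumes hol: "\<And>n. f n holomorphic_on {s. Re s > 0}" and B: "continuous_on UNIV B"
    and bound: "\<And>n s. Re s > 0 \<Longrightarrow> norm (f n s) \<le> B s * real (Suc n) powr (- Re s - 1)"
  shows suminf_half_plane_holomorphic: "(\<lambda>s. \<Sum>n. f n s) holomorphic_on {s. Re s > 0}"
    and suminf_half_plane_sums: "Re s > 0 \<Longrightarrow> (\<lambda>n. f n s) sums (\<Sum>n. f n s)"
proof -
  let ?S = "{s. Re s > 0}"
  have S: "open ?S" by (rule open_halfspace_Re_gt)
  have "\<exists>g g'. \<forall>z\<in>?S. (\<lambda>n. f n z) sums g z \<and> (\<lambda>n. deriv (f n) z) sums g' z \<and> (g has_field_derivative g' z) (at z)"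
    by (rule series_and_derivative_comparison_local[OF S holomorphic_derivI[OF hol S]
          half_plane_locally_dominated[OF B _ bound]]) auto
  then obtain g g' where g: "\<And>z. z \<in> ?S \<Longrightarrow> (\<lambda>n. f n z) sums g z"
    "\<And>z. z \<in> ?S \<Longrightarrow> (g has_field_derivative g' z) (at z)" by metis
  then have "(\<lambda>s. \<Sum>n. f n s) holomorphic_on ?S \<longleftrightarrow> g holomorphic_on ?S"
    by (intro holomorphic_cong) (auto simp: sums_iff)
  then show "(\<lambda>s. \<Sum>n. f n s) holomorphic_on ?S"
    using g(2) unfolding holomorphic_on_open[OF S] by blast
  show "(\<lambda>n. f n s) sums (\<Sum>n. f n s)" if "Re s > 0"
    using g(1)[of s] that by (simp add: sums_iff)
qed

text \<open>The continuation of \<open>\<Sum> a\<^sub>n n\<^bsup>-s\<^esup>\<close> by summation by parts, in terms of the partial sums \<open>b\<^sub>n\<close> of \<open>a\<^sub>n\<close>.\<close>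

definition abel_term :: "(nat \<Rightarrow> real) \<Rightarrow> nat \<Rightarrow> complex \<Rightarrow> complex" where
  "abel_term b n s = of_real (b (Suc n)) * (of_nat (Suc n) powr (- s) - of_nat (Suc (Suc n)) powr (- s))"

definition abel_series :: "(nat \<Rightarrow> real) \<Rightarrow> complex \<Rightarrow> complex" where
  "abel_series b s = (\<Sum>n. abel_term b n s)"

lemma norm_abel_term_le:
  assumes b: "\<bar>b (Suc n)\<bar> \<le> 1" and "Re s > 0" "0 \<le> \<theta>" "\<theta> \<le> 1"
  shows "norm (abel_term b n s) \<le> 2 * norm s powr \<theta> * real (Suc n) powr (- Re s - \<theta>)"
proof -
  let ?X = "norm (complex_of_real (real (Suc (Suc n))) powr (- s) - of_real (real (Suc n)) powr (- s))"
  have "norm (abel_term b n s) = \<bar>b (Suc n)\<bar> * ?X"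
    by (simp add: abel_term_def norm_mult norm_minus_commute)
  also have "\<dots> \<le> 1 * ?X" using b by (intro mult_right_mono) auto
  also have "?X \<le> 2 * norm s powr \<theta> * real (Suc n) powr (- Re s - \<theta>)"
    using assms by (intro norm_powr_diff_le) auto
  finally show ?thesis by simp
qed

lemma
  assumes "\<And>n. \<bar>b n\<bar> \<le> 1"
  shows abel_series_holomorphic: "abel_series b holomorphic_on {s. Re s > 0}"
    and abel_series_sums: "Re s > 0 \<Longrightarrow> (\<lambda>n. abel_term b n s) sums abel_series b s"
proof -
  have hol: "abel_term b n holomorphic_on {s. Re s > 0}" for n
    unfolding abel_term_def[abs_def] by (intro holomorphic_intros)
  have cont: "continuous_on UNIV (\<lambda>s::complex. 2 * norm s)" by (intro continuous_intros)
  have bound: "norm (abel_term b n s) \<le> 2 * norm s * real (Suc n) powr (- Re s - 1)" if "Re s > 0" for n s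
    using norm_abel_term_le[of b n s 1] assms that by simp
  show "abel_series b holomorphic_on {s. Re s > 0}"
    using suminf_half_plane_holomorphic[OF hol cont bound] by (simp add: abel_series_def[abs_def])
  show "(\<lambda>n. abel_term b n s) sums abel_series b s" if "Re s > 0"
    unfolding abel_series_def by (rule suminf_half_plane_sums[OF hol cont bound that])
qed

lemma norm_abel_series_le:
  assumes "\<And>n. \<bar>b n\<bar> \<le> 1" "0 < \<sigma>" "\<sigma> \<le> Re s" "0 \<le> \<theta>" "\<theta> \<le> 1" "\<sigma> + \<theta> > 1"
  shows "norm (abel_series b s) \<le> 2 * norm s powr \<theta> * (\<Sum>n. real (Suc n) powr (- (\<sigma> + \<theta>)))"
  unfolding abel_series_def
proof (rule norm_suminf_powr_le)
  fix n
  have "norm (abel_term b n s) \<le> 2 * norm s powr \<theta> * real (Suc n) powr (- Re s - \<theta>)"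
    using assms by (intro norm_abel_term_le) auto
  also have "\<dots> \<le> 2 * norm s powr \<theta> * real (Suc n) powr (- (\<sigma> + \<theta>))"
    using assms by (intro mult_left_mono powr_mono) auto
  finally show "norm (abel_term b n s) \<le> 2 * norm s powr \<theta> * real (Suc n) powr (- (\<sigma> + \<theta>))" .
qed (use assms in auto)

lemma dseries_Suc_sums:
  assumes "abs_conv_gt1 a" "Re s > 1"
  shows "(\<lambda>n. of_real (a (Suc n)) * of_nat (Suc n) powr (- s)) sums dseries a s"
proof -
  have "(\<lambda>n. dterm a (Suc n) s) sums dseries a s"
    using dseries_sums[OF assms] by (subst sums_Suc_iff) simp
  then show ?thesis by (simp add: dterm_def)
qed

lemma abel_series_eq_dseries:
  assumes a: "abs_conv_gt1 a" and b: "\<And>n. \<bar>b n\<bar> \<le> 1" "b 0 = 0"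
    and diff: "\<And>n. a (Suc n) = b (Suc n) - b n" and s: "Re s > 1"
  shows "abel_series b s = dseries a s"
proof -
  note B = dseries_Suc_sums[OF abs_conv_gt1_bounded[of b, OF b(1)] s]
  from sums_diff[OF B dseries_Suc_sums[OF a s]]
  have "(\<lambda>n. complex_of_real (b n) * of_nat (Suc n) powr (- s)) sums (dseries b s - dseries a s)"
    by (simp add: diff algebra_simps)
  then have "(\<lambda>n. complex_of_real (b (Suc n)) * of_nat (Suc (Suc n)) powr (- s)) sums (dseries b s - dseries a s)"
    by (subst sums_Suc_iff) (simp add: b(2))
  from sums_diff[OF B this] have "(\<lambda>n. abel_term b n s) sums dseries a s"
    by (simp add: abel_term_def algebra_simps)
  then show ?thesis by (simp add: abel_series_def sums_iff)
qed

text \<open>\<open>zeta_reg s\<close> is the continuation of \<open>(s - 1) \<zeta>(s)\<close>.\<close>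

definition zeta_term :: "nat \<Rightarrow> complex \<Rightarrow> complex" where
  "zeta_term n s = of_nat (Suc (Suc n)) powr (1 - s) - of_nat (Suc n) powr (1 - s) + (s - 1) * of_nat (Suc n) powr (- s)"

definition zeta_reg :: "complex \<Rightarrow> complex" where
  "zeta_reg s = 1 + (\<Sum>n. zeta_term n s)"

lemma norm_zeta_term_le:
  assumes s: "Re s > 0" and \<theta>: "0 \<le> \<theta>" "\<theta> \<le> 1"
  shows "norm (zeta_term n s) \<le> 2 * norm (s - 1) * norm s powr \<theta> * real (Suc n) powr (- Re s - \<theta>)"
proof -
  define m where "m = real (Suc n)"
  let ?S = "closed_segment (complex_of_real m) (of_real (m + 1))"
  define f where "f = (\<lambda>z. z powr (1 - s) - z * ((1 - s) * of_real m powr (- s)))"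
  define B where "B = norm (s - 1) * (2 * norm s powr \<theta> * m powr (- Re s - \<theta>))"
  have "norm (f (of_real (m + 1)) - f (of_real m)) \<le> B * norm (complex_of_real (m + 1) - of_real m)"
  proof (rule field_differentiable_bound[of ?S f "\<lambda>z. (1 - s) * (z powr (- s) - of_real m powr (- s))"])
    fix z assume "z \<in> ?S"
    then obtain x where x: "m \<le> x" "x \<le> m + 1" "z = of_real x" by (elim closed_segment_of_realE) auto
    have "(f has_field_derivative (1 - s) * z powr (1 - s - 1) - 1 * ((1 - s) * of_real m powr (- s))) (at z within ?S)"
      unfolding f_def x(3) using x(1)
      by (intro DERIV_diff has_field_derivative_powr_of_real DERIV_cmult_right DERIV_ident) (simp add: m_def)
    then show "(f has_field_derivative (1 - s) * (z powr (- s) - of_real m powr (- s))) (at z within ?S)"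
      by (simp add: algebra_simps)
    have "norm (complex_of_real x powr (- s) - of_real m powr (- s)) \<le> 2 * norm s powr \<theta> * m powr (- Re s - \<theta>)"
      using x s \<theta> by (intro norm_powr_diff_le) (auto simp: m_def)
    then show "norm ((1 - s) * (z powr (- s) - of_real m powr (- s))) \<le> B"
      unfolding B_def x(3) norm_mult norm_minus_commute[of 1] by (intro mult_left_mono) auto
  qed auto
  moreover have "f (of_real (m + 1)) - f (of_real m) = zeta_term n s"
    unfolding f_def m_def zeta_term_def by (simp add: algebra_simps)
  ultimately show ?thesis by (simp add: B_def m_def mult_ac)
qed

lemma zeta_reg_holomorphic: "zeta_reg holomorphic_on {s. Re s > 0}"
  and zeta_reg_sums: "Re s > 0 \<Longrightarrow> (\<lambda>n. zeta_term n s) sums (zeta_reg s - 1)"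
proof -
  have hol: "zeta_term n holomorphic_on {s. Re s > 0}" for n
    unfolding zeta_term_def[abs_def] by (intro holomorphic_intros)
  have cont: "continuous_on UNIV (\<lambda>s::complex. 2 * norm (s - 1) * norm s)" by (intro continuous_intros)
  have bound: "norm (zeta_term n s) \<le> 2 * norm (s - 1) * norm s * real (Suc n) powr (- Re s - 1)" if "Re s > 0" for n s
    using norm_zeta_term_le[of s 1 n] that by simp
  show "zeta_reg holomorphic_on {s. Re s > 0}"
    unfolding zeta_reg_def[abs_def]
    by (intro holomorphic_on_add holomorphic_on_const suminf_half_plane_holomorphic[OF hol cont bound])
  show "(\<lambda>n. zeta_term n s) sums (zeta_reg s - 1)" if "Re s > 0"
    using suminf_half_plane_sums[OF hol cont bound that] by (simp add: zeta_reg_def)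
qed

lemma norm_zeta_reg_le:
  assumes "0 < \<sigma>" "\<sigma> \<le> Re s" "0 \<le> \<theta>" "\<theta> \<le> 1" "\<sigma> + \<theta> > 1"
  shows "norm (zeta_reg s) \<le> 1 + 2 * norm (s - 1) * norm s powr \<theta> * (\<Sum>n. real (Suc n) powr (- (\<sigma> + \<theta>)))"
proof -
  have "norm (\<Sum>n. zeta_term n s) \<le> 2 * norm (s - 1) * norm s powr \<theta> * (\<Sum>n. real (Suc n) powr (- (\<sigma> + \<theta>)))"
  proof (rule norm_suminf_powr_le)
    fix n
    have "norm (zeta_term n s) \<le> 2 * norm (s - 1) * norm s powr \<theta> * real (Suc n) powr (- Re s - \<theta>)"
      using assms by (intro norm_zeta_term_le) auto
    also have "\<dots> \<le> 2 * norm (s - 1) * norm s powr \<theta> * real (Suc n) powr (- (\<sigma> + \<theta>))"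
      using assms by (intro mult_left_mono powr_mono) auto
    finally show "norm (zeta_term n s) \<le> 2 * norm (s - 1) * norm s powr \<theta> * real (Suc n) powr (- (\<sigma> + \<theta>))" .
  qed (use assms in auto)
  then show ?thesis unfolding zeta_reg_def by (intro order.trans[OF norm_triangle_ineq]) simp
qed

lemma zeta_reg_1: "zeta_reg 1 = 1"
  by (simp add: zeta_reg_def zeta_term_def del: of_nat_Suc)

lemma zeta_reg_eq_dseries:
  assumes "Re s > 1"
  shows "zeta_reg s = (s - 1) * dseries (\<lambda>_. 1) s"
proof -
  have "(\<lambda>n. of_nat (Suc n) powr (1 - s)) \<longlonglongrightarrow> (0::complex)"
    using assms by (intro LIMSEQ_Suc tendsto_neg_powr_complex_of_nat filterlim_ident) auto
  from telescope_sums[OF this]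
  have "(\<lambda>n. of_nat (Suc (Suc n)) powr (1 - s) - of_nat (Suc n) powr (1 - s)) sums (- 1 :: complex)" by simp
  moreover have "(\<lambda>n. (s - 1) * of_nat (Suc n) powr (- s)) sums ((s - 1) * dseries (\<lambda>_. 1) s)"
    using sums_mult[OF dseries_Suc_sums[OF abs_conv_gt1_const[of 1] assms]] by simp
  ultimately have "(\<lambda>n. zeta_term n s) sums (- 1 + (s - 1) * dseries (\<lambda>_. 1) s)"
    unfolding zeta_term_def by (rule sums_add)
  moreover have "(\<lambda>n. zeta_term n s) sums (zeta_reg s - 1)" using assms by (intro zeta_reg_sums) simp
  ultimately have "zeta_reg s - 1 = - 1 + (s - 1) * dseries (\<lambda>_. 1) s" using sums_unique2 by blast
  then show ?thesis by simp
qed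

definition chi4 :: "nat \<Rightarrow> real" where
  "chi4 n = (if n mod 4 = 1 then 1 else if n mod 4 = 3 then -1 else 0)"

definition chi4_sum :: "nat \<Rightarrow> real" where
  "chi4_sum n = (if n mod 4 = 1 \<or> n mod 4 = 2 then 1 else 0)"

lemma mod_4_cases: "(n::nat) mod 4 \<in> {0, 1, 2, 3}"
  by auto

interpretation chi4: bounded_completely_multiplicative chi4
proof
  fix m n :: nat
  have "(m * n) mod 4 = ((m mod 4) * (n mod 4)) mod 4" by (simp add: mod_mult_eq)
  then show "chi4 (m * n) = chi4 m * chi4 n"
    using mod_4_cases[of m] mod_4_cases[of n] by (auto simp: chi4_def)
qed (simp add: chi4_def)

interpretation one: bounded_completely_multiplicative "\<lambda>_. 1"
  by standard auto

lemma chi4_Suc: "chi4 (Suc n) = chi4_sum (Suc n) - chi4_sum n"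
  using mod_4_cases[of n] by (auto simp: chi4_def chi4_sum_def mod_Suc)

lemma chi4_sum_le_1: "\<bar>chi4_sum n\<bar> \<le> 1"
  by (simp add: chi4_sum_def)

definition L_chi4 :: "complex \<Rightarrow> complex" where
  "L_chi4 = abel_series chi4_sum"

lemma L_chi4_holomorphic: "L_chi4 holomorphic_on {s. Re s > 0}"
  unfolding L_chi4_def using chi4_sum_le_1 by (rule abel_series_holomorphic)

lemma L_chi4_eq_dseries: "Re s > 1 \<Longrightarrow> L_chi4 s = dseries chi4 s"
  unfolding L_chi4_def
  by (intro abel_series_eq_dseries chi4.abs_conv chi4_sum_le_1 chi4_Suc) (simp add: chi4_sum_def)

lemma L_chi4_of_real_pos:
  assumes "x > 0"
  shows "Re (L_chi4 (of_real x)) > 0"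
proof -
  define t where "t = (\<lambda>n. chi4_sum (Suc n) * (real (Suc n) powr (- x) - real (Suc (Suc n)) powr (- x)))"
  have "of_nat n powr (- complex_of_real x) = of_real (real n powr (- x))" for n
    by (metis of_nat_0_le_iff of_real_minus of_real_of_nat_eq powr_of_real)
  then have "abel_term chi4_sum n (of_real x) = of_real (t n)" for n
    by (simp add: abel_term_def t_def del: of_nat_Suc)
  then have "t sums Re (L_chi4 (of_real x))"
    using sums_Re[OF abel_series_sums[of chi4_sum "of_real x", OF chi4_sum_le_1]] assms
    by (simp add: L_chi4_def)
  moreover have "t n \<ge> 0" for n
    unfolding t_def using assms by (intro mult_nonneg_nonneg) (auto simp: chi4_sum_def intro!: powr_mono2')
  moreover have "2 powr (- x) < (1::real)" using assms by (simp add: powr_minus divide_simps)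
  then have "t 0 > 0" by (simp add: t_def chi4_sum_def)
  ultimately show ?thesis using suminf_pos2[of t 0] by (auto simp: sums_iff)
qed

definition zeta :: "complex \<Rightarrow> complex" where
  "zeta s = zeta_reg s / (s - 1)"

text \<open>\<open>dedekind_zeta\<close> is the zeta function of \<open>\<rat>(\<i>)\<close>, and \<open>dedekind_zeta_reg s\<close> is the continuation of \<open>(s - 1) dedekind_zeta s\<close>.\<close>

definition dedekind_zeta_reg :: "complex \<Rightarrow> complex" where
  "dedekind_zeta_reg s = zeta_reg s * L_chi4 s"

definition dedekind_zeta :: "complex \<Rightarrow> complex" where
  "dedekind_zeta s = zeta s * L_chi4 s"

lemma zeta_eq_dseries: "Re s > 1 \<Longrightarrow> zeta s = dseries (\<lambda>_. 1) s"
  by (auto simp: zeta_def zeta_reg_eq_dseries)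

lemma dedekind_zeta_eq_dseries: "Re s > 1 \<Longrightarrow> dedekind_zeta s = dseries (\<lambda>_. 1) s * dseries chi4 s"
  by (simp add: dedekind_zeta_def zeta_eq_dseries L_chi4_eq_dseries)

lemma dedekind_zeta_reg_eq: "s \<noteq> 1 \<Longrightarrow> dedekind_zeta_reg s = (s - 1) * dedekind_zeta s"
  by (simp add: dedekind_zeta_reg_def dedekind_zeta_def zeta_def)

abbreviation punctured_half_plane :: "complex set" where
  "punctured_half_plane \<equiv> {s. Re s > 0} - {1}"

lemma open_punctured_half_plane: "open punctured_half_plane"
  by (intro open_Diff open_halfspace_Re_gt) auto

lemma zeta_holomorphic: "zeta holomorphic_on punctured_half_plane"
  unfolding zeta_def[abs_def]
  by (intro holomorphic_intros holomorphic_on_subset[OF zeta_reg_holomorphic]) auto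

lemma dedekind_zeta_holomorphic: "dedekind_zeta holomorphic_on punctured_half_plane"
  unfolding dedekind_zeta_def[abs_def]
  by (intro holomorphic_intros zeta_holomorphic holomorphic_on_subset[OF L_chi4_holomorphic]) auto

lemma dedekind_zeta_reg_holomorphic: "dedekind_zeta_reg holomorphic_on {s. Re s > 0}"
  unfolding dedekind_zeta_reg_def[abs_def]
  by (intro holomorphic_intros zeta_reg_holomorphic L_chi4_holomorphic)

definition dedekind_mangoldt :: "nat \<Rightarrow> real" where
  "dedekind_mangoldt n = (1 + chi4 n) * mangoldt n"

lemma dedekind_mangoldt_eq: "dedekind_mangoldt n = 1 * mangoldt n + chi4 n * mangoldt n"
  by (simp add: dedekind_mangoldt_def algebra_simps)

lemma dedekind_mangoldt_nonneg: "dedekind_mangoldt n \<ge> 0"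
  unfolding dedekind_mangoldt_def
  using mangoldt_nonneg[of n] by (intro mult_nonneg_nonneg) (auto simp: chi4_def)

lemma abs_conv_gt1_dedekind_mangoldt: "abs_conv_gt1 dedekind_mangoldt"
  unfolding dedekind_mangoldt_eq[abs_def]
  by (intro abs_conv_gt1_add abs_conv_gt1_mangoldt one.abs_le_1 chi4.abs_le_1)

lemma dedekind_zeta_deriv_eq:
  assumes s: "Re s > 1"
  shows "deriv dedekind_zeta s = - dseries dedekind_mangoldt s * dedekind_zeta s"
proof -
  have "((\<lambda>s. dseries (\<lambda>_. 1) s * dseries chi4 s) has_field_derivative
     (- dseries (\<lambda>n. 1 * ln (real n)) s * dseries chi4 s + (- dseries (\<lambda>n. chi4 n * ln (real n)) s) * dseries (\<lambda>_. 1) s)) (at s)"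
    by (intro DERIV_mult dseries_deriv one.abs_conv chi4.abs_conv s)
  then have "(dedekind_zeta has_field_derivative
     (- dseries (\<lambda>n. 1 * ln (real n)) s * dseries chi4 s + (- dseries (\<lambda>n. chi4 n * ln (real n)) s) * dseries (\<lambda>_. 1) s)) (at s)"
    by (rule has_field_derivative_transform_within_open[OF _ open_halfspace_Re_gt[of 1]])
       (use s in \<open>auto simp: dedekind_zeta_eq_dseries\<close>)
  moreover have "dseries dedekind_mangoldt s = dseries (\<lambda>n. 1 * mangoldt n) s + dseries (\<lambda>n. chi4 n * mangoldt n) s"
    unfolding dedekind_mangoldt_eq[abs_def]
    by (intro dseries_add abs_conv_gt1_mangoldt one.abs_le_1 chi4.abs_le_1 s)
  ultimately show ?thesis
    using one.dseries_mangoldt[OF s] chi4.dseries_mangoldt[OF s] dedekind_zeta_eq_dseries[OF s]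
    by (simp add: DERIV_imp_deriv algebra_simps flip: one.dseries_mangoldt[OF s] chi4.dseries_mangoldt[OF s])
qed

lemma dedekind_zeta_eq_exp:
  obtains K where "K \<noteq> 0"
    "\<And>s. Re s > 1 \<Longrightarrow> dedekind_zeta s = K * exp (dseries (\<lambda>n. dedekind_mangoldt n / ln (real n)) s)"
proof -
  obtain K1 where K1: "\<And>s. Re s > 1 \<Longrightarrow> dseries (\<lambda>_. 1) s = K1 * exp (dseries (\<lambda>n. 1 * mangoldt n / ln (real n)) s)"
    using one.dseries_eq_exp by blast
  obtain K2 where K2: "\<And>s. Re s > 1 \<Longrightarrow> dseries chi4 s = K2 * exp (dseries (\<lambda>n. chi4 n * mangoldt n / ln (real n)) s)"
    using chi4.dseries_eq_exp by blast
  have "K1 \<noteq> 0" using K1[of 2] dseries_of_real_pos[OF one.abs_conv, of 2] by auto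
  moreover have "K2 \<noteq> 0" using K2[of 2] L_chi4_of_real_pos[of 2] L_chi4_eq_dseries[of 2] by auto
  moreover have "dedekind_zeta s = (K1 * K2) * exp (dseries (\<lambda>n. dedekind_mangoldt n / ln (real n)) s)" if "Re s > 1" for s
  proof -
    have "dseries (\<lambda>n. dedekind_mangoldt n / ln (real n)) s =
      dseries (\<lambda>n. 1 * mangoldt n / ln (real n) + chi4 n * mangoldt n / ln (real n)) s"
      by (simp add: dedekind_mangoldt_eq add_divide_distrib)
    also have "\<dots> = dseries (\<lambda>n. 1 * mangoldt n / ln (real n)) s + dseries (\<lambda>n. chi4 n * mangoldt n / ln (real n)) s"
      by (intro dseries_add abs_conv_gt1_mangoldt_div_ln that one.abs_le_1 chi4.abs_le_1)
    finally show ?thesis using dedekind_zeta_eq_dseries[OF that] K1[OF that] K2[OF that] by (simp add: exp_add)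
  qed
  ultimately show ?thesis using that[of "K1 * K2"] by auto
qed

lemma norm_dedekind_zeta_341:
  obtains k where "k > 0"
    "\<And>\<sigma> t. \<sigma> > 1 \<Longrightarrow> k \<le> norm (dedekind_zeta (of_real \<sigma>)) ^ 3 * norm (dedekind_zeta (Complex \<sigma> t)) ^ 4 * norm (dedekind_zeta (Complex \<sigma> (2 * t)))"
proof -
  define b where "b = (\<lambda>n. dedekind_mangoldt n / ln (real n))"
  obtain K where K: "K \<noteq> 0" "\<And>s. Re s > 1 \<Longrightarrow> dedekind_zeta s = K * exp (dseries b s)"
    unfolding b_def using dedekind_zeta_eq_exp by blast
  have b: "abs_conv_gt1 b"
    unfolding b_def dedekind_mangoldt_eq add_divide_distrib
    by (intro abs_conv_gt1_add abs_conv_gt1_mangoldt_div_ln one.abs_le_1 chi4.abs_le_1)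
  have b0: "b n \<ge> 0" for n
    unfolding b_def using dedekind_mangoldt_nonneg by (cases "n = 0") auto
  have norm_eq: "norm (dedekind_zeta s) = norm K * exp (Re (dseries b s))" if "Re s > 1" for s
    using K(2)[OF that] by (simp add: norm_mult)
  show ?thesis
  proof (rule that[of "norm K ^ 8"])
    show "norm K ^ 8 > 0" using K(1) by simp
    fix \<sigma> t :: real assume \<sigma>: "\<sigma> > 1"
    have exps: "exp (3 * x) = exp x ^ 3" "exp (4 * x) = exp x ^ 4" for x :: real
      using exp_of_nat_mult[of 3 x] exp_of_nat_mult[of 4 x] by simp_all
    have "norm K ^ 8 * 1 \<le> norm K ^ 8 * exp (3 * Re (dseries b (of_real \<sigma>)) + 4 * Re (dseries b (Complex \<sigma> t)) + Re (dseries b (Complex \<sigma> (2 * t))))"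
      using dseries_341[OF b b0 \<sigma>] by (intro mult_left_mono) auto
    also have "\<dots> = norm (dedekind_zeta (of_real \<sigma>)) ^ 3 * norm (dedekind_zeta (Complex \<sigma> t)) ^ 4 * norm (dedekind_zeta (Complex \<sigma> (2 * t)))"
      using \<sigma> by (simp add: norm_eq power_mult_distrib exp_add exps power_numeral_reduce)
    finally show "norm K ^ 8 \<le> norm (dedekind_zeta (of_real \<sigma>)) ^ 3 * norm (dedekind_zeta (Complex \<sigma> t)) ^ 4 * norm (dedekind_zeta (Complex \<sigma> (2 * t)))" by simp
  qed
qed

lemma dedekind_zeta_341:
  obtains k where "0 < k" "k \<le> 1"
    "\<And>\<sigma> t. 1 < \<sigma> \<Longrightarrow> \<sigma> \<le> 2 \<Longrightarrow> k * (\<sigma> - 1) ^ 3 \<le> norm (dedekind_zeta (Complex \<sigma> t)) ^ 4 * norm (dedekind_zeta (Complex \<sigma> (2 * t)))"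
proof -
  obtain k where k: "k > 0" "\<And>\<sigma> t. \<sigma> > 1 \<Longrightarrow>
      k \<le> norm (dedekind_zeta (of_real \<sigma>)) ^ 3 * norm (dedekind_zeta (Complex \<sigma> t)) ^ 4 * norm (dedekind_zeta (Complex \<sigma> (2 * t)))"
    by (rule norm_dedekind_zeta_341) blast
  have "bounded (dedekind_zeta_reg ` complex_of_real ` {1..2})"
    by (intro compact_imp_bounded compact_continuous_image continuous_intros
        holomorphic_on_imp_continuous_on[OF holomorphic_on_subset[OF dedekind_zeta_reg_holomorphic]]) auto
  then obtain C where C: "\<And>\<sigma>. 1 \<le> \<sigma> \<Longrightarrow> \<sigma> \<le> 2 \<Longrightarrow> norm (dedekind_zeta_reg (of_real \<sigma>)) \<le> C"
    unfolding bounded_iff by force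
  define k' where "k' = min 1 (k / (max 1 C) ^ 3)"
  show ?thesis
  proof (rule that)
    show "0 < k'" "k' \<le> 1" using k(1) by (auto simp: k'_def)
    fix \<sigma> t :: real assume \<sigma>: "1 < \<sigma>" "\<sigma> \<le> 2"
    define G where "G = norm (dedekind_zeta (Complex \<sigma> t)) ^ 4 * norm (dedekind_zeta (Complex \<sigma> (2 * t)))"
    have "G \<ge> 0" by (simp add: G_def)
    have "norm (complex_of_real \<sigma> - 1) = \<sigma> - 1"
      using \<sigma> norm_of_real[of "\<sigma> - 1", where ?'a = complex] by simp
    then have "(\<sigma> - 1) * norm (dedekind_zeta (of_real \<sigma>)) = norm (dedekind_zeta_reg (of_real \<sigma>))"
      using dedekind_zeta_reg_eq[of "of_real \<sigma>"] \<sigma> by (simp add: norm_mult)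
    then have pole: "(\<sigma> - 1) * norm (dedekind_zeta (of_real \<sigma>)) \<le> max 1 C" using C[of \<sigma>] \<sigma> by simp
    have "k * (\<sigma> - 1) ^ 3 \<le> norm (dedekind_zeta (of_real \<sigma>)) ^ 3 * G * (\<sigma> - 1) ^ 3"
      using k(2)[OF \<sigma>(1), of t] \<sigma> by (intro mult_right_mono) (auto simp: G_def mult.assoc)
    also have "\<dots> = ((\<sigma> - 1) * norm (dedekind_zeta (of_real \<sigma>))) ^ 3 * G"
      by (simp add: power_mult_distrib)
    also have "\<dots> \<le> (max 1 C) ^ 3 * G"
      using pole \<sigma> \<open>G \<ge> 0\<close> by (intro mult_right_mono power_mono) auto
    finally have "k / (max 1 C) ^ 3 * (\<sigma> - 1) ^ 3 \<le> G" by (simp add: field_simps)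
    moreover have "k' * (\<sigma> - 1) ^ 3 \<le> k / (max 1 C) ^ 3 * (\<sigma> - 1) ^ 3"
      using \<sigma> by (intro mult_right_mono) (auto simp: k'_def)
    ultimately show "k' * (\<sigma> - 1) ^ 3 \<le> norm (dedekind_zeta (Complex \<sigma> t)) ^ 4 * norm (dedekind_zeta (Complex \<sigma> (2 * t)))"
      by (simp add: G_def)
  qed
qed

text \<open>
  The first hypothesis bounds \<open>G\<close> from below for \<open>\<sigma> \<ge> 1 + k/(16 M\<^sup>5)\<close>, and the Lipschitz condition carries this
  over to smaller \<open>\<sigma>\<close>.
\<close>

lemma lower_bound_of_341:
  fixes G :: "real \<Rightarrow> real"
  assumes k: "0 < k" "k \<le> 1" and M: "M \<ge> 1" and nonneg: "\<And>\<sigma>. G \<sigma> \<ge> 0"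
    and power: "\<And>\<sigma>. 1 < \<sigma> \<Longrightarrow> \<sigma> \<le> 2 \<Longrightarrow> k * (\<sigma> - 1) ^ 3 \<le> G \<sigma> ^ 4 * M"
    and lipschitz: "\<And>\<sigma> \<tau>. 1 < \<sigma> \<Longrightarrow> \<sigma> \<le> \<tau> \<Longrightarrow> \<tau> \<le> 2 \<Longrightarrow> \<bar>G \<tau> - G \<sigma>\<bar> \<le> M * (\<tau> - \<sigma>)"
    and \<sigma>: "1 < \<sigma>" "\<sigma> \<le> 2"
  shows "k / 16 / M ^ 4 \<le> G \<sigma>"
proof -
  define c where "c = k / 16"
  define a where "a = c / M ^ 5"
  have "c > 0" "c \<le> 1" using k by (auto simp: c_def)
  have "1 \<le> M ^ 5" using M by simp
  then have "c \<le> M ^ 5" using \<open>c \<le> 1\<close> by linarith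
  then have a: "a > 0" "a \<le> 1" using \<open>c > 0\<close> M by (auto simp: a_def)
  have far: "2 * c / M ^ 4 \<le> G \<tau>" if "1 + a \<le> \<tau>" "\<tau> \<le> 2" for \<tau>
  proof (rule power_le_imp_le_base[of _ 3])
    have "(2 * c / M ^ 4) ^ 4 = k * a ^ 3 / M"
      using M by (simp add: a_def c_def power_divide power_mult_distrib field_simps flip: power_mult power_Suc power_add)
    also have "\<dots> \<le> k * (\<tau> - 1) ^ 3 / M"
      using that a k M by (intro divide_right_mono mult_left_mono power_mono) auto
    also have "\<dots> \<le> G \<tau> ^ 4" using power[of \<tau>] that a M by (simp add: field_simps)
    finally show "(2 * c / M ^ 4) ^ Suc 3 \<le> G \<tau> ^ Suc 3" by simp
  qed (rule nonneg)
  have "c / M ^ 4 \<le> G \<sigma>"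
  proof (cases "1 + a \<le> \<sigma>")
    case True
    have "c / M ^ 4 \<le> 2 * c / M ^ 4" using \<open>c > 0\<close> M by (intro divide_right_mono) auto
    then show ?thesis using far[of \<sigma>] True \<sigma> by simp
  next
    case False
    have "\<bar>G (1 + a) - G \<sigma>\<bar> \<le> M * (1 + a - \<sigma>)" using False \<sigma> a by (intro lipschitz) auto
    also have "\<dots> \<le> M * a" using \<sigma> M by (intro mult_left_mono) auto
    also have "\<dots> = c / M ^ 4" using M by (simp add: a_def power_numeral_reduce field_simps)
    finally show ?thesis using far[of "1 + a"] a by simp
  qed
  then show ?thesis by (simp add: c_def)
qed

lemma Complex_in_punctured_half_plane: "\<sigma> \<ge> 1 \<Longrightarrow> t \<noteq> 0 \<Longrightarrow> Complex \<sigma> t \<in> punctured_half_plane"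
  by (auto simp: complex_eq_iff)

lemma norm_diff_horizontal_le:
  assumes f: "f holomorphic_on punctured_half_plane" and "t \<noteq> 0" "1 \<le> \<sigma>" "\<sigma> \<le> \<tau>"
    and bound: "\<And>x. \<sigma> \<le> x \<Longrightarrow> x \<le> \<tau> \<Longrightarrow> norm (deriv f (Complex x t)) \<le> B"
  shows "norm (f (Complex \<tau> t) - f (Complex \<sigma> t)) \<le> B * (\<tau> - \<sigma>)"
proof -
  let ?S = "closed_segment (Complex \<sigma> t) (Complex \<tau> t)"
  have "norm (f (Complex \<tau> t) - f (Complex \<sigma> t)) \<le> B * norm (Complex \<tau> t - Complex \<sigma> t)"
  proof (rule field_differentiable_bound[of ?S f "deriv f"])
    fix z assume "z \<in> ?S"
    then have z: "z = Complex (Re z) t" "\<sigma> \<le> Re z" "Re z \<le> \<tau>"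
      using assms(4) closed_segment_same_Im[of "Complex \<sigma> t" "Complex \<tau> t"]
      by (auto simp: complex_eq_iff closed_segment_eq_real_ivl)
    then have "z \<in> punctured_half_plane"
      using Complex_in_punctured_half_plane[of "Re z" t] assms by auto
    then show "(f has_field_derivative deriv f z) (at z within ?S)"
      using holomorphic_derivI[OF f open_punctured_half_plane] by blast
    show "norm (deriv f z) \<le> B" using bound[of "Re z"] z by simp
  qed auto
  also have "Complex \<tau> t - Complex \<sigma> t = of_real (\<tau> - \<sigma>)" by (simp add: complex_eq_iff)
  finally show ?thesis using assms(4) by (simp only: norm_of_real)
qed

lemma dedekind_zeta_lower_bound:
  obtains c where "c > 0"
    "\<And>t M \<sigma>. t \<noteq> 0 \<Longrightarrow> M \<ge> 1 \<Longrightarrow>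
       (\<And>\<sigma>. 1 < \<sigma> \<Longrightarrow> \<sigma> \<le> 2 \<Longrightarrow> norm (dedekind_zeta (Complex \<sigma> (2 * t))) \<le> M) \<Longrightarrow>
       (\<And>\<sigma>. 1 < \<sigma> \<Longrightarrow> \<sigma> \<le> 2 \<Longrightarrow> norm (deriv dedekind_zeta (Complex \<sigma> t)) \<le> M) \<Longrightarrow>
       1 < \<sigma> \<Longrightarrow> \<sigma> \<le> 2 \<Longrightarrow> c / M ^ 4 \<le> norm (dedekind_zeta (Complex \<sigma> t))"
proof -
  obtain k where k: "0 < k" "k \<le> 1" "\<And>\<sigma> t. 1 < \<sigma> \<Longrightarrow> \<sigma> \<le> 2 \<Longrightarrow>
      k * (\<sigma> - 1) ^ 3 \<le> norm (dedekind_zeta (Complex \<sigma> t)) ^ 4 * norm (dedekind_zeta (Complex \<sigma> (2 * t)))"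
    by (rule dedekind_zeta_341) blast
  show ?thesis
  proof (rule that[of "k / 16"])
    show "k / 16 > 0" using k(1) by simp
    fix t M \<sigma> :: real
    assume t: "t \<noteq> 0" and M: "M \<ge> 1"
      and bound: "\<And>\<sigma>. 1 < \<sigma> \<Longrightarrow> \<sigma> \<le> 2 \<Longrightarrow> norm (dedekind_zeta (Complex \<sigma> (2 * t))) \<le> M"
        "\<And>\<sigma>. 1 < \<sigma> \<Longrightarrow> \<sigma> \<le> 2 \<Longrightarrow> norm (deriv dedekind_zeta (Complex \<sigma> t)) \<le> M"
      and \<sigma>: "1 < \<sigma>" "\<sigma> \<le> 2"
    show "k / 16 / M ^ 4 \<le> norm (dedekind_zeta (Complex \<sigma> t))"
    proof (rule lower_bound_of_341[OF k(1,2) M _ _ _ \<sigma>])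
      fix \<sigma> :: real assume \<sigma>: "1 < \<sigma>" "\<sigma> \<le> 2"
      have "norm (dedekind_zeta (Complex \<sigma> t)) ^ 4 * norm (dedekind_zeta (Complex \<sigma> (2 * t)))
        \<le> norm (dedekind_zeta (Complex \<sigma> t)) ^ 4 * M"
        using bound(1)[OF \<sigma>] by (intro mult_left_mono) auto
      then show "k * (\<sigma> - 1) ^ 3 \<le> norm (dedekind_zeta (Complex \<sigma> t)) ^ 4 * M"
        using k(3)[OF \<sigma>, of t] by linarith
    next
      fix \<sigma> \<tau> :: real assume "1 < \<sigma>" "\<sigma> \<le> \<tau>" "\<tau> \<le> 2"
      then have "norm (dedekind_zeta (Complex \<tau> t) - dedekind_zeta (Complex \<sigma> t)) \<le> M * (\<tau> - \<sigma>)"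
        using t by (intro norm_diff_horizontal_le dedekind_zeta_holomorphic bound(2)) auto
      then show "\<bar>norm (dedekind_zeta (Complex \<tau> t)) - norm (dedekind_zeta (Complex \<sigma> t))\<bar> \<le> M * (\<tau> - \<sigma>)"
        using norm_triangle_ineq3 order.trans by blast
    qed simp
  qed
qed

lemma dedekind_zeta_nonzero_gt_1:
  assumes "Re s > 1"
  shows "dedekind_zeta s \<noteq> 0"
  using dedekind_zeta_eq_exp assms by (metis exp_not_eq_zero mult_eq_0_iff)

lemma bounded_on_horizontal_segment:
  assumes f: "f holomorphic_on punctured_half_plane" and "t \<noteq> 0"
  obtains M where "\<And>\<sigma>. 1 \<le> \<sigma> \<Longrightarrow> \<sigma> \<le> 2 \<Longrightarrow> norm (f (Complex \<sigma> t)) \<le> M"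
proof -
  have "bounded (f ` (\<lambda>\<sigma>. Complex \<sigma> t) ` {1..2})"
    using Complex_in_punctured_half_plane \<open>t \<noteq> 0\<close>
    by (intro compact_imp_bounded compact_continuous_image continuous_intros
        holomorphic_on_imp_continuous_on[OF holomorphic_on_subset[OF f]]) auto
  then show ?thesis using that unfolding bounded_iff by fastforce
qed

lemma dedekind_zeta_nonzero:
  assumes "Re s \<ge> 1" "s \<noteq> 1"
  shows "dedekind_zeta s \<noteq> 0"
proof (cases "Re s > 1")
  case True
  then show ?thesis by (rule dedekind_zeta_nonzero_gt_1)
next
  case False
  define t where "t = Im s"
  have s: "s = Complex 1 t" and t: "t \<noteq> 0" "2 * t \<noteq> 0"
    using assms False by (auto simp: t_def complex_eq_iff)
  obtain M1 where M1: "\<And>\<sigma>. 1 \<le> \<sigma> \<Longrightarrow> \<sigma> \<le> 2 \<Longrightarrow> norm (dedekind_zeta (Complex \<sigma> (2 * t))) \<le> M1"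
    using bounded_on_horizontal_segment[OF dedekind_zeta_holomorphic t(2)] by blast
  obtain M2 where M2: "\<And>\<sigma>. 1 \<le> \<sigma> \<Longrightarrow> \<sigma> \<le> 2 \<Longrightarrow> norm (deriv dedekind_zeta (Complex \<sigma> t)) \<le> M2"
    using bounded_on_horizontal_segment[OF holomorphic_deriv[OF dedekind_zeta_holomorphic open_punctured_half_plane] t(1)]
    by blast
  define M where "M = max 1 (max M1 M2)"
  obtain c where c: "c > 0" "\<And>\<sigma>. 1 < \<sigma> \<Longrightarrow> \<sigma> \<le> 2 \<Longrightarrow> c / M ^ 4 \<le> norm (dedekind_zeta (Complex \<sigma> t))"
  proof (rule dedekind_zeta_lower_bound)
    fix c assume "c > 0" and "\<And>t M \<sigma>. t \<noteq> 0 \<Longrightarrow> M \<ge> 1 \<Longrightarrow>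
       (\<And>\<sigma>. 1 < \<sigma> \<Longrightarrow> \<sigma> \<le> 2 \<Longrightarrow> norm (dedekind_zeta (Complex \<sigma> (2 * t))) \<le> M) \<Longrightarrow>
       (\<And>\<sigma>. 1 < \<sigma> \<Longrightarrow> \<sigma> \<le> 2 \<Longrightarrow> norm (deriv dedekind_zeta (Complex \<sigma> t)) \<le> M) \<Longrightarrow>
       1 < \<sigma> \<Longrightarrow> \<sigma> \<le> 2 \<Longrightarrow> c / M ^ 4 \<le> norm (dedekind_zeta (Complex \<sigma> t))"
    then show thesis using t(1) M1 M2 by (intro that[of c]) (auto simp: M_def le_max_iff_disj)
  qed
  have "continuous_on {1..2} (\<lambda>\<sigma>. norm (dedekind_zeta (Complex \<sigma> t)))"
  proof (intro continuous_on_norm continuous_on_compose2[OF holomorphic_on_imp_continuous_on[OF dedekind_zeta_holomorphic]])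
    show "(\<lambda>\<sigma>. Complex \<sigma> t) ` {1..2} \<subseteq> punctured_half_plane"
      using Complex_in_punctured_half_plane t(1) by auto
  qed (intro continuous_intros)
  then have "((\<lambda>\<sigma>. norm (dedekind_zeta (Complex \<sigma> t))) \<longlongrightarrow> norm (dedekind_zeta (Complex 1 t))) (at_right 1)"
    by (simp add: continuous_on_def flip: at_within_Icc_at_right[of 1 2])
  moreover have "\<forall>\<^sub>F \<sigma> in at_right 1. c / M ^ 4 \<le> norm (dedekind_zeta (Complex \<sigma> t))"
    using eventually_at_right_real[of 1 2] c(2) by (auto elim!: eventually_mono)
  ultimately have "c / M ^ 4 \<le> norm (dedekind_zeta (Complex 1 t))"
    by (rule tendsto_lowerbound) simp
  moreover have "c / M ^ 4 > 0" using c(1) by (simp add: M_def)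
  ultimately show ?thesis unfolding s by auto
qed

lemma dedekind_zeta_reg_nonzero:
  assumes "Re s \<ge> 1"
  shows "dedekind_zeta_reg s \<noteq> 0"
proof (cases "s = 1")
  case True
  then show ?thesis using L_chi4_of_real_pos[of 1] by (auto simp: dedekind_zeta_reg_def zeta_reg_1)
next
  case False
  then show ?thesis using dedekind_zeta_nonzero[OF assms False] dedekind_zeta_reg_eq[OF False] by simp
qed

text \<open>
  The exponents below are \<open>1/40\<close> for \<open>\<zeta>\<close> and \<open>L\<close>, hence \<open>M = O(t\<^bsup>1/20\<^esup>)\<close> for their product and its derivatives;
  the 3-4-1 argument costs a factor \<open>M\<^bsup>10\<^esup> = O(t\<^bsup>1/2\<^esup>)\<close>.
\<close>

definition strip_growth :: "(complex \<Rightarrow> complex) \<Rightarrow> real \<Rightarrow> bool" where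
  "strip_growth f \<alpha> \<longleftrightarrow> (\<exists>C. \<forall>s. 79/80 \<le> Re s \<longrightarrow> Re s \<le> 3 \<longrightarrow> \<bar>Im s\<bar> \<ge> 1/2 \<longrightarrow>
    norm (f s) \<le> C * (1 + \<bar>Im s\<bar>) powr \<alpha>)"

lemma strip_growthE:
  assumes "strip_growth f \<alpha>"
  obtains C where "C \<ge> 0"
    "\<And>s. 79/80 \<le> Re s \<Longrightarrow> Re s \<le> 3 \<Longrightarrow> \<bar>Im s\<bar> \<ge> 1/2 \<Longrightarrow> norm (f s) \<le> C * (1 + \<bar>Im s\<bar>) powr \<alpha>"
proof -
  obtain C where C: "\<And>s. 79/80 \<le> Re s \<Longrightarrow> Re s \<le> 3 \<Longrightarrow> \<bar>Im s\<bar> \<ge> 1/2 \<Longrightarrow>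
      norm (f s) \<le> C * (1 + \<bar>Im s\<bar>) powr \<alpha>"
    using assms unfolding strip_growth_def by blast
  have "C * (1 + \<bar>Im s\<bar>) powr \<alpha> \<le> \<bar>C\<bar> * (1 + \<bar>Im s\<bar>) powr \<alpha>" for s by (intro mult_right_mono) auto
  then show ?thesis using that[of "\<bar>C\<bar>"] C order.trans by fastforce
qed

lemma strip_growth_mult:
  assumes "strip_growth f \<alpha>" "strip_growth g \<beta>"
  shows "strip_growth (\<lambda>s. f s * g s) (\<alpha> + \<beta>)"
proof -
  obtain C where C: "C \<ge> 0"
    "\<And>s. 79/80 \<le> Re s \<Longrightarrow> Re s \<le> 3 \<Longrightarrow> \<bar>Im s\<bar> \<ge> 1/2 \<Longrightarrow> norm (f s) \<le> C * (1 + \<bar>Im s\<bar>) powr \<alpha>"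
    using assms(1) by (rule strip_growthE) blast
  obtain D where D: "D \<ge> 0"
    "\<And>s. 79/80 \<le> Re s \<Longrightarrow> Re s \<le> 3 \<Longrightarrow> \<bar>Im s\<bar> \<ge> 1/2 \<Longrightarrow> norm (g s) \<le> D * (1 + \<bar>Im s\<bar>) powr \<beta>"
    using assms(2) by (rule strip_growthE) blast
  have "norm (f s * g s) \<le> (C * D) * (1 + \<bar>Im s\<bar>) powr (\<alpha> + \<beta>)"
    if "79/80 \<le> Re s" "Re s \<le> 3" "\<bar>Im s\<bar> \<ge> 1/2" for s
  proof -
    have "norm (f s * g s) \<le> (C * (1 + \<bar>Im s\<bar>) powr \<alpha>) * (D * (1 + \<bar>Im s\<bar>) powr \<beta>)"
      unfolding norm_mult using C D that by (intro mult_mono) auto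
    then show ?thesis by (simp add: powr_add mult_ac)
  qed
  then show ?thesis unfolding strip_growth_def by blast
qed

lemma norm_powr_le_strip:
  assumes "0 \<le> Re s" "Re s \<le> 3" "0 \<le> \<theta>" "\<theta> \<le> 1"
  shows "norm s powr \<theta> \<le> 3 * (1 + \<bar>Im s\<bar>) powr \<theta>"
proof -
  have "norm s \<le> \<bar>Re s\<bar> + \<bar>Im s\<bar>" by (rule cmod_le)
  then have "norm s powr \<theta> \<le> (3 * (1 + \<bar>Im s\<bar>)) powr \<theta>" using assms by (intro powr_mono2) auto
  also have "\<dots> = 3 powr \<theta> * (1 + \<bar>Im s\<bar>) powr \<theta>" by (subst powr_mult) auto
  also have "3 powr \<theta> \<le> (3::real) powr 1" using assms by (intro powr_mono) auto
  finally show ?thesis by (simp add: mult_right_mono)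
qed

lemma strip_growth_L_chi4: "strip_growth L_chi4 (1/40)"
proof -
  define Z where "Z = (\<Sum>n. real (Suc n) powr (- (79/80 + 1/40)))"
  have Z: "Z \<ge> 0" unfolding Z_def by (intro suminf_nonneg summable_Suc_powr) auto
  have "norm (L_chi4 s) \<le> 6 * Z * (1 + \<bar>Im s\<bar>) powr (1/40)" if "79/80 \<le> Re s" "Re s \<le> 3" for s
  proof -
    have "norm (L_chi4 s) \<le> 2 * norm s powr (1/40) * Z"
      unfolding L_chi4_def Z_def using that by (intro norm_abel_series_le chi4_sum_le_1) auto
    also have "\<dots> \<le> 2 * (3 * (1 + \<bar>Im s\<bar>) powr (1/40)) * Z"
      using that Z by (intro mult_right_mono mult_left_mono norm_powr_le_strip) auto
    finally show ?thesis by (simp add: mult_ac)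
  qed
  then show ?thesis unfolding strip_growth_def by blast
qed

lemma strip_growth_zeta: "strip_growth zeta (1/40)"
proof -
  define Z where "Z = (\<Sum>n. real (Suc n) powr (- (79/80 + 1/40)))"
  have Z: "Z \<ge> 0" unfolding Z_def by (intro suminf_nonneg summable_Suc_powr) auto
  have "norm (zeta s) \<le> (2 + 6 * Z) * (1 + \<bar>Im s\<bar>) powr (1/40)"
    if s: "79/80 \<le> Re s" "Re s \<le> 3" "\<bar>Im s\<bar> \<ge> 1/2" for s
  proof -
    let ?w = "(1 + \<bar>Im s\<bar>) powr (1/40)"
    have "norm (s - 1) \<ge> 1/2" using abs_Im_le_cmod[of "s - 1"] s by simp
    then have s_minus_1_pos: "norm (s - 1) > 0" and inv: "1 / norm (s - 1) \<le> 2" by (auto simp: divide_simps)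
    have "norm (zeta s) \<le> (1 + 2 * norm (s - 1) * norm s powr (1/40) * Z) / norm (s - 1)"
      unfolding zeta_def norm_divide Z_def using s by (intro divide_right_mono norm_zeta_reg_le) auto
    also have "\<dots> = 1 / norm (s - 1) + 2 * norm s powr (1/40) * Z"
      using s_minus_1_pos by (simp add: add_divide_distrib)
    also have "\<dots> \<le> 2 * ?w + 2 * (3 * ?w) * Z"
    proof (intro add_mono mult_right_mono mult_left_mono norm_powr_le_strip Z)
      have "?w \<ge> 1" by (rule ge_one_powr_ge_zero) auto
      then show "1 / norm (s - 1) \<le> 2 * ?w" using inv by linarith
    qed (use s in auto)
    finally show ?thesis by (simp add: algebra_simps)
  qed
  then show ?thesis unfolding strip_growth_def by blast
qed

lemma strip_growth_dedekind_zeta: "strip_growth dedekind_zeta (1/20)"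
  using strip_growth_mult[OF strip_growth_zeta strip_growth_L_chi4] by (simp add: dedekind_zeta_def[abs_def])

lemma strip_growth_mono:
  assumes "strip_growth f \<alpha>" "\<alpha> \<le> \<beta>"
  shows "strip_growth f \<beta>"
proof -
  obtain C where C: "C \<ge> 0"
    "\<And>s. 79/80 \<le> Re s \<Longrightarrow> Re s \<le> 3 \<Longrightarrow> \<bar>Im s\<bar> \<ge> 1/2 \<Longrightarrow> norm (f s) \<le> C * (1 + \<bar>Im s\<bar>) powr \<alpha>"
    using assms(1) by (rule strip_growthE) blast
  have "C * (1 + \<bar>Im s\<bar>) powr \<alpha> \<le> C * (1 + \<bar>Im s\<bar>) powr \<beta>" for s
    using assms(2) C(1) by (intro mult_left_mono powr_mono) auto
  then show ?thesis unfolding strip_growth_def using C(2) order.trans by blast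
qed

definition derivs_growth :: "(complex \<Rightarrow> complex) \<Rightarrow> nat \<Rightarrow> real \<Rightarrow> real \<Rightarrow> bool" where
  "derivs_growth f N \<alpha> D \<longleftrightarrow> (\<forall>n s. n \<le> N \<longrightarrow> 1 \<le> Re s \<longrightarrow> Re s \<le> 2 \<longrightarrow> \<bar>Im s\<bar> \<ge> 1 \<longrightarrow>
    norm ((deriv ^^ n) f s) \<le> D * (1 + \<bar>Im s\<bar>) powr \<alpha>)"

lemma derivs_growthD:
  "derivs_growth f N \<alpha> D \<Longrightarrow> n \<le> N \<Longrightarrow> 1 \<le> Re s \<Longrightarrow> Re s \<le> 2 \<Longrightarrow> \<bar>Im s\<bar> \<ge> 1 \<Longrightarrow>
    norm ((deriv ^^ n) f s) \<le> D * (1 + \<bar>Im s\<bar>) powr \<alpha>"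
  by (simp add: derivs_growth_def)

lemma derivs_growth_mono:
  assumes "derivs_growth f N \<alpha> D" "D \<le> E"
  shows "derivs_growth f N \<alpha> E"
  unfolding derivs_growth_def
proof (intro allI impI)
  fix n s assume "n \<le> N" "1 \<le> Re s" "Re s \<le> 2" "\<bar>Im s\<bar> \<ge> 1"
  note derivs_growthD[OF assms(1) this]
  also have "D * (1 + \<bar>Im s\<bar>) powr \<alpha> \<le> E * (1 + \<bar>Im s\<bar>) powr \<alpha>"
    using assms(2) by (intro mult_right_mono) auto
  finally show "norm ((deriv ^^ n) f s) \<le> E * (1 + \<bar>Im s\<bar>) powr \<alpha>" .
qed

text \<open>Cauchy's inequality on discs of radius \<open>1/100\<close>.\<close>

lemma strip_growth_derivs_growth:
  assumes f: "f holomorphic_on punctured_half_plane" and growth: "strip_growth f \<alpha>" and \<alpha>: "\<alpha> \<ge> 0"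
  obtains D where "derivs_growth f N \<alpha> D"
proof -
  obtain C where C: "C \<ge> 0"
    "\<And>s. 79/80 \<le> Re s \<Longrightarrow> Re s \<le> 3 \<Longrightarrow> \<bar>Im s\<bar> \<ge> 1/2 \<Longrightarrow> norm (f s) \<le> C * (1 + \<bar>Im s\<bar>) powr \<alpha>"
    using growth by (rule strip_growthE) blast
  define D where "D = fact N * 100 ^ N * (C * 2 powr \<alpha>)"
  have "norm ((deriv ^^ n) f s) \<le> D * (1 + \<bar>Im s\<bar>) powr \<alpha>"
    if n: "n \<le> N" and s: "1 \<le> Re s" "Re s \<le> 2" "\<bar>Im s\<bar> \<ge> 1" for n s
  proof -
    have near: "79/80 \<le> Re z \<and> Re z \<le> 3 \<and> 1/2 \<le> \<bar>Im z\<bar> \<and> \<bar>Im z\<bar> \<le> 1 + \<bar>Im s\<bar>" if "norm (s - z) \<le> 1/100" for z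
    proof -
      have "\<bar>Re s - Re z\<bar> \<le> norm (s - z)" "\<bar>Im s - Im z\<bar> \<le> norm (s - z)"
        using abs_Re_le_cmod[of "s - z"] abs_Im_le_cmod[of "s - z"] by auto
      then show ?thesis using that s by auto
    qed
    then have sub: "cball s (1/100) \<subseteq> punctured_half_plane" by (force simp: dist_norm)
    have "norm ((deriv ^^ n) f s) \<le> fact n * (C * 2 powr \<alpha> * (1 + \<bar>Im s\<bar>) powr \<alpha>) / (1/100) ^ n"
    proof (rule Cauchy_inequality)
      show "f holomorphic_on ball s (1/100)"
        using f sub by (meson ball_subset_cball holomorphic_on_subset order.trans)
      show "continuous_on (cball s (1/100)) f"
        using f sub by (meson holomorphic_on_imp_continuous_on holomorphic_on_subset)
      fix z assume "norm (s - z) = 1/100"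
      then have z: "79/80 \<le> Re z" "Re z \<le> 3" "1/2 \<le> \<bar>Im z\<bar>" "\<bar>Im z\<bar> \<le> 1 + \<bar>Im s\<bar>" using near[of z] by auto
      have "norm (f z) \<le> C * (1 + \<bar>Im z\<bar>) powr \<alpha>" using C(2) z by blast
      also have "\<dots> \<le> C * (2 * (1 + \<bar>Im s\<bar>)) powr \<alpha>"
        using z \<alpha> C(1) by (intro mult_left_mono powr_mono2) auto
      also have "\<dots> = C * 2 powr \<alpha> * (1 + \<bar>Im s\<bar>) powr \<alpha>" by (subst powr_mult) auto
      finally show "norm (f z) \<le> C * 2 powr \<alpha> * (1 + \<bar>Im s\<bar>) powr \<alpha>" .
    qed simp
    also have "\<dots> = fact n * 100 ^ n * (C * 2 powr \<alpha>) * (1 + \<bar>Im s\<bar>) powr \<alpha>"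
      by (simp add: power_divide mult_ac)
    also have "fact n * 100 ^ n * (C * 2 powr \<alpha>) \<le> D"
      unfolding D_def using C(1) n by (intro mult_mono fact_mono power_increasing) auto
    finally show ?thesis by (simp add: mult_right_mono)
  qed
  then show ?thesis using that unfolding derivs_growth_def by blast
qed

text \<open>Subtracting \<open>1\<close> removes the pole of the Dirichlet series at \<open>s = 1\<close>.\<close>

definition centered_mangoldt :: "nat \<Rightarrow> real" where
  "centered_mangoldt n = dedekind_mangoldt n - 1"

lemma centered_mangoldt_eq: "centered_mangoldt n = dedekind_mangoldt n + - 1"
  by (simp add: centered_mangoldt_def)

lemma abs_conv_gt1_centered_mangoldt: "abs_conv_gt1 centered_mangoldt"
  unfolding centered_mangoldt_eq[abs_def]
  by (intro abs_conv_gt1_add abs_conv_gt1_dedekind_mangoldt abs_conv_gt1_const)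

lemma dseries_centered_mangoldt:
  assumes "Re s > 1"
  shows "dseries centered_mangoldt s = - deriv dedekind_zeta s / dedekind_zeta s - zeta s"
proof -
  have "dseries centered_mangoldt s = dseries dedekind_mangoldt s + dseries (\<lambda>_. - 1) s"
    unfolding centered_mangoldt_eq[abs_def]
    by (intro dseries_add abs_conv_gt1_dedekind_mangoldt abs_conv_gt1_const assms)
  also have "dseries (\<lambda>_. - 1) s = - zeta s"
    using dseries_minus[OF one.abs_conv assms] zeta_eq_dseries[OF assms] by simp
  also have "dseries dedekind_mangoldt s = - deriv dedekind_zeta s / dedekind_zeta s"
    using dedekind_zeta_deriv_eq[OF assms] dedekind_zeta_nonzero_gt_1[OF assms] by simp
  finally show ?thesis by simp
qed

lemma dseries_centered_mangoldt_ln: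
  assumes s: "Re s > 1"
  shows "dseries (\<lambda>n. centered_mangoldt n * ln (real n)) s =
    deriv (deriv dedekind_zeta) s / dedekind_zeta s - (deriv dedekind_zeta s / dedekind_zeta s)\<^sup>2 + deriv zeta s"
proof -
  let ?f = "dedekind_zeta" and ?f' = "deriv dedekind_zeta" and ?f'' = "deriv (deriv dedekind_zeta)"
  note nz = dedekind_zeta_nonzero_gt_1[OF s]
  have s_in: "s \<in> punctured_half_plane" using s by auto
  have "((\<lambda>s. - ?f' s / ?f s - zeta s) has_field_derivative
      (- ?f'' s * ?f s - - ?f' s * ?f' s) / (?f s * ?f s) - deriv zeta s) (at s)"
    by (intro DERIV_diff DERIV_minus DERIV_divide nz
        holomorphic_derivI[OF dedekind_zeta_holomorphic open_punctured_half_plane s_in]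
        holomorphic_derivI[OF zeta_holomorphic open_punctured_half_plane s_in]
        holomorphic_derivI[OF holomorphic_deriv[OF dedekind_zeta_holomorphic open_punctured_half_plane]
          open_punctured_half_plane s_in])
  then have "(dseries centered_mangoldt has_field_derivative
      (- ?f'' s * ?f s - - ?f' s * ?f' s) / (?f s * ?f s) - deriv zeta s) (at s)"
    by (rule has_field_derivative_transform_within_open[OF _ open_halfspace_Re_gt[of 1]])
       (use s dseries_centered_mangoldt in auto)
  with dseries_deriv[OF abs_conv_gt1_centered_mangoldt s]
  have "- dseries (\<lambda>n. centered_mangoldt n * ln (real n)) s =
      (- ?f'' s * ?f s - - ?f' s * ?f' s) / (?f s * ?f s) - deriv zeta s"
    by (rule DERIV_unique)
  also have "\<dots> = - (?f'' s / ?f s - (?f' s / ?f s)\<^sup>2 + deriv zeta s)"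
    using nz by (simp add: field_simps power2_eq_square)
  finally show ?thesis by (rule neg_equal_iff_equal[THEN iffD1])
qed

lemma norm_log_deriv_le:
  fixes z z' z'' :: complex
  assumes c: "c > 0" and M: "M \<ge> 1" and z: "c / M ^ 4 \<le> norm z" and z': "norm z' \<le> M" and z'': "norm z'' \<le> M"
  shows "norm (z' / z) \<le> (1 / c + 1 / c\<^sup>2) * M ^ 10"
    and "norm (z'' / z - (z' / z)\<^sup>2) \<le> (1 / c + 1 / c\<^sup>2) * M ^ 10"
proof -
  have pos: "0 < c / M ^ 4" using c M by simp
  then have "0 < norm z" using z by linarith
  then have "1 / norm z \<le> 1 / (c / M ^ 4)"
    using z pos by (intro divide_left_mono mult_pos_pos) simp_all
  then have inv: "1 / norm z \<le> M ^ 4 / c" by simp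
  have quot: "norm (y / z) \<le> M ^ 5 / c" if "norm y \<le> M" for y
  proof -
    have "norm y * (1 / norm z) \<le> M * (M ^ 4 / c)" using that inv M by (intro mult_mono) auto
    then show ?thesis by (simp add: norm_divide power_numeral_reduce)
  qed
  have "M ^ 5 / c \<le> M ^ 10 / c" using M c by (intro divide_right_mono power_increasing) auto
  note quot10 = order.trans[OF quot this]
  have "norm ((z' / z)\<^sup>2) \<le> (M ^ 5 / c)\<^sup>2"
    unfolding norm_power using quot[OF z'] by (intro power_mono) auto
  then have sq: "norm ((z' / z)\<^sup>2) \<le> M ^ 10 / c\<^sup>2" by (simp add: power_divide flip: power_mult)
  have "0 \<le> M ^ 10 / c\<^sup>2" using M by simp
  moreover have expand: "(1 / c + 1 / c\<^sup>2) * M ^ 10 = M ^ 10 / c + M ^ 10 / c\<^sup>2" by (simp add: distrib_right)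
  ultimately show "norm (z' / z) \<le> (1 / c + 1 / c\<^sup>2) * M ^ 10"
    using quot10[OF z'] by linarith
  show "norm (z'' / z - (z' / z)\<^sup>2) \<le> (1 / c + 1 / c\<^sup>2) * M ^ 10"
    using norm_triangle_ineq4[of "z'' / z" "(z' / z)\<^sup>2"] quot10[OF z''] sq expand by linarith
qed

lemma zeta_derivs_growth:
  obtains D where "D \<ge> 1" "derivs_growth dedekind_zeta 2 (1/20) D" "derivs_growth zeta 2 (1/20) D"
proof -
  obtain D where D: "derivs_growth dedekind_zeta 2 (1/20) D"
    by (rule strip_growth_derivs_growth[OF dedekind_zeta_holomorphic strip_growth_dedekind_zeta]) auto
  have "strip_growth zeta (1/20)" by (rule strip_growth_mono[OF strip_growth_zeta]) simp
  then obtain E where E: "derivs_growth zeta 2 (1/20) E"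
    by (rule strip_growth_derivs_growth[OF zeta_holomorphic]) auto
  show ?thesis
    by (rule that[of "max 1 (max D E)"]) (auto intro: derivs_growth_mono[OF D] derivs_growth_mono[OF E])
qed

lemma dedekind_zeta_lower_growth:
  assumes D: "D \<ge> 1" and growth: "derivs_growth dedekind_zeta 2 (1/20) D"
  obtains c where "c > 0" "\<And>s. 1 < Re s \<Longrightarrow> Re s \<le> 2 \<Longrightarrow> \<bar>Im s\<bar> \<ge> 1 \<Longrightarrow>
      c / (2 * D * (1 + \<bar>Im s\<bar>) powr (1/20)) ^ 4 \<le> norm (dedekind_zeta s)"
proof -
  obtain c where c: "c > 0" "\<And>t M \<sigma>. t \<noteq> 0 \<Longrightarrow> M \<ge> 1 \<Longrightarrow>
       (\<And>\<sigma>. 1 < \<sigma> \<Longrightarrow> \<sigma> \<le> 2 \<Longrightarrow> norm (dedekind_zeta (Complex \<sigma> (2 * t))) \<le> M) \<Longrightarrow>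
       (\<And>\<sigma>. 1 < \<sigma> \<Longrightarrow> \<sigma> \<le> 2 \<Longrightarrow> norm (deriv dedekind_zeta (Complex \<sigma> t)) \<le> M) \<Longrightarrow>
       1 < \<sigma> \<Longrightarrow> \<sigma> \<le> 2 \<Longrightarrow> c / M ^ 4 \<le> norm (dedekind_zeta (Complex \<sigma> t))"
    by (rule dedekind_zeta_lower_bound) blast
  have "c / (2 * D * (1 + \<bar>Im s\<bar>) powr (1/20)) ^ 4 \<le> norm (dedekind_zeta s)"
    if s: "1 < Re s" "Re s \<le> 2" "\<bar>Im s\<bar> \<ge> 1" for s
  proof -
    define t where "t = Im s"
    define w where "w = (1 + \<bar>t\<bar>) powr (1/20)"
    have w: "w \<ge> 1" unfolding w_def by (rule ge_one_powr_ge_zero) auto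
    have "(1 + \<bar>2 * t\<bar>) powr (1/20) \<le> (2 * (1 + \<bar>t\<bar>)) powr (1/20)" by (intro powr_mono2) auto
    also have "\<dots> = 2 powr (1/20) * w" by (subst powr_mult) (auto simp: w_def)
    also have "2 powr (1/20) \<le> (2::real) powr 1" by (rule powr_mono) auto
    finally have w_double: "(1 + \<bar>2 * t\<bar>) powr (1/20) \<le> 2 * w" using w by (simp add: mult_right_mono)
    have "c / (2 * D * w) ^ 4 \<le> norm (dedekind_zeta (Complex (Re s) t))"
    proof (rule c(2))
      have Dw_ge_1: "D * w \<ge> 1" using mult_mono[of 1 D 1 w] D w by simp
      then show "2 * D * w \<ge> 1" by simp
      fix \<sigma> :: real assume \<sigma>: "1 < \<sigma>" "\<sigma> \<le> 2"
      have "norm (dedekind_zeta (Complex \<sigma> (2 * t))) \<le> D * (1 + \<bar>2 * t\<bar>) powr (1/20)"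
        using derivs_growthD[OF growth, of 0 "Complex \<sigma> (2 * t)"] \<sigma> s by (simp add: t_def)
      also have "\<dots> \<le> D * (2 * w)" using w_double D by (intro mult_left_mono) auto
      finally show "norm (dedekind_zeta (Complex \<sigma> (2 * t))) \<le> 2 * D * w" by simp
      have "norm (deriv dedekind_zeta (Complex \<sigma> t)) \<le> D * w"
        using derivs_growthD[OF growth, of 1 "Complex \<sigma> t"] \<sigma> s by (simp add: t_def w_def)
      then show "norm (deriv dedekind_zeta (Complex \<sigma> t)) \<le> 2 * D * w" using Dw_ge_1 by linarith
    qed (use s in \<open>auto simp: t_def\<close>)
    then show ?thesis by (simp add: t_def w_def)
  qed
  then show ?thesis using that c(1) by blast
qed

lemma dseries_centered_mangoldt_growth_far:
  obtains C where "\<And>s. 1 < Re s \<Longrightarrow> Re s \<le> 2 \<Longrightarrow> \<bar>Im s\<bar> \<ge> 1 \<Longrightarrow>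
     norm (dseries centered_mangoldt s) \<le> C * (1 + \<bar>Im s\<bar>) powr (1/2) \<and>
     norm (dseries (\<lambda>n. centered_mangoldt n * ln (real n)) s) \<le> C * (1 + \<bar>Im s\<bar>) powr (1/2)"
proof -
  let ?w = "\<lambda>s. (1 + \<bar>Im s\<bar>) powr (1/20)"
  obtain D where D: "D \<ge> 1" "derivs_growth dedekind_zeta 2 (1/20) D" "derivs_growth zeta 2 (1/20) D"
    by (rule zeta_derivs_growth)
  from dedekind_zeta_lower_growth[OF D(1,2)]
  obtain c where c: "c > 0" "\<And>s. 1 < Re s \<Longrightarrow> Re s \<le> 2 \<Longrightarrow> \<bar>Im s\<bar> \<ge> 1 \<Longrightarrow>
      c / (2 * D * ?w s) ^ 4 \<le> norm (dedekind_zeta s)" by blast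
  define C where "C = (1 / c + 1 / c\<^sup>2 + 1) * (2 * D) ^ 10"
  have "norm (dseries centered_mangoldt s) \<le> C * (1 + \<bar>Im s\<bar>) powr (1/2) \<and>
     norm (dseries (\<lambda>n. centered_mangoldt n * ln (real n)) s) \<le> C * (1 + \<bar>Im s\<bar>) powr (1/2)"
    if s: "1 < Re s" "Re s \<le> 2" "\<bar>Im s\<bar> \<ge> 1" for s
  proof -
    let ?f = "dedekind_zeta s" and ?f' = "deriv dedekind_zeta s" and ?f'' = "deriv (deriv dedekind_zeta) s"
    define M where "M = 2 * D * ?w s"
    have Dw_ge_1: "D * ?w s \<ge> 1"
      using mult_mono[of 1 D 1 "?w s"] D(1) ge_one_powr_ge_zero[of "1 + \<bar>Im s\<bar>" "1/20"] by simp
    then have M: "M \<ge> 1" "D * ?w s \<le> M" by (auto simp: M_def)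
    then have "D * ?w s \<le> M ^ 10" using self_le_power[of M 10] by simp
    then have zeta: "norm (zeta s) \<le> M ^ 10" "norm (deriv zeta s) \<le> M ^ 10"
      using derivs_growthD[OF D(3), of 0 s] derivs_growthD[OF D(3), of 1 s] s by auto
    have derivs: "norm ?f' \<le> M" "norm ?f'' \<le> M"
      using derivs_growthD[OF D(2), of 1 s] derivs_growthD[OF D(2), of 2 s] s M(2) by (auto simp: numeral_2_eq_2)
    have "c / M ^ 4 \<le> norm ?f" unfolding M_def by (rule c(2)[OF s])
    note log_deriv = norm_log_deriv_le[OF c(1) M(1) this derivs]
    have "(?w s) ^ 10 = (1 + \<bar>Im s\<bar>) powr (1/2)" by (simp add: powr_power)
    then have "(1 / c + 1 / c\<^sup>2) * M ^ 10 + M ^ 10 = C * (1 + \<bar>Im s\<bar>) powr (1/2)"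
      by (simp add: C_def M_def power_mult_distrib algebra_simps)
    moreover have "norm (dseries centered_mangoldt s) \<le> norm (?f' / ?f) + norm (zeta s)"
      unfolding dseries_centered_mangoldt[OF s(1)] using norm_triangle_ineq4[of "- ?f' / ?f" "zeta s"] by simp
    moreover have "norm (dseries (\<lambda>n. centered_mangoldt n * ln (real n)) s) \<le>
        norm (?f'' / ?f - (?f' / ?f)\<^sup>2) + norm (deriv zeta s)"
      unfolding dseries_centered_mangoldt_ln[OF s(1)] by (rule norm_triangle_ineq)
    ultimately show ?thesis using log_deriv zeta by linarith
  qed
  then show ?thesis using that by blast
qed

lemma dseries_centered_mangoldt_continuation:
  obtains N F where "open N" "{s. Re s \<ge> 1} \<subseteq> N" "F holomorphic_on N"
    "\<And>s. Re s > 1 \<Longrightarrow> F s = dseries centered_mangoldt s"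
proof
  define g where "g = (\<lambda>s. if s = 1 then deriv zeta_reg 1 else (zeta_reg s - zeta_reg 1) / (s - 1))"
  define N where "N = {s. Re s > 0} \<inter> dedekind_zeta_reg -` (- {0})"
  define F where "F = (\<lambda>s. - deriv dedekind_zeta_reg s / dedekind_zeta_reg s - g s)"
  have g: "g holomorphic_on {s. Re s > 0}"
    unfolding g_def by (rule pole_lemma_open[OF zeta_reg_holomorphic open_halfspace_Re_gt])
  show "open N" unfolding N_def
    by (rule continuous_open_preimage[OF holomorphic_on_imp_continuous_on[OF dedekind_zeta_reg_holomorphic]
          open_halfspace_Re_gt]) auto
  show "{s. Re s \<ge> 1} \<subseteq> N" using dedekind_zeta_reg_nonzero by (auto simp: N_def)
  have sub: "N \<subseteq> {s. Re s > 0}" by (auto simp: N_def)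
  show "F holomorphic_on N" unfolding F_def
    by (intro holomorphic_intros holomorphic_on_subset[OF g sub]
        holomorphic_on_subset[OF holomorphic_deriv[OF dedekind_zeta_reg_holomorphic open_halfspace_Re_gt] sub]
        holomorphic_on_subset[OF dedekind_zeta_reg_holomorphic sub]) (auto simp: N_def)
  fix s :: complex assume s: "Re s > 1"
  then have s_neq_1: "s \<noteq> 1" by auto
  have "((\<lambda>s. (s - 1) * dedekind_zeta s) has_field_derivative
      (1 * dedekind_zeta s + deriv dedekind_zeta s * (s - 1))) (at s)"
    by (rule DERIV_mult[OF _ holomorphic_derivI[OF dedekind_zeta_holomorphic open_punctured_half_plane]])
       (use s s_neq_1 in \<open>auto intro!: derivative_eq_intros\<close>)
  then have "(dedekind_zeta_reg has_field_derivative
      (1 * dedekind_zeta s + deriv dedekind_zeta s * (s - 1))) (at s)"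
    by (rule has_field_derivative_transform_within_open[OF _ open_halfspace_Re_gt[of 1]])
       (use s in \<open>auto intro!: dedekind_zeta_reg_eq[symmetric]\<close>)
  note deriv_reg = DERIV_imp_deriv[OF this]
  have "F s = - (1 * dedekind_zeta s + deriv dedekind_zeta s * (s - 1)) / ((s - 1) * dedekind_zeta s)
      - (zeta_reg s - 1) / (s - 1)"
    unfolding F_def deriv_reg dedekind_zeta_reg_eq[OF s_neq_1] using s_neq_1 by (simp add: g_def zeta_reg_1)
  also have "\<dots> = - deriv dedekind_zeta s / dedekind_zeta s - zeta s"
    using s_neq_1 dedekind_zeta_nonzero_gt_1[OF s] by (simp add: zeta_def divide_simps) (simp add: algebra_simps)
  also have "\<dots> = dseries centered_mangoldt s" by (rule dseries_centered_mangoldt[OF s, symmetric])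
  finally show "F s = dseries centered_mangoldt s" .
qed

lemma dseries_centered_mangoldt_bounded_near:
  obtains C where "\<And>s. 1 < Re s \<Longrightarrow> Re s \<le> 2 \<Longrightarrow> \<bar>Im s\<bar> \<le> 1 \<Longrightarrow>
     norm (dseries centered_mangoldt s) \<le> C \<and> norm (dseries (\<lambda>n. centered_mangoldt n * ln (real n)) s) \<le> C"
proof -
  obtain N F where N: "open N" "{s. Re s \<ge> 1} \<subseteq> N" and F: "F holomorphic_on N"
    and F_eq: "\<And>s. Re s > 1 \<Longrightarrow> F s = dseries centered_mangoldt s"
    using dseries_centered_mangoldt_continuation by blast
  have deriv_F: "deriv F s = - dseries (\<lambda>n. centered_mangoldt n * ln (real n)) s" if "Re s > 1" for s
  proof (rule DERIV_imp_deriv)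
    show "(F has_field_derivative - dseries (\<lambda>n. centered_mangoldt n * ln (real n)) s) (at s)"
      by (rule has_field_derivative_transform_within_open[OF dseries_deriv[OF abs_conv_gt1_centered_mangoldt that]
            open_halfspace_Re_gt[of 1]]) (use that F_eq in auto)
  qed
  define Q where "Q = cbox (Complex 1 (-1)) (Complex 2 1)"
  have Q: "Q \<subseteq> N" using N(2) by (auto simp: Q_def in_cbox_complex_iff)
  have bounded_on_Q: "\<exists>M. \<forall>z\<in>Q. norm (f z) \<le> M" if "f holomorphic_on N" for f
  proof -
    have "bounded (f ` Q)" unfolding Q_def
      by (intro compact_imp_bounded compact_continuous_image compact_cbox
          holomorphic_on_imp_continuous_on[OF holomorphic_on_subset[OF that Q[unfolded Q_def]]])
    then show ?thesis unfolding bounded_iff by blast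
  qed
  obtain M1 M2 where M: "\<forall>z\<in>Q. norm (F z) \<le> M1" "\<forall>z\<in>Q. norm (deriv F z) \<le> M2"
    using bounded_on_Q[OF F] bounded_on_Q[OF holomorphic_deriv[OF F N(1)]] by blast
  show ?thesis
  proof (rule that[of "max M1 M2"])
    fix s assume s: "1 < Re s" "Re s \<le> 2" "\<bar>Im s\<bar> \<le> 1"
    then have "s \<in> Q" by (auto simp: Q_def in_cbox_complex_iff)
    then have "norm (F s) \<le> M1" "norm (deriv F s) \<le> M2" using M by blast+
    then show "norm (dseries centered_mangoldt s) \<le> max M1 M2 \<and>
      norm (dseries (\<lambda>n. centered_mangoldt n * ln (real n)) s) \<le> max M1 M2"
      unfolding F_eq[OF s(1)] deriv_F[OF s(1)] by (simp add: le_max_iff_disj)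
  qed
qed

lemma vertical_growthI:
  assumes near: "\<And>s. 1 < Re s \<Longrightarrow> Re s \<le> 2 \<Longrightarrow> \<bar>Im s\<bar> \<le> 1 \<Longrightarrow> norm (dseries a s) \<le> C"
    and far: "\<And>s. 1 < Re s \<Longrightarrow> Re s \<le> 2 \<Longrightarrow> \<bar>Im s\<bar> \<ge> 1 \<Longrightarrow> norm (dseries a s) \<le> D * (1 + \<bar>Im s\<bar>) powr \<kappa>"
    and "\<kappa> \<ge> 0"
  shows "vertical_growth a \<kappa>"
proof -
  have "norm (dseries a s) \<le> max C D * (1 + \<bar>Im s\<bar>) powr \<kappa>" if s: "1 < Re s" "Re s \<le> 2" for s
  proof (cases "\<bar>Im s\<bar> \<le> 1")
    case True
    have "norm (dseries a s) \<le> max C D * 1" using near[OF s True] by simp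
    also have "\<dots> \<le> max C D * (1 + \<bar>Im s\<bar>) powr \<kappa>"
      using near[OF s True] norm_ge_zero[of "dseries a s"] \<open>\<kappa> \<ge> 0\<close>
      by (intro mult_left_mono ge_one_powr_ge_zero) (auto simp del: norm_ge_zero)
    finally show ?thesis .
  next
    case False
    then have "norm (dseries a s) \<le> D * (1 + \<bar>Im s\<bar>) powr \<kappa>" using far s by simp
    also have "\<dots> \<le> max C D * (1 + \<bar>Im s\<bar>) powr \<kappa>" by (intro mult_right_mono) auto
    finally show ?thesis .
  qed
  then show ?thesis unfolding vertical_growth_def by blast
qed

theorem vertical_growth_centered_mangoldt:
  shows "vertical_growth centered_mangoldt (1/2)"
    and "vertical_growth (\<lambda>n. centered_mangoldt n * ln (real n)) (1/2)"
proof -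
  obtain C where C: "\<And>s. 1 < Re s \<Longrightarrow> Re s \<le> 2 \<Longrightarrow> \<bar>Im s\<bar> \<le> 1 \<Longrightarrow>
     norm (dseries centered_mangoldt s) \<le> C \<and> norm (dseries (\<lambda>n. centered_mangoldt n * ln (real n)) s) \<le> C"
    by (rule dseries_centered_mangoldt_bounded_near) blast
  obtain D where D: "\<And>s. 1 < Re s \<Longrightarrow> Re s \<le> 2 \<Longrightarrow> \<bar>Im s\<bar> \<ge> 1 \<Longrightarrow>
     norm (dseries centered_mangoldt s) \<le> D * (1 + \<bar>Im s\<bar>) powr (1/2) \<and>
     norm (dseries (\<lambda>n. centered_mangoldt n * ln (real n)) s) \<le> D * (1 + \<bar>Im s\<bar>) powr (1/2)"
    by (rule dseries_centered_mangoldt_growth_far) blast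
  show "vertical_growth centered_mangoldt (1/2)"
    by (rule vertical_growthI[of _ C D]) (use C D in auto)
  show "vertical_growth (\<lambda>n. centered_mangoldt n * ln (real n)) (1/2)"
    by (rule vertical_growthI[of _ C D]) (use C D in auto)
qed

section \<open>Riesz means of a set of integers\<close>

locale price_set =
  fixes P :: "nat set"
  assumes ge_2: "q \<in> P \<Longrightarrow> q \<ge> 2"
begin

definition segment :: "real \<Rightarrow> nat set" where
  "segment x = {q \<in> P. real q \<le> x}"

definition riesz :: "real \<Rightarrow> real" where
  "riesz x = (\<Sum>q\<in>segment x. x - real q)"

definition theta :: "real \<Rightarrow> real" where
  "theta x = (\<Sum>q\<in>segment x. ln (real q) * (1 - real q / x))"

definition chebyshev :: "real \<Rightarrow> real" where
  "chebyshev x = (\<Sum>q\<in>segment x. ln (real q))"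

definition log_weight :: "real \<Rightarrow> real" where
  "log_weight x = (\<Sum>q\<in>segment x. ln (real q) * ln (x / real q))"

lemma segment_subset: "segment x \<subseteq> {1..nat \<lfloor>x\<rfloor>}"
proof
  fix q assume "q \<in> segment x"
  then show "q \<in> {1..nat \<lfloor>x\<rfloor>}" using ge_2[of q] by (auto simp: segment_def le_nat_floor)
qed

lemma finite_segment [simp]: "finite (segment x)"
  by (rule finite_subset[OF segment_subset]) simp

lemma segment_mono: "x \<le> y \<Longrightarrow> segment x \<subseteq> segment y"
  by (auto simp: segment_def)

lemma segmentD:
  assumes "q \<in> segment x"
  shows "q \<in> P" "real q \<le> x" "real q \<ge> 2" "ln (real q) > 0"
  using assms ge_2[of q] by (auto simp: segment_def)

lemma segment_empty: "x < 2 \<Longrightarrow> segment x = {}"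
  using segmentD(2,3) by force

lemma card_segment_le: "x \<ge> 0 \<Longrightarrow> real (card (segment x)) \<le> x"
  using card_mono[OF _ segment_subset[of x]] by simp linarith

lemma sum_segment_restrict:
  assumes "x \<le> y"
  shows "(\<Sum>q\<in>segment y. if q \<in> segment x then f q else 0) = sum f (segment x)"
  using segment_mono[OF assms] by (simp add: sum.inter_restrict[symmetric] Int_absorb1)

lemma riesz_nonneg: "riesz x \<ge> 0"
  unfolding riesz_def by (intro sum_nonneg) (auto simp: segment_def)

lemma riesz_eq_0: "x < 2 \<Longrightarrow> riesz x = 0"
  by (simp add: riesz_def segment_empty)

lemma riesz_le_mult_card: "riesz x \<le> x * real (card (segment x))"
proof -
  have "riesz x \<le> (\<Sum>q\<in>segment x. x)" unfolding riesz_def by (intro sum_mono) auto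
  then show ?thesis by (simp add: mult.commute)
qed

lemma riesz_le_square: "x \<ge> 0 \<Longrightarrow> riesz x \<le> x\<^sup>2"
  using riesz_le_mult_card[of x] mult_left_mono[OF card_segment_le[of x], of x] by (simp add: power2_eq_square)

lemma riesz_mono:
  assumes "x \<le> y" shows "riesz x \<le> riesz y"
proof -
  have "riesz x \<le> (\<Sum>q\<in>segment x. y - real q)" unfolding riesz_def using assms by (intro sum_mono) auto
  also have "\<dots> \<le> riesz y" unfolding riesz_def using assms
    by (intro sum_mono2 segment_mono finite_segment) (auto simp: segment_def)
  finally show ?thesis .
qed

lemma riesz_diff_le:
  assumes "y \<ge> 0" "0 \<le> d" "d \<le> 1"
  shows "riesz (y + d) \<le> riesz y + (y + 1)"
proof -
  have "riesz (y + d) \<le> (\<Sum>q\<in>segment (y + d). (if q \<in> segment y then y - real q else 0) + 1)"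
    unfolding riesz_def using assms by (intro sum_mono) (auto simp: segment_def)
  also have "\<dots> = riesz y + real (card (segment (y + d)))"
    unfolding riesz_def using assms by (simp add: sum.distrib sum_segment_restrict)
  also have "real (card (segment (y + d))) \<le> y + 1" using assms card_segment_le[of "y + d"] by simp
  finally show ?thesis by simp
qed

lemma chebyshev_mono: "x \<le> y \<Longrightarrow> chebyshev x \<le> chebyshev y"
  unfolding chebyshev_def using segmentD(4) by (intro sum_mono2 segment_mono finite_segment) force+

lemma chebyshev_nonneg: "chebyshev x \<ge> 0"
  unfolding chebyshev_def using segmentD(4) by (intro sum_nonneg) force

lemma chebyshev_le_theta:
  assumes "x > 0"
  shows "chebyshev x \<le> 2 * theta (2 * x)"
proof -
  have weight: "0 \<le> ln (real q) * (1 - real q / (2 * x))" if "q \<in> segment (2 * x)" for q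
    using segmentD[OF that] assms by (intro mult_nonneg_nonneg) (auto simp: field_simps)
  have "chebyshev x = 2 * (\<Sum>q\<in>segment x. ln (real q) * (1/2))"
    unfolding chebyshev_def by (simp only: sum_distrib_right[symmetric])
  also have "(\<Sum>q\<in>segment x. ln (real q) * (1/2)) \<le> (\<Sum>q\<in>segment x. ln (real q) * (1 - real q / (2 * x)))"
  proof (intro sum_mono mult_left_mono)
    fix q assume q: "q \<in> segment x"
    show "1/2 \<le> 1 - real q / (2 * x)" using segmentD(2)[OF q] assms by (simp add: field_simps)
    show "0 \<le> ln (real q)" using segmentD(4)[OF q] by simp
  qed
  also have "\<dots> \<le> theta (2 * x)" unfolding theta_def
    using assms weight by (intro sum_mono2 segment_mono finite_segment) auto
  finally show ?thesis by simp
qed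

lemma chebyshev_linear:
  assumes "theta \<in> O(\<lambda>x. x)"
  obtains C where "C > 0" "\<And>x. x \<ge> 1 \<Longrightarrow> chebyshev x \<le> C * x"
proof -
  obtain c where c: "c > 0" "\<forall>\<^sub>F x in at_top. norm (theta x) \<le> c * norm x"
    using assms by (elim landau_o.bigE)
  from eventually_conj[OF c(2) eventually_ge_at_top[of 1]]
  obtain y where y: "\<And>x. x \<ge> y \<Longrightarrow> \<bar>theta x\<bar> \<le> c * \<bar>x\<bar> \<and> x \<ge> 1"
    unfolding eventually_at_top_linorder by auto
  define C where "C = 4 * c + chebyshev y"
  have C: "C > 0" "4 * c \<le> C" "chebyshev y \<le> C"
    using c(1) chebyshev_nonneg[of y] by (auto simp: C_def)
  show ?thesis
  proof (rule that[OF C(1)])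
    fix x :: real assume x: "x \<ge> 1"
    show "chebyshev x \<le> C * x"
    proof (cases "x \<ge> y")
      case True
      have "2 * x \<ge> y" using True x by linarith
      then have "\<bar>theta (2 * x)\<bar> \<le> c * \<bar>2 * x\<bar>" using y by blast
      then have "chebyshev x \<le> 4 * c * x"
        using chebyshev_le_theta[of x] x by (simp add: abs_le_iff)
      also have "\<dots> \<le> C * x" using C(2) x by (intro mult_right_mono) auto
      finally show ?thesis .
    next
      case False
      then have "chebyshev x \<le> C" using chebyshev_mono[of x y] C(3) by linarith
      also have "\<dots> \<le> C * x" using mult_left_mono[of 1 x C] x C(1) by simp
      finally show ?thesis .
    qed
  qed
qed

lemma log_weight_halving: "x > 0 \<Longrightarrow> log_weight x \<le> chebyshev x + log_weight (x / 2)"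
proof -
  assume x: "x > 0"
  let ?half = "\<lambda>q. if q \<in> segment (x / 2) then ln (real q) * ln (x / 2 / real q) else 0"
  have "log_weight x \<le> (\<Sum>q\<in>segment x. ln (real q) + ?half q)"
    unfolding log_weight_def
  proof (rule sum_mono)
    fix q assume q: "q \<in> segment x"
    note q' = segmentD[OF q]
    have "ln (x / real q) = ln 2 + ln (x / 2 / real q)" using q'(3) x by (simp add: ln_div ln_mult)
    moreover have "ln (x / 2 / real q) \<le> 0" if "q \<notin> segment (x / 2)"
      using that q' x by (auto simp: segment_def field_simps)
    ultimately have "ln (x / real q) \<le> 1 + (if q \<in> segment (x / 2) then ln (x / 2 / real q) else 0)"
      using ln_2_less_1 by auto
    from mult_left_mono[OF this, of "ln (real q)"] show "ln (real q) * ln (x / real q) \<le> ln (real q) + ?half q"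
      using q'(4) by (auto simp: algebra_simps split: if_splits)
  qed
  also have "\<dots> = chebyshev x + log_weight (x / 2)"
    unfolding sum.distrib chebyshev_def log_weight_def using x by (simp add: sum_segment_restrict)
  finally show ?thesis .
qed

lemma log_weight_le:
  assumes C: "C > 0" "\<And>x. x \<ge> 1 \<Longrightarrow> chebyshev x \<le> C * x" and "x \<ge> 1"
  shows "log_weight x \<le> 2 * C * x"
proof -
  have dyadic: "log_weight x \<le> 2 * C * x" if "x > 0" "x \<le> 2 ^ n" for x n
    using that
  proof (induction n arbitrary: x)
    case 0
    then show ?case using C(1) by (simp add: log_weight_def segment_empty)
  next
    case (Suc n)
    show ?case
    proof (cases "x < 2")
      case True
      then show ?thesis using C(1) Suc.prems by (simp add: log_weight_def segment_empty)
    next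
      case False
      have "log_weight x \<le> chebyshev x + log_weight (x / 2)" using Suc.prems(1) by (rule log_weight_halving)
      also have "\<dots> \<le> C * x + 2 * C * (x / 2)"
        using C(2)[of x] Suc.IH[of "x / 2"] Suc.prems False by (intro add_mono) auto
      finally show ?thesis by simp
    qed
  qed
  obtain n where "x < 2 ^ n" using real_arch_pow[of 2 x] by auto
  then show ?thesis using dyadic[of x n] \<open>x \<ge> 1\<close> by simp
qed

lemma ln_mult_riesz_eq:
  assumes "x > 0"
  shows "ln x * riesz x = x * theta x + x * (\<Sum>q\<in>segment x. (1 - real q / x) * ln (x / real q))"
proof -
  have "ln x * (x - real q) = x * (ln (real q) * (1 - real q / x)) + x * ((1 - real q / x) * ln (x / real q))"
    if "q \<in> segment x" for q
  proof -
    have ln_div_eq: "ln (x / real q) = ln x - ln (real q)" using segmentD(3)[OF that] assms by (simp add: ln_div)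
    have "x - real q = x * (1 - real q / x)" using assms by (simp add: field_simps)
    then show ?thesis unfolding ln_div_eq by (simp only:) (simp only: algebra_simps)
  qed
  then show ?thesis
    unfolding riesz_def theta_def sum_distrib_left by (simp add: sum.distrib)
qed

lemma
  assumes "x > 1"
  shows riesz_remainder_nonneg: "0 \<le> (\<Sum>q\<in>segment x. (1 - real q / x) * ln (x / real q))" (is "0 \<le> ?R")
    and riesz_remainder_le:
      "(\<Sum>q\<in>segment x. (1 - real q / x) * ln (x / real q)) \<le> sqrt x * ln x + 2 / ln x * log_weight x"
proof -
  have ln_x_pos: "ln x > 0" using assms by simp
  have weights: "0 \<le> ln (x / real q)" "0 \<le> 1 - real q / x" if "q \<in> segment x" for q
    using segmentD[OF that] assms by (simp_all add: field_simps)
  then show "0 \<le> ?R" by (intro sum_nonneg mult_nonneg_nonneg)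
  let ?small = "\<lambda>q. if q \<in> segment (sqrt x) then ln x else 0"
  have "?R \<le> (\<Sum>q\<in>segment x. ?small q + 2 / ln x * (ln (real q) * ln (x / real q)))"
  proof (rule sum_mono)
    fix q assume q: "q \<in> segment x"
    note q' = segmentD[OF q]
    have "(1 - real q / x) * ln (x / real q) \<le> 1 * ln (x / real q)"
      using weights[OF q] assms by (intro mult_right_mono) auto
    also have "\<dots> \<le> ?small q + 2 / ln x * (ln (real q) * ln (x / real q))"
    proof (cases "q \<in> segment (sqrt x)")
      case True
      have "ln (x / real q) \<le> ln x" using q' assms by (simp add: ln_div)
      moreover have "2 / ln x * (ln (real q) * ln (x / real q)) \<ge> 0" using ln_x_pos q'(4) weights(1)[OF q] by simp
      ultimately show ?thesis using True by simp
    next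
      case False
      then have "sqrt x < real q" using q'(1) by (auto simp: segment_def)
      then have "ln (sqrt x) \<le> ln (real q)" using assms q'(3) by simp
      then have "1 \<le> 2 / ln x * ln (real q)" using ln_x_pos assms by (simp add: ln_sqrt field_simps)
      from mult_right_mono[OF this weights(1)[OF q]] show ?thesis using False by (simp add: mult.assoc)
    qed
    finally show "(1 - real q / x) * ln (x / real q) \<le> ?small q + 2 / ln x * (ln (real q) * ln (x / real q))" .
  qed
  also have "\<dots> = (\<Sum>q\<in>segment (sqrt x). ln x) + 2 / ln x * log_weight x"
    unfolding sum.distrib log_weight_def sum_distrib_left
    using assms by (subst sum_segment_restrict) (auto simp: real_sqrt_le_iff' power2_eq_square intro!: real_le_lsqrt)
  also have "(\<Sum>q\<in>segment (sqrt x). ln x) \<le> sqrt x * ln x"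
    using card_segment_le[of "sqrt x"] ln_x_pos assms by (simp add: mult_right_mono)
  finally show "?R \<le> sqrt x * ln x + 2 / ln x * log_weight x" by simp
qed

theorem riesz_asymp:
  assumes theta: "(\<lambda>x. theta x - \<kappa> * x) \<in> O(\<lambda>x. x / ln x)"
  shows "(\<lambda>x. riesz x - \<kappa> * x\<^sup>2 / ln x) \<in> O(\<lambda>x. x\<^sup>2 / (ln x)\<^sup>2)"
proof -
  define R where "R = (\<lambda>x. \<Sum>q\<in>segment x. (1 - real q / x) * ln (x / real q))"
  have "(\<lambda>x::real. x / ln x) \<in> O(\<lambda>x. x)" by real_asymp
  with theta have "(\<lambda>x. (theta x - \<kappa> * x) + \<kappa> * x) \<in> O(\<lambda>x. x)"
    by (intro sum_in_bigo(1)) (auto intro: landau_o.big_trans)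
  then have "theta \<in> O(\<lambda>x. x)" by simp
  then obtain C where C: "C > 0" "\<And>x. x \<ge> 1 \<Longrightarrow> chebyshev x \<le> C * x" by (rule chebyshev_linear) blast
  have "R \<in> O(\<lambda>x. sqrt x * ln x + 2 / ln x * (2 * C * x))"
  proof (rule bigoI[where c = 1])
    show "\<forall>\<^sub>F x in at_top. norm (R x) \<le> 1 * norm (sqrt x * ln x + 2 / ln x * (2 * C * x))"
      using eventually_gt_at_top[of 1]
    proof eventually_elim
      case (elim x)
      have "2 / ln x * log_weight x \<le> 2 / ln x * (2 * C * x)"
        using log_weight_le[OF C, of x] elim by (intro mult_left_mono) auto
      then show ?case
        using riesz_remainder_nonneg[OF elim] riesz_remainder_le[OF elim] by (simp add: R_def)
    qed
  qed
  also have "(\<lambda>x. sqrt x * ln x + 2 / ln x * (2 * C * x)) \<in> O(\<lambda>x. x / ln x)"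
    using C(1) by real_asymp
  finally have "(\<lambda>x. x / ln x * ((theta x - \<kappa> * x) + R x)) \<in> O(\<lambda>x. x / ln x * (x / ln x))"
    by (intro landau_o.big.mult_left sum_in_bigo(1) theta)
  also have "(\<lambda>x::real. x / ln x * (x / ln x)) \<in> O(\<lambda>x. x\<^sup>2 / (ln x)\<^sup>2)" by real_asymp
  also have "(\<lambda>x. x / ln x * ((theta x - \<kappa> * x) + R x)) \<in> O(\<lambda>x. x\<^sup>2 / (ln x)\<^sup>2) \<longleftrightarrow>
    (\<lambda>x. riesz x - \<kappa> * x\<^sup>2 / ln x) \<in> O(\<lambda>x. x\<^sup>2 / (ln x)\<^sup>2)"
  proof (rule landau_o.big.in_cong)
    show "\<forall>\<^sub>F x in at_top. x / ln x * ((theta x - \<kappa> * x) + R x) = riesz x - \<kappa> * x\<^sup>2 / ln x"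
      using eventually_gt_at_top[of 1]
    proof eventually_elim
      case (elim x)
      have "riesz x = (x * theta x + x * R x) / ln x"
        using ln_mult_riesz_eq[of x] elim by (simp add: R_def field_simps)
      then show ?case using elim by (simp add: field_simps power2_eq_square)
    qed
  qed
  finally show ?thesis .
qed

end

section \<open>A knapsack problem with logarithmic gains\<close>

text \<open>The gain of raising a multiplicity from \<open>l\<close> to \<open>l + 1\<close> when the multiplicity \<open>b\<close> is worth \<open>ln (b + 1)\<close>.\<close>

definition gain :: "nat \<Rightarrow> real" where
  "gain l = ln (1 + 1 / real (Suc l))"

definition gain_sq_sum :: real where
  "gain_sq_sum = (\<Sum>l. (gain l)\<^sup>2)"

definition gain_three_halves_sum :: real where
  "gain_three_halves_sum = (\<Sum>l. gain l * sqrt (gain l))"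

lemma gain_pos: "gain l > 0"
  unfolding gain_def by (intro ln_gt_zero) simp

lemma gain_le: "gain l \<le> 1 / real (Suc l)"
  unfolding gain_def by (rule ln_add_one_self_le_self) simp

lemma gain_le_1: "gain l \<le> 1"
  by (rule order.trans[OF gain_le]) simp

lemma mult_gain_less_1:
  assumes "0 \<le> T" "T \<le> real l"
  shows "T * gain l < 1"
proof -
  have "T * gain l \<le> T / real (Suc l)" using mult_left_mono[OF gain_le[of l] assms(1)] by simp
  also have "\<dots> < 1" using assms by simp
  finally show ?thesis .
qed

lemma sum_gain: "(\<Sum>l<b. gain l) = ln (real b + 1)"
proof (induction b)
  case (Suc b)
  have "1 + 1 / real (Suc b) = (real (Suc b) + 1) / real (Suc b)" by (simp add: field_simps)
  then have "gain b = ln (real (Suc b) + 1) - ln (real (Suc b))"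
    unfolding gain_def by (simp add: ln_div)
  then show ?case using Suc by simp
qed simp

lemma summable_gain_three_halves: "summable (\<lambda>l. gain l * sqrt (gain l))"
proof (rule summable_comparison_test'[where N = 0])
  show "summable (\<lambda>l. real (Suc l) powr (- (3/2)))"
    using summable_real_powr_iff[of "- (3/2)"] summable_Suc_iff[of "\<lambda>n. real n powr (- (3/2))"] by simp
  fix l
  have "gain l * sqrt (gain l) \<le> 1 / real (Suc l) * sqrt (1 / real (Suc l))"
    using gain_le[of l] gain_pos[of l] by (intro mult_mono) auto
  also have "\<dots> = real (Suc l) powr (- (3/2))"
    using powr_add[of "real (Suc l)" "-1" "-1/2"]
    by (simp add: powr_minus_divide powr_half_sqrt real_sqrt_divide)
  finally show "norm (gain l * sqrt (gain l)) \<le> real (Suc l) powr (- (3/2))"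
    using gain_pos[of l] by simp
qed

lemma summable_gain_sq: "summable (\<lambda>l. (gain l)\<^sup>2)"
proof (rule summable_comparison_test'[OF summable_gain_three_halves])
  fix l
  have "sqrt (gain l) * sqrt (gain l) \<le> sqrt (gain l) * 1"
    using gain_pos[of l] gain_le_1[of l] by (intro mult_left_mono) auto
  then show "norm ((gain l)\<^sup>2) \<le> gain l * sqrt (gain l)"
    using gain_pos[of l] by (simp add: power2_eq_square)
qed

lemma gain_sq_sum_pos: "gain_sq_sum > 0"
  unfolding gain_sq_sum_def by (intro suminf_pos summable_gain_sq) (use gain_pos in \<open>auto simp: less_le\<close>)

context price_set
begin

definition dual :: "real \<Rightarrow> real \<Rightarrow> real" where
  "dual d T = (\<Sum>l. riesz (T * gain l + d))"

lemma riesz_gain_eq_0: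
  assumes "0 \<le> T" "T \<le> real l" "d \<le> 1"
  shows "riesz (T * gain l + d) = 0"
  using mult_gain_less_1[OF assms(1,2)] assms(3) by (intro riesz_eq_0) linarith

lemma dual_sums:
  assumes "0 \<le> T" "T \<le> real M" "d \<le> 1"
  shows "(\<lambda>l. riesz (T * gain l + d)) sums (\<Sum>l<M. riesz (T * gain l + d))"
proof (rule sums_finite)
  fix l assume "l \<notin> {..<M}"
  then have "T \<le> real l" using assms(2) by simp
  then show "riesz (T * gain l + d) = 0" using assms by (intro riesz_gain_eq_0)
qed simp

lemma dual_eq_sum: "0 \<le> T \<Longrightarrow> T \<le> real M \<Longrightarrow> d \<le> 1 \<Longrightarrow> dual d T = (\<Sum>l<M. riesz (T * gain l + d))"
  unfolding dual_def by (rule sums_unique[OF dual_sums, symmetric])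

lemma summable_dual:
  assumes "0 \<le> T" "d \<le> 1"
  shows "summable (\<lambda>l. riesz (T * gain l + d))"
proof -
  obtain M where "T \<le> real M" using real_arch_simple by blast
  then show ?thesis using dual_sums[OF assms(1) _ assms(2)] sums_summable by blast
qed

lemma sum_max_le_riesz:
  assumes "finite A" "A \<subseteq> P"
  shows "(\<Sum>q\<in>A. max 0 (x - real q)) \<le> riesz x"
proof -
  have "(\<Sum>q\<in>A. max 0 (x - real q)) = (\<Sum>q\<in>A \<inter> segment x. max 0 (x - real q))"
    using assms by (intro sum.mono_neutral_right) (auto simp: segment_def)
  also have "\<dots> = (\<Sum>q\<in>A \<inter> segment x. x - real q)"
    by (intro sum.cong) (auto simp: segment_def)
  also have "\<dots> \<le> riesz x" unfolding riesz_def
    by (intro sum_mono2 finite_segment) (auto simp: segment_def)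
  finally show ?thesis .
qed

text \<open>With the multiplier \<open>1 / T\<close>, each unit of price \<open>q\<close> and gain \<open>gain l\<close> is optimised separately.\<close>

lemma weak_duality:
  assumes A: "finite A" "A \<subseteq> P" and T: "T > 0" and d: "d \<le> 1"
  shows "(\<Sum>q\<in>A. ln (real (b q) + 1)) \<le> ((\<Sum>q\<in>A. real (b q) * (real q - d)) + dual d T) / T"
proof -
  define M where "M = (\<Sum>q\<in>A. b q)"
  have M: "b q \<le> M" if "q \<in> A" for q unfolding M_def using A(1) that by (intro member_le_sum) auto
  have "T * (\<Sum>q\<in>A. ln (real (b q) + 1)) - (\<Sum>q\<in>A. real (b q) * (real q - d)) =
    (\<Sum>q\<in>A. \<Sum>l<b q. T * gain l + d - real q)"
    by (simp add: sum_subtractf sum.distrib sum_distrib_left[symmetric] sum_gain algebra_simps)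
  also have "\<dots> \<le> (\<Sum>q\<in>A. \<Sum>l<M. max 0 (T * gain l + d - real q))"
  proof (rule sum_mono)
    fix q assume q: "q \<in> A"
    have "(\<Sum>l<b q. T * gain l + d - real q) \<le> (\<Sum>l<b q. max 0 (T * gain l + d - real q))"
      by (intro sum_mono) auto
    also have "\<dots> \<le> (\<Sum>l<M. max 0 (T * gain l + d - real q))"
      using M[OF q] by (intro sum_mono2) auto
    finally show "(\<Sum>l<b q. T * gain l + d - real q) \<le> (\<Sum>l<M. max 0 (T * gain l + d - real q))" .
  qed
  also have "\<dots> = (\<Sum>l<M. \<Sum>q\<in>A. max 0 (T * gain l + d - real q))" by (rule sum.swap)
  also have "\<dots> \<le> (\<Sum>l<M. riesz (T * gain l + d))" by (intro sum_mono sum_max_le_riesz A)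
  also have "\<dots> \<le> dual d T" unfolding dual_def
    using T d by (intro sum_le_suminf summable_dual) (auto simp: riesz_nonneg)
  finally show ?thesis using T by (simp add: field_simps)
qed

text \<open>
  The greedy solution buys the unit \<open>(q, l)\<close> iff its price \<open>q\<close> is at most \<open>T\<close> times its gain, which means
  \<open>exp (q / T) \<le> 1 + 1 / (l + 1)\<close>. It attains equality in weak duality.
\<close>

definition copies :: "real \<Rightarrow> nat \<Rightarrow> nat" where
  "copies T q = nat \<lfloor>1 / (exp (real q / T) - 1)\<rfloor>"

definition base :: "real \<Rightarrow> nat set" where
  "base T = segment (T * gain 0)"

definition cost :: "real \<Rightarrow> real" where
  "cost T = (\<Sum>q\<in>base T. real (copies T q) * real q)"

lemma less_copies_iff:
  assumes "T > 0" "q > 0"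
  shows "l < copies T q \<longleftrightarrow> real q \<le> T * gain l"
proof -
  define e where "e = exp (real q / T)"
  have e: "e > 1" using assms by (simp add: e_def)
  have "l < copies T q \<longleftrightarrow> real (Suc l) \<le> 1 / (e - 1)"
    by (simp add: copies_def e_def[symmetric] zless_nat_eq_int_zless less_floor_iff add.commute)
  also have "\<dots> \<longleftrightarrow> e \<le> 1 + 1 / real (Suc l)" using e by (simp add: field_simps)
  also have "\<dots> \<longleftrightarrow> real q / T \<le> gain l"
    unfolding e_def gain_def by (subst ln_ge_iff) (auto intro: add_pos_pos)
  finally show ?thesis using assms(1) by (simp add: field_simps)
qed

lemma finite_base [simp]: "finite (base T)"
  by (simp add: base_def)

lemma base_subset: "base T \<subseteq> P"
  by (auto simp: base_def segment_def)

lemma base_pos: "q \<in> base T \<Longrightarrow> q > 0"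
  using segmentD(3)[of q] by (force simp: base_def)

lemma base_nonpos: "T \<le> 0 \<Longrightarrow> base T = {}"
  unfolding base_def using gain_pos[of 0]
  by (intro segment_empty) (smt (verit) mult_nonpos_nonneg)

lemma sum_copies_swap:
  fixes h :: "nat \<Rightarrow> nat \<Rightarrow> real"
  assumes T: "0 < T" "T \<le> real M"
  shows "(\<Sum>q\<in>base T. \<Sum>l<copies T q. h q l) = (\<Sum>l<M. \<Sum>q\<in>segment (T * gain l). h q l)"
proof -
  have units: "{..<copies T q} = {l \<in> {..<M}. real q \<le> T * gain l}" if "q \<in> base T" for q
  proof (intro equalityI subsetI)
    fix l assume "l \<in> {..<copies T q}"
    then have affordable: "real q \<le> T * gain l" using less_copies_iff[OF T(1) base_pos[OF that]] by simp
    have "2 \<le> real q" using that segmentD(3) by (simp add: base_def)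
    then have "\<not> M \<le> l" using affordable mult_gain_less_1[of T l] T by fastforce
    then show "l \<in> {l \<in> {..<M}. real q \<le> T * gain l}" using affordable by simp
  qed (use less_copies_iff[OF T(1) base_pos[OF that]] in simp)
  have buyers: "{q \<in> base T. real q \<le> T * gain l} = segment (T * gain l)" for l
  proof -
    have "gain l \<le> gain 0"
      unfolding gain_def by (subst ln_le_cancel_iff) (auto intro: add_pos_nonneg simp: field_simps)
    then have "T * gain l \<le> T * gain 0" using T(1) by simp
    then show ?thesis by (auto simp: base_def segment_def)
  qed
  have "(\<Sum>q\<in>base T. \<Sum>l<copies T q. h q l) = (\<Sum>q\<in>base T. \<Sum>l\<in>{l \<in> {..<M}. real q \<le> T * gain l}. h q l)"
    by (intro sum.cong refl units)
  also have "\<dots> = (\<Sum>l<M. \<Sum>q\<in>{q \<in> base T. real q \<le> T * gain l}. h q l)"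
    by (rule sum.swap_restrict) auto
  finally show ?thesis unfolding buyers .
qed

lemma greedy_value:
  assumes "T > 0"
  shows "T * (\<Sum>q\<in>base T. ln (real (copies T q) + 1)) = dual 0 T + cost T"
proof -
  obtain M where M: "T \<le> real M" using real_arch_simple by blast
  have "T * (\<Sum>q\<in>base T. ln (real (copies T q) + 1)) - cost T = (\<Sum>q\<in>base T. \<Sum>l<copies T q. T * gain l - real q)"
    by (simp add: cost_def sum_subtractf sum_distrib_left[symmetric] sum_gain)
  also have "\<dots> = (\<Sum>l<M. riesz (T * gain l))" unfolding sum_copies_swap[OF assms M] riesz_def ..
  also have "\<dots> = dual 0 T" using dual_eq_sum[of T M 0] assms M by simp
  finally show ?thesis by simp
qed

lemma sum_copies_le:
  assumes "T > 0"
  shows "(\<Sum>q\<in>base (real T). real (copies (real T) q)) \<le> real T * ln (real T + 1)"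
proof -
  have "(\<Sum>q\<in>base (real T). real (copies (real T) q)) = (\<Sum>l<T. real (card (segment (real T * gain l))))"
    using sum_copies_swap[of "real T" T "\<lambda>q l. 1"] assms by simp
  also have "\<dots> \<le> (\<Sum>l<T. real T * gain l)"
    using gain_pos by (intro sum_mono card_segment_le) (simp add: less_imp_le)
  finally show ?thesis by (simp add: sum_distrib_left[symmetric] sum_gain)
qed

definition segment_sum :: "real \<Rightarrow> real" where
  "segment_sum y = (\<Sum>q\<in>segment y. real q)"

lemma segment_sum_nonneg: "segment_sum y \<ge> 0"
  unfolding segment_sum_def by (intro sum_nonneg) auto

lemma segment_sum_le: "y \<ge> 0 \<Longrightarrow> segment_sum y \<le> y\<^sup>2"
proof -
  assume y: "y \<ge> 0"
  have "segment_sum y \<le> (\<Sum>q\<in>segment y. y)" unfolding segment_sum_def by (intro sum_mono) (auto simp: segment_def)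
  also have "\<dots> \<le> y * y" using card_segment_le[OF y] y by (simp add: mult_right_mono)
  finally show ?thesis by (simp add: power2_eq_square)
qed

lemma segment_sum_step:
  assumes "0 \<le> y" "y \<le> y'" "y' \<le> y + 1"
  shows "segment_sum y' \<le> segment_sum y + y' * sqrt y'"
proof (cases "y' < 2")
  case True
  have "0 \<le> y' * sqrt y'" using assms by simp
  then show ?thesis using True segment_sum_nonneg[of y] by (simp add: segment_sum_def[of y'] segment_empty)
next
  case False
  have new: "segment y' - segment y \<subseteq> {nat \<lfloor>y'\<rfloor>}"
  proof
    fix q assume "q \<in> segment y' - segment y"
    then have "real q \<le> y'" "y < real q" by (auto simp: segment_def)
    then have "q = nat \<lfloor>y'\<rfloor>" using assms by linarith
    then show "q \<in> {nat \<lfloor>y'\<rfloor>}" by simp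
  qed
  have "segment_sum y' = segment_sum y + (\<Sum>q\<in>segment y' - segment y. real q)"
    unfolding segment_sum_def using sum.subset_diff[OF segment_mono[OF assms(2)] finite_segment, of real] by simp
  also have "(\<Sum>q\<in>segment y' - segment y. real q) \<le> (\<Sum>q\<in>{nat \<lfloor>y'\<rfloor>}. real q)"
    using new by (intro sum_mono2) auto
  also have "\<dots> \<le> y' * 1" using assms by simp
  also have "\<dots> \<le> y' * sqrt y'" using False by (intro mult_left_mono) auto
  finally show ?thesis by simp
qed

text \<open>At least half of the elements exceed \<open>card / 2\<close>.\<close>

lemma segment_sum_ge:
  assumes y: "y \<ge> 0"
  shows "segment_sum y \<ge> (real (card (segment y)))\<^sup>2 / 4"
proof -
  define w where "w = real (card (segment y)) / 2"
  have w: "0 \<le> w" "w \<le> y" using card_segment_le[OF y] y by (simp_all add: w_def)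
  note sub = segment_mono[OF w(2)]
  have "w * w \<le> w * real (card (segment y - segment w))"
  proof (rule mult_left_mono[OF _ w(1)])
    have "card (segment y - segment w) = card (segment y) - card (segment w)"
      using sub by (intro card_Diff_subset) auto
    moreover have "card (segment w) \<le> card (segment y)" using sub by (intro card_mono) auto
    ultimately show "w \<le> real (card (segment y - segment w))" using card_segment_le[OF w(1)] by (simp add: w_def)
  qed
  also have "\<dots> = (\<Sum>q\<in>segment y - segment w. w)" by (simp add: mult.commute)
  also have "\<dots> \<le> (\<Sum>q\<in>segment y - segment w. real q)"
    by (intro sum_mono) (auto simp: segment_def)
  also have "\<dots> \<le> segment_sum y" unfolding segment_sum_def by (intro sum_mono2) auto
  finally show ?thesis by (simp add: w_def power2_eq_square)
qed

lemma cost_eq_sum: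
  assumes "0 \<le> T" "T \<le> real M"
  shows "cost T = (\<Sum>l<M. segment_sum (T * gain l))"
proof (cases "T = 0")
  case False
  then show ?thesis
    using sum_copies_swap[of T M "\<lambda>q l. real q"] assms by (simp add: cost_def segment_sum_def)
qed (simp add: cost_def base_nonpos segment_sum_def segment_empty)

lemma cost_le:
  assumes "T \<ge> 0"
  shows "cost T \<le> gain_sq_sum * T\<^sup>2"
proof -
  obtain M where M: "T \<le> real M" using real_arch_simple by blast
  have "cost T \<le> (\<Sum>l<M. T\<^sup>2 * (gain l)\<^sup>2)" unfolding cost_eq_sum[OF assms M]
  proof (rule sum_mono)
    fix l show "segment_sum (T * gain l) \<le> T\<^sup>2 * (gain l)\<^sup>2"
      using segment_sum_le[of "T * gain l"] assms gain_pos[of l] by (simp add: power_mult_distrib)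
  qed
  also have "\<dots> = T\<^sup>2 * (\<Sum>l<M. (gain l)\<^sup>2)" by (simp add: sum_distrib_left)
  also have "\<dots> \<le> T\<^sup>2 * gain_sq_sum"
    unfolding gain_sq_sum_def by (intro mult_left_mono sum_le_suminf summable_gain_sq) auto
  finally show ?thesis by (simp add: mult.commute)
qed

lemma cost_step:
  assumes "T \<ge> 0"
  shows "cost (T + 1) \<le> cost T + gain_three_halves_sum * ((T + 1) * sqrt (T + 1))"
proof -
  obtain M where M: "T + 1 \<le> real M" using real_arch_simple by blast
  have "cost (T + 1) = (\<Sum>l<M. segment_sum ((T + 1) * gain l))" using assms M by (intro cost_eq_sum) auto
  also have "\<dots> \<le> (\<Sum>l<M. segment_sum (T * gain l) + (T + 1) * sqrt (T + 1) * (gain l * sqrt (gain l)))"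
  proof (rule sum_mono)
    fix l
    have "segment_sum ((T + 1) * gain l) \<le> segment_sum (T * gain l) + (T + 1) * gain l * sqrt ((T + 1) * gain l)"
      using assms gain_pos[of l] gain_le_1[of l] by (intro segment_sum_step) (auto simp: algebra_simps)
    then show "segment_sum ((T + 1) * gain l) \<le> segment_sum (T * gain l) + (T + 1) * sqrt (T + 1) * (gain l * sqrt (gain l))"
      by (simp add: real_sqrt_mult mult_ac)
  qed
  also have "\<dots> = cost T + (T + 1) * sqrt (T + 1) * (\<Sum>l<M. gain l * sqrt (gain l))"
    using cost_eq_sum[of T M] assms M by (simp add: sum.distrib sum_distrib_left)
  also have "(T + 1) * sqrt (T + 1) * (\<Sum>l<M. gain l * sqrt (gain l)) \<le> (T + 1) * sqrt (T + 1) * gain_three_halves_sum"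
    unfolding gain_three_halves_sum_def using assms gain_pos
    by (intro mult_left_mono sum_le_suminf summable_gain_three_halves) (auto simp: less_imp_le)
  finally show ?thesis by (simp only: mult.commute add_le_cancel_left)
qed

end

definition knapsack_error :: "real \<Rightarrow> real" where
  "knapsack_error Y = sqrt (Y / ln Y) * (ln (ln Y) / ln Y)"

lemma ln_le_2_sqrt:
  assumes "z > 0"
  shows "ln z \<le> 2 * sqrt (z::real)"
proof -
  have "ln (sqrt z) \<le> sqrt z" using assms ln_le_minus_one[of "sqrt z"] by simp
  then show ?thesis using assms by (simp add: ln_sqrt)
qed

text \<open>
  The error allowed in the approximation of \<open>riesz y\<close> by \<open>\<kappa> y\<^sup>2 / ln T\<close> for \<open>0 \<le> y \<le> T\<close>. It is summable over
  \<open>y = T \<cdot> gain l\<close>, and for \<open>y = T\<close> it is the error term of the asymptotic formula.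
\<close>

definition riesz_error :: "real \<Rightarrow> real \<Rightarrow> real" where
  "riesz_error T y = y * sqrt (y * T) / (ln T)\<^sup>2"

lemma riesz_error_nonneg: "0 \<le> y \<Longrightarrow> 0 \<le> T \<Longrightarrow> 0 \<le> riesz_error T y"
  by (simp add: riesz_error_def)

lemma square_le_riesz_error:
  assumes "0 \<le> y" "y \<le> sqrt T" "1 \<le> T" "(ln T)\<^sup>2 \<le> sqrt (sqrt T)" "ln T > 0"
  shows "y\<^sup>2 \<le> riesz_error T y"
proof -
  have "sqrt y * (ln T)\<^sup>2 \<le> sqrt (sqrt T) * sqrt (sqrt T)"
    using assms by (intro mult_mono) auto
  also have "\<dots> = sqrt T" using assms by simp
  finally have "y * sqrt y * (sqrt y * (ln T)\<^sup>2) \<le> y * sqrt y * sqrt T"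
    using assms by (intro mult_left_mono) auto
  moreover have "y\<^sup>2 = y * sqrt y * sqrt y" using assms(1) by (simp add: power2_eq_square mult.assoc)
  ultimately have "y\<^sup>2 * (ln T)\<^sup>2 \<le> y * sqrt (y * T)" by (simp only: real_sqrt_mult mult.assoc)
  then show ?thesis using assms(5) by (simp add: riesz_error_def pos_le_divide_eq)
qed

lemma square_div_ln_le_riesz_error:
  assumes "0 \<le> y" "y \<le> T"
  shows "y\<^sup>2 / (ln T)\<^sup>2 \<le> riesz_error T y"
proof -
  have "y \<le> sqrt (y * T)" using assms by (intro real_le_rsqrt) (simp add: power2_eq_square mult_left_mono)
  then show ?thesis unfolding riesz_error_def power2_eq_square[of y]
    using assms by (intro divide_right_mono mult_left_mono) auto
qed

lemma le_riesz_error: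
  assumes "1 \<le> y" "1 < T" "(ln T)\<^sup>2 \<le> sqrt T"
  shows "y \<le> riesz_error T y"
proof -
  have "sqrt T \<le> sqrt (y * T)" using assms mult_right_mono[of 1 y T] by simp
  then have "(ln T)\<^sup>2 \<le> sqrt (y * T)" using assms(3) by linarith
  then have "y * (ln T)\<^sup>2 \<le> y * sqrt (y * T)" using assms by (intro mult_left_mono) auto
  then show ?thesis using assms by (simp add: riesz_error_def field_simps)
qed

lemma ln_base_change_le_riesz_error:
  assumes "1 < y" "y \<le> T" "ln T \<le> 2 * ln y"
  shows "\<bar>y\<^sup>2 / ln y - y\<^sup>2 / ln T\<bar> \<le> 4 * riesz_error T y"
proof -
  have pos: "ln y > 0" "ln T > 0" "ln y \<le> ln T" using assms by auto
  have "y\<^sup>2 / ln y - y\<^sup>2 / ln T = y\<^sup>2 * (ln T - ln y) / (ln y * ln T)"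
    using pos by (simp add: field_simps)
  moreover have "0 \<le> y\<^sup>2 * (ln T - ln y) / (ln y * ln T)" using pos by simp
  ultimately have "\<bar>y\<^sup>2 / ln y - y\<^sup>2 / ln T\<bar> = y\<^sup>2 * ln (T / y) / (ln y * ln T)"
    using assms by (simp add: ln_div)
  also have "\<dots> \<le> y\<^sup>2 * (2 * sqrt (T / y)) / (ln T / 2 * ln T)"
    using assms pos by (intro frac_le mult_left_mono mult_right_mono ln_le_2_sqrt) auto
  also have "y\<^sup>2 * (2 * sqrt (T / y)) = 2 * (y * sqrt (y * T))"
  proof -
    have "y * sqrt (T / y) = sqrt (y * T)"
      using assms by (simp add: real_sqrt_divide real_sqrt_mult field_simps real_sqrt_mult_self)
    then show ?thesis by (simp add: power2_eq_square)
  qed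
  finally show ?thesis by (simp add: riesz_error_def power2_eq_square)
qed

locale dense_price_set = price_set +
  fixes \<kappa> :: real
  assumes kappa_pos: "\<kappa> > 0"
    and theta_asymp: "(\<lambda>x. theta x - \<kappa> * x) \<in> O(\<lambda>x. x / ln x)"
begin

lemma riesz_shift_approx_small:
  assumes y: "0 \<le> y" "y \<le> sqrt T" and T: "1 < T" "(ln T)\<^sup>2 \<le> sqrt (sqrt T)" "1 \<le> ln T" and d: "0 \<le> d" "d \<le> 1"
  shows "\<bar>riesz (y + d) - \<kappa> * y\<^sup>2 / ln T\<bar> \<le> (4 + \<kappa>) * riesz_error T y"
proof -
  have "riesz (y + d) \<le> 4 * y\<^sup>2"
  proof (cases "y < 1")
    case True
    then show ?thesis using d by (simp add: riesz_eq_0)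
  next
    case False
    have "riesz (y + d) \<le> (y + d)\<^sup>2" using y d by (intro riesz_le_square) simp
    also have "\<dots> \<le> (2 * y)\<^sup>2" using False d by (intro power_mono) auto
    finally show ?thesis by (simp add: power_mult_distrib)
  qed
  moreover have "\<kappa> * y\<^sup>2 / ln T \<le> \<kappa> * y\<^sup>2 / 1" using kappa_pos T by (intro divide_left_mono) auto
  moreover have "0 \<le> \<kappa> * y\<^sup>2 / ln T" using kappa_pos T by simp
  ultimately have "\<bar>riesz (y + d) - \<kappa> * y\<^sup>2 / ln T\<bar> \<le> (4 + \<kappa>) * y\<^sup>2"
    using riesz_nonneg[of "y + d"] kappa_pos by (simp add: algebra_simps abs_le_iff)
  also have "\<dots> \<le> (4 + \<kappa>) * riesz_error T y"
    using y T kappa_pos by (intro mult_left_mono square_le_riesz_error) linarith+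
  finally show ?thesis .
qed

lemma riesz_shift_approx_large:
  assumes y: "sqrt T < y" "y \<le> T" and T: "1 < T" "(ln T)\<^sup>2 \<le> sqrt T" and d: "0 \<le> d" "d \<le> 1"
    and K: "0 \<le> K" "\<bar>riesz y - \<kappa> * y\<^sup>2 / ln y\<bar> \<le> K * (y\<^sup>2 / (ln y)\<^sup>2)"
  shows "\<bar>riesz (y + d) - \<kappa> * y\<^sup>2 / ln T\<bar> \<le> (2 + 4 * K + 4 * \<kappa>) * riesz_error T y"
proof -
  have y_gt_1: "1 < y" using y T by (meson less_trans real_sqrt_gt_1_iff)
  have "ln (sqrt T) \<le> ln y" using y T y_gt_1 by simp
  then have ln_y: "ln T \<le> 2 * ln y" "ln y > 0" using T y_gt_1 by (simp_all add: ln_sqrt)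
  have "\<bar>riesz (y + d) - riesz y\<bar> \<le> 2 * y"
    using riesz_mono[of y "y + d"] riesz_diff_le[of y d] y_gt_1 d by simp
  also have "\<dots> \<le> 2 * riesz_error T y" using le_riesz_error[of y T] y_gt_1 T by simp
  finally have shift: "\<bar>riesz (y + d) - riesz y\<bar> \<le> 2 * riesz_error T y" .
  note K(2)
  also have "K * (y\<^sup>2 / (ln y)\<^sup>2) \<le> K * (y\<^sup>2 / (ln T / 2)\<^sup>2)"
    using ln_y T K(1) by (intro mult_left_mono divide_left_mono power_mono) auto
  also have "\<dots> = 4 * K * (y\<^sup>2 / (ln T)\<^sup>2)" by (simp add: power_divide)
  also have "\<dots> \<le> 4 * K * riesz_error T y"
    using y y_gt_1 K(1) by (intro mult_left_mono square_div_ln_le_riesz_error) auto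
  finally have asymp: "\<bar>riesz y - \<kappa> * y\<^sup>2 / ln y\<bar> \<le> 4 * K * riesz_error T y" .
  have "\<bar>\<kappa> * y\<^sup>2 / ln y - \<kappa> * y\<^sup>2 / ln T\<bar> = \<kappa> * \<bar>y\<^sup>2 / ln y - y\<^sup>2 / ln T\<bar>"
    using kappa_pos by (simp add: abs_mult_pos' right_diff_distrib)
  also have "\<dots> \<le> \<kappa> * (4 * riesz_error T y)"
    using kappa_pos y y_gt_1 ln_y by (intro mult_left_mono ln_base_change_le_riesz_error) auto
  finally show ?thesis using shift asymp by (simp add: algebra_simps)
qed

lemma riesz_shift_approx:
  assumes d: "0 \<le> d" "d \<le> 1"
  obtains C where "C > 0"
    "\<forall>\<^sub>F T in at_top. \<forall>y. 0 \<le> y \<longrightarrow> y \<le> T \<longrightarrow> \<bar>riesz (y + d) - \<kappa> * y\<^sup>2 / ln T\<bar> \<le> C * riesz_error T y"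
proof -
  obtain K where K: "K > 0" "\<forall>\<^sub>F x in at_top. norm (riesz x - \<kappa> * x\<^sup>2 / ln x) \<le> K * norm (x\<^sup>2 / (ln x)\<^sup>2)"
    using riesz_asymp[OF theta_asymp] by (elim landau_o.bigE)
  then obtain x0 where x0: "\<bar>riesz x - \<kappa> * x\<^sup>2 / ln x\<bar> \<le> K * (x\<^sup>2 / (ln x)\<^sup>2)" if "x \<ge> x0" for x
    unfolding eventually_at_top_linorder by auto
  define C where "C = 4 + 4 * K + 4 * \<kappa>"
  have C: "4 + \<kappa> \<le> C" "2 + 4 * K + 4 * \<kappa> \<le> C" "C > 0" using K(1) kappa_pos by (simp_all add: C_def)
  have evs: "\<forall>\<^sub>F T::real in at_top. sqrt T \<ge> x0" "\<forall>\<^sub>F T::real in at_top. (ln T)\<^sup>2 \<le> sqrt (sqrt T)"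
      "\<forall>\<^sub>F T::real in at_top. (ln T)\<^sup>2 \<le> sqrt T" "\<forall>\<^sub>F T::real in at_top. 1 \<le> ln T"
    using sqrt_at_top by (simp add: filterlim_at_top) real_asymp+
  show ?thesis
  proof (rule that[OF C(3)])
    show "\<forall>\<^sub>F T in at_top. \<forall>y. 0 \<le> y \<longrightarrow> y \<le> T \<longrightarrow> \<bar>riesz (y + d) - \<kappa> * y\<^sup>2 / ln T\<bar> \<le> C * riesz_error T y"
      using evs eventually_gt_at_top[of 1]
    proof (eventually_elim, intro allI impI)
      fix T y :: real
      assume T: "x0 \<le> sqrt T" "(ln T)\<^sup>2 \<le> sqrt (sqrt T)" "(ln T)\<^sup>2 \<le> sqrt T" "1 \<le> ln T" "1 < T"
        and y: "0 \<le> y" "y \<le> T"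
      note weaken = mult_right_mono[OF _ riesz_error_nonneg[of y T]]
      show "\<bar>riesz (y + d) - \<kappa> * y\<^sup>2 / ln T\<bar> \<le> C * riesz_error T y"
      proof (cases "y \<le> sqrt T")
        case True
        then show ?thesis
          using riesz_shift_approx_small[of y T d] weaken[OF C(1)] T y d by simp
      next
        case False
        then show ?thesis
          using riesz_shift_approx_large[of T y d K] weaken[OF C(2)] x0[of y] T y d K(1) by simp
      qed
    qed
  qed
qed

theorem dual_asymp:
  assumes d: "0 \<le> d" "d \<le> 1"
  shows "(\<lambda>T. dual d T - \<kappa> * gain_sq_sum * (T\<^sup>2 / ln T)) \<in> O(\<lambda>T. T\<^sup>2 / (ln T)\<^sup>2)"
proof -
  obtain C where C: "C > 0"
    "\<forall>\<^sub>F T in at_top. \<forall>y. 0 \<le> y \<longrightarrow> y \<le> T \<longrightarrow> \<bar>riesz (y + d) - \<kappa> * y\<^sup>2 / ln T\<bar> \<le> C * riesz_error T y"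
    using riesz_shift_approx[OF d] .
  show ?thesis
  proof (rule bigoI)
    show "\<forall>\<^sub>F T in at_top. norm (dual d T - \<kappa> * gain_sq_sum * (T\<^sup>2 / ln T)) \<le>
      (C * gain_three_halves_sum) * norm (T\<^sup>2 / (ln T)\<^sup>2)"
      using C(2) eventually_gt_at_top[of 1]
    proof eventually_elim
      case (elim T)
      let ?main = "\<lambda>l. \<kappa> * (T\<^sup>2 / ln T) * (gain l)\<^sup>2"
      let ?error = "\<lambda>l. C * (T\<^sup>2 / (ln T)\<^sup>2) * (gain l * sqrt (gain l))"
      have termwise: "norm (riesz (T * gain l + d) - ?main l) \<le> ?error l" for l
      proof -
        have "riesz_error T (T * gain l) = T\<^sup>2 / (ln T)\<^sup>2 * (gain l * sqrt (gain l))"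
          using elim(2) by (simp add: riesz_error_def real_sqrt_mult power2_eq_square)
        moreover have "0 \<le> T * gain l" "T * gain l \<le> T"
          using elim(2) gain_pos[of l] gain_le_1[of l] by auto
        ultimately have "\<bar>riesz (T * gain l + d) - \<kappa> * (T * gain l)\<^sup>2 / ln T\<bar> \<le>
            C * (T\<^sup>2 / (ln T)\<^sup>2 * (gain l * sqrt (gain l)))"
          using elim(1) by metis
        then show ?thesis by (simp add: power_mult_distrib mult_ac)
      qed
      have summable: "summable (\<lambda>l. riesz (T * gain l + d))" "summable ?main" "summable ?error"
        using elim(2) d
        by (intro summable_dual summable_mult summable_gain_sq summable_gain_three_halves; simp)+
      have "dual d T - \<kappa> * gain_sq_sum * (T\<^sup>2 / ln T) = (\<Sum>l. riesz (T * gain l + d) - ?main l)"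
        unfolding suminf_diff[OF summable(1,2), symmetric] suminf_mult[OF summable_gain_sq]
        by (simp add: dual_def gain_sq_sum_def)
      also have "norm \<dots> \<le> (\<Sum>l. ?error l)" by (rule norm_suminf_le[OF termwise summable(3)])
      also have "\<dots> = C * gain_three_halves_sum * norm (T\<^sup>2 / (ln T)\<^sup>2)"
        unfolding suminf_mult[OF summable_gain_three_halves] by (simp add: gain_three_halves_sum_def)
      finally show ?case .
    qed
  qed
qed

definition knapsack_value :: "real \<Rightarrow> real" where
  "knapsack_value Y = 2 * sqrt (2 * \<kappa> * gain_sq_sum) * sqrt (Y / ln Y)"

lemma card_segment_lower: "\<forall>\<^sub>F x in at_top. \<kappa> / 2 * (x / ln x) \<le> real (card (segment x))"
proof -
  obtain K where K: "K > 0" "\<forall>\<^sub>F x in at_top. norm (riesz x - \<kappa> * x\<^sup>2 / ln x) \<le> K * norm (x\<^sup>2 / (ln x)\<^sup>2)"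
    using riesz_asymp[OF theta_asymp] by (elim landau_o.bigE)
  have "\<forall>\<^sub>F x::real in at_top. K * (x\<^sup>2 / (ln x)\<^sup>2) \<le> \<kappa> / 2 * (x\<^sup>2 / ln x)" using K(1) kappa_pos by real_asymp
  with K(2) show ?thesis using eventually_gt_at_top[of 1]
  proof eventually_elim
    case (elim x)
    have "x * (\<kappa> / 2 * (x / ln x)) = \<kappa> / 2 * (x\<^sup>2 / ln x)" by (simp add: power2_eq_square)
    also have "\<dots> \<le> riesz x" using elim by (simp add: abs_le_iff)
    also have "\<dots> \<le> x * real (card (segment x))" by (rule riesz_le_mult_card)
    finally show ?case using elim(3) by (simp only: mult_le_cancel_left_pos)
  qed
qed

lemma cost_lower: "\<forall>\<^sub>F T in at_top. T\<^sup>2 / (ln T) ^ 3 \<le> cost T"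
proof -
  have "filterlim (\<lambda>T::real. T * ln 2) at_top at_top" by real_asymp
  from eventually_compose_filterlim[OF card_segment_lower this]
  have "\<forall>\<^sub>F T in at_top. \<kappa> / 2 * (T * ln 2 / ln (T * ln 2)) \<le> real (card (segment (T * ln 2)))" .
  moreover have "\<forall>\<^sub>F T::real in at_top. T\<^sup>2 / (ln T) ^ 3 \<le> (\<kappa> / 2 * (T * ln 2 / ln (T * ln 2)))\<^sup>2 / 4"
    "\<forall>\<^sub>F T::real in at_top. 0 \<le> \<kappa> / 2 * (T * ln 2 / ln (T * ln 2))"
    using kappa_pos by real_asymp+
  ultimately show ?thesis using eventually_gt_at_top[of 1]
  proof eventually_elim
    case (elim T)
    obtain M where M: "T \<le> real M" using real_arch_simple by blast
    have "T\<^sup>2 / (ln T) ^ 3 \<le> (real (card (segment (T * ln 2))))\<^sup>2 / 4"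
      by (rule order.trans[OF elim(2)]) (use elim in \<open>intro divide_right_mono power_mono, auto\<close>)
    also have "\<dots> \<le> segment_sum (T * gain 0)" using segment_sum_ge[of "T * ln 2"] elim(4) by (simp add: gain_def)
    also have "\<dots> \<le> (\<Sum>l<M. segment_sum (T * gain l))"
      using elim(4) M by (intro member_le_sum) (auto simp: segment_sum_nonneg)
    also have "\<dots> = cost T" using elim M by (intro cost_eq_sum[symmetric]) auto
    finally show ?case .
  qed
qed

definition threshold :: "real \<Rightarrow> nat" where
  "threshold Y = (GREATEST T. cost (real T) \<le> Y)"

lemma
  assumes "Y \<ge> 0"
  shows cost_threshold_le: "cost (real (threshold Y)) \<le> Y"
    and less_cost_threshold: "Y < cost (real (threshold Y) + 1)"
proof -
  have "\<forall>\<^sub>F T::real in at_top. T \<le> T\<^sup>2 / (ln T) ^ 3" by real_asymp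
  with cost_lower have "\<forall>\<^sub>F T in at_top. T \<le> cost T" by eventually_elim simp
  then obtain T0 where T0: "\<And>T. T \<ge> T0 \<Longrightarrow> T \<le> cost T" unfolding eventually_at_top_linorder by blast
  have bounded: "T \<le> nat \<lceil>max T0 Y\<rceil>" if "cost (real T) \<le> Y" for T
    using T0[of "real T"] that by linarith
  have "cost (real 0) \<le> Y" using assms by (simp add: cost_def base_nonpos)
  then show "cost (real (threshold Y)) \<le> Y"
    unfolding threshold_def using bounded by (rule GreatestI_nat)
  show "Y < cost (real (threshold Y) + 1)"
  proof (rule ccontr)
    assume "\<not> Y < cost (real (threshold Y) + 1)"
    then have "cost (real (Suc (threshold Y))) \<le> Y" by (simp add: add.commute)
    from Greatest_le_nat[of "\<lambda>T. cost (real T) \<le> Y", OF this bounded]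
    show False by (simp add: threshold_def[symmetric])
  qed
qed

lemma threshold_ge: "\<forall>\<^sub>F Y in at_top. Y powr (1/4) \<le> real (threshold Y)"
proof -
  have "\<forall>\<^sub>F Y in at_top. gain_sq_sum * (Y powr (1/4) + 1)\<^sup>2 \<le> Y"
    using gain_sq_sum_pos by real_asymp
  then show ?thesis using eventually_ge_at_top[of 0]
  proof eventually_elim
    case (elim Y)
    note elim(1)
    also have "Y < cost (real (threshold Y) + 1)" using elim(2) by (rule less_cost_threshold)
    also have "\<dots> \<le> gain_sq_sum * (real (threshold Y) + 1)\<^sup>2" by (intro cost_le) simp
    finally have "(Y powr (1/4) + 1)\<^sup>2 < (real (threshold Y) + 1)\<^sup>2" using gain_sq_sum_pos by simp
    then have "Y powr (1/4) + 1 < real (threshold Y) + 1" by (rule power2_less_imp_less) simp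
    then show ?case by simp
  qed
qed

lemma filterlim_threshold: "filterlim (\<lambda>Y. real (threshold Y)) at_top at_top"
proof (rule filterlim_at_top_mono[OF _ threshold_ge])
  show "filterlim (\<lambda>Y::real. Y powr (1/4)) at_top at_top" by real_asymp
qed

lemma threshold_le: "\<forall>\<^sub>F Y in at_top. real (threshold Y) \<le> sqrt Y * (ln Y)\<^sup>2"
proof -
  have "\<forall>\<^sub>F T::real in at_top. T \<le> T\<^sup>2 / (ln T) ^ 3" by real_asymp
  from eventually_compose_filterlim[OF cost_lower filterlim_threshold]
    eventually_compose_filterlim[OF this filterlim_threshold]
    eventually_compose_filterlim[OF eventually_gt_at_top[of 1] filterlim_threshold]
    eventually_ge_at_top[of "exp 1"]
  show ?thesis
  proof eventually_elim
    case (elim Y)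
    define t where "t = real (threshold Y)"
    have Y: "Y > 0" "ln Y \<ge> 1" using elim(4) by (auto simp: ln_ge_iff less_le_trans[OF exp_gt_zero])
    have cost: "t\<^sup>2 / (ln t) ^ 3 \<le> Y" "t \<le> Y" "ln t > 0"
      using elim cost_threshold_le[of Y] Y by (simp_all add: t_def)
    have "t\<^sup>2 \<le> Y * (ln t) ^ 3" using cost(1,3) by (simp add: pos_divide_le_eq)
    also have "\<dots> \<le> Y * (ln Y) ^ 3" using cost Y elim(3) by (intro mult_left_mono power_mono) (auto simp: t_def)
    also have "\<dots> \<le> Y * (ln Y) ^ 4" using Y by (intro mult_left_mono power_increasing) auto
    also have "\<dots> = (sqrt Y * (ln Y)\<^sup>2)\<^sup>2" using Y by (simp add: power_mult_distrib power_mult[symmetric])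
    finally show ?case unfolding t_def by (rule power2_le_imp_le) (use Y in simp)
  qed
qed

end

lemma lagrange_bound_asymp:
  fixes s C :: real
  assumes "s > 0" "C > 0"
  shows "(\<lambda>Y. s * sqrt (Y / ln Y) + s / 2 * (sqrt (Y * ln Y) / ln (sqrt (Y * ln Y) / s)) +
    C * (sqrt (Y * ln Y) / (ln (sqrt (Y * ln Y) / s))\<^sup>2) - 2 * s * sqrt (Y / ln Y)) \<in> O(knapsack_error)"
  using assms unfolding knapsack_error_def[abs_def] by real_asymp

lemma greedy_bound_asymp:
  fixes s K :: real
  assumes "s > 0"
  shows "(\<lambda>Y. 2 * s * sqrt (Y / ln Y) - (1 - K / ln Y) * (2 * s * sqrt (Y / (ln Y + 4 * ln (ln Y))))) \<in> O(knapsack_error)"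
  using assms unfolding knapsack_error_def[abs_def] by real_asymp

lemma knapsack_error_nonneg: "\<forall>\<^sub>F Y in at_top. knapsack_error Y \<ge> 0"
  unfolding knapsack_error_def by real_asymp

context dense_price_set
begin

text \<open>The multiplier balancing the two terms of the Lagrangian bound is \<open>T = sqrt (Y ln Y) / s\<close>.\<close>

lemma lagrange_bound:
  obtains T K where "\<forall>\<^sub>F Y in at_top. T Y > 0"
    "\<forall>\<^sub>F Y in at_top. (Y + dual 1 (T Y)) / T Y \<le> knapsack_value Y + K * knapsack_error Y"
proof -
  define s where "s = sqrt (2 * \<kappa> * gain_sq_sum)"
  have s: "s > 0" "\<kappa> * gain_sq_sum = s\<^sup>2 / 2" using kappa_pos gain_sq_sum_pos by (auto simp: s_def)
  define T where "T = (\<lambda>Y. sqrt (Y * ln Y) / s)"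
  have T_at_top: "filterlim T at_top at_top" unfolding T_def using s(1) by real_asymp
  have T_eqs: "Y / T Y = s * sqrt (Y / ln Y)" "s\<^sup>2 / 2 * T Y = s / 2 * sqrt (Y * ln Y)"
    "C * T Y = C / s * sqrt (Y * ln Y)" if "Y > 1" for C Y
    using s(1) that
    by (simp_all add: T_def power2_eq_square real_sqrt_mult real_sqrt_divide field_simps)
  obtain C where C: "C > 0"
    "\<forall>\<^sub>F T in at_top. norm (dual 1 T - s\<^sup>2 / 2 * (T\<^sup>2 / ln T)) \<le> C * norm (T\<^sup>2 / (ln T)\<^sup>2)"
    using dual_asymp[of 1] unfolding s(2) by (auto elim!: landau_o.bigE)
  let ?bound = "\<lambda>Y. s * sqrt (Y / ln Y) + s / 2 * (sqrt (Y * ln Y) / ln (T Y)) + C / s * (sqrt (Y * ln Y) / (ln (T Y))\<^sup>2)"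
  have "(\<lambda>Y. ?bound Y - 2 * s * sqrt (Y / ln Y)) \<in> O(knapsack_error)"
    unfolding T_def using s(1) C(1) by (intro lagrange_bound_asymp) auto
  then obtain K where K: "\<forall>\<^sub>F Y in at_top. norm (?bound Y - 2 * s * sqrt (Y / ln Y)) \<le> K * norm (knapsack_error Y)"
    by (elim landau_o.bigE)
  show ?thesis
  proof (rule that)
    show T_pos: "\<forall>\<^sub>F Y in at_top. T Y > 0" using T_at_top by (simp add: filterlim_at_top_dense)
    show "\<forall>\<^sub>F Y in at_top. (Y + dual 1 (T Y)) / T Y \<le> knapsack_value Y + K * knapsack_error Y"
      using eventually_compose_filterlim[OF C(2) T_at_top] K knapsack_error_nonneg T_pos eventually_gt_at_top[of 1]
    proof eventually_elim
      case (elim Y)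
      have "(Y + dual 1 (T Y)) / T Y \<le> (Y + (s\<^sup>2 / 2 * ((T Y)\<^sup>2 / ln (T Y)) + C * ((T Y)\<^sup>2 / (ln (T Y))\<^sup>2))) / T Y"
        using elim(1,4) by (intro divide_right_mono add_left_mono) (auto simp: abs_le_iff)
      also have "\<dots> = Y / T Y + s\<^sup>2 / 2 * (T Y / ln (T Y)) + C * (T Y / (ln (T Y))\<^sup>2)"
        using elim(4) by (simp add: add_divide_distrib power2_eq_square)
      also have "\<dots> = ?bound Y"
        using T_eqs[OF elim(5)] by (simp only: times_divide_eq_right)
      also have "\<dots> \<le> knapsack_value Y + K * knapsack_error Y"
        using elim(2,3) by (simp add: knapsack_value_def s_def)
      finally show ?case .
    qed
  qed
qed

theorem knapsack_upper:
  obtains K where "\<forall>\<^sub>F Y in at_top. \<forall>A b. finite A \<longrightarrow> A \<subseteq> P \<longrightarrow> (\<Sum>q\<in>A. real (b q) * (real q - 1)) \<le> Y \<longrightarrow>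
    (\<Sum>q\<in>A. ln (real (b q) + 1)) \<le> knapsack_value Y + K * knapsack_error Y"
proof -
  obtain T K where ev: "\<forall>\<^sub>F Y in at_top. T Y > 0"
    "\<forall>\<^sub>F Y in at_top. (Y + dual 1 (T Y)) / T Y \<le> knapsack_value Y + K * knapsack_error Y"
    by (rule lagrange_bound)
  show ?thesis
  proof (rule that)
    show "\<forall>\<^sub>F Y in at_top. \<forall>A b. finite A \<longrightarrow> A \<subseteq> P \<longrightarrow> (\<Sum>q\<in>A. real (b q) * (real q - 1)) \<le> Y \<longrightarrow>
      (\<Sum>q\<in>A. ln (real (b q) + 1)) \<le> knapsack_value Y + K * knapsack_error Y"
      using ev
    proof (eventually_elim, intro allI impI)
      fix Y A and b :: "nat \<Rightarrow> nat"
      assume Y: "0 < T Y" "(Y + dual 1 (T Y)) / T Y \<le> knapsack_value Y + K * knapsack_error Y"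
        and A: "finite A" "A \<subseteq> P" "(\<Sum>q\<in>A. real (b q) * (real q - 1)) \<le> Y"
      have "(\<Sum>q\<in>A. ln (real (b q) + 1)) \<le> ((\<Sum>q\<in>A. real (b q) * (real q - 1)) + dual 1 (T Y)) / T Y"
        using A Y(1) by (intro weak_duality) auto
      also have "\<dots> \<le> (Y + dual 1 (T Y)) / T Y" using A Y by (intro divide_right_mono) auto
      finally show "(\<Sum>q\<in>A. ln (real (b q) + 1)) \<le> knapsack_value Y + K * knapsack_error Y" using Y(2) by simp
    qed
  qed
qed

lemma dual_add_cost_lower:
  obtains C where "C > 0"
    "\<forall>\<^sub>F T in at_top. \<kappa> * gain_sq_sum * (T\<^sup>2 / ln T) - C * (T\<^sup>2 / (ln T)\<^sup>2) + cost (T + 1) \<le> dual 0 T + cost T"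
proof -
  obtain C where C: "C > 0"
    "\<forall>\<^sub>F T in at_top. norm (dual 0 T - \<kappa> * gain_sq_sum * (T\<^sup>2 / ln T)) \<le> C * norm (T\<^sup>2 / (ln T)\<^sup>2)"
    using dual_asymp[of 0] by (auto elim!: landau_o.bigE)
  have step: "\<forall>\<^sub>F T::real in at_top. gain_three_halves_sum * ((T + 1) * sqrt (T + 1)) \<le> T\<^sup>2 / (ln T)\<^sup>2" by real_asymp
  show ?thesis
  proof (rule that[of "C + 1"])
    show "\<forall>\<^sub>F T in at_top. \<kappa> * gain_sq_sum * (T\<^sup>2 / ln T) - (C + 1) * (T\<^sup>2 / (ln T)\<^sup>2) + cost (T + 1) \<le> dual 0 T + cost T"
      using C(2) step eventually_ge_at_top[of 0]
    proof eventually_elim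
      case (elim T)
      have "cost (T + 1) \<le> cost T + T\<^sup>2 / (ln T)\<^sup>2" using cost_step[OF elim(3)] elim(2) by simp
      then show ?case using elim(1) by (simp add: abs_le_iff distrib_right add_divide_distrib)
    qed
  qed (use C(1) in simp)
qed

lemma balanced_value_ge:
  fixes a C G L M Y t :: real
  assumes "a > 0" "C > 0" "Y > 0" "t > 0"
    and l: "0 < l" "l \<le> L" "M \<le> 4 * l" "M > 0" "4 * C / a \<le> M"
    and G: "a * (t\<^sup>2 / l) - C * (t\<^sup>2 / l\<^sup>2) + Y \<le> t * G"
  shows "(1 - 4 * C / a / M) * (2 * sqrt (a * Y / L)) \<le> G"
proof -
  define \<eta> where "\<eta> = 4 * C / a / M"
  have eta: "0 \<le> \<eta>" "\<eta> \<le> 1" using assms by (auto simp: \<eta>_def field_simps)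
  have "C / l = C * (1 / l)" by simp
  also have "\<dots> \<le> C * (4 / M)" using l assms(2) by (intro mult_left_mono) (auto simp: field_simps)
  also have "\<dots> = \<eta> * a" using assms(1) by (simp add: \<eta>_def)
  finally have "C / l * (t\<^sup>2 / l) \<le> \<eta> * a * (t\<^sup>2 / l)" using l(1) by (intro mult_right_mono) auto
  then have error: "C * (t\<^sup>2 / l\<^sup>2) \<le> \<eta> * (a * (t\<^sup>2 / l))" by (simp add: power2_eq_square)
  have "2 * (t * sqrt a / sqrt L) * sqrt Y \<le> (t * sqrt a / sqrt L)\<^sup>2 + (sqrt Y)\<^sup>2"
    by (rule sum_squares_bound)
  then have "t * (2 * sqrt (a * Y / L)) \<le> a * (t\<^sup>2 / L) + Y"
    using assms by (simp add: power_mult_distrib power_divide real_sqrt_mult real_sqrt_divide mult_ac)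
  also have "\<dots> \<le> a * (t\<^sup>2 / l) + Y"
    using assms by (intro add_right_mono mult_left_mono divide_left_mono) auto
  finally have "(1 - \<eta>) * (t * (2 * sqrt (a * Y / L))) \<le> (1 - \<eta>) * (a * (t\<^sup>2 / l) + Y)"
    using eta by (intro mult_left_mono) auto
  also have "\<dots> \<le> t * G"
    using error G mult_nonneg_nonneg[OF eta(1), of Y] assms(3) unfolding left_diff_distrib distrib_left mult_1_left
    by linarith
  finally have "t * ((1 - \<eta>) * (2 * sqrt (a * Y / L))) \<le> t * G" by (simp only: mult_ac)
  then show ?thesis using \<open>t > 0\<close> unfolding \<eta>_def by simp
qed

lemma
  shows ln_threshold_ge: "\<forall>\<^sub>F Y in at_top. ln Y \<le> 4 * ln (real (threshold Y))"
    and ln_threshold_le: "\<forall>\<^sub>F Y in at_top. ln (real (threshold Y)) \<le> (ln Y + 4 * ln (ln Y)) / 2"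
proof -
  show "\<forall>\<^sub>F Y in at_top. ln Y \<le> 4 * ln (real (threshold Y))"
    using threshold_ge eventually_gt_at_top[of 0]
  proof eventually_elim
    case (elim Y)
    have "ln (Y powr (1/4)) \<le> ln (real (threshold Y))" using elim by (intro ln_mono) auto
    then show ?case using elim(2) by (simp add: ln_powr)
  qed
  have "\<forall>\<^sub>F Y::real in at_top. 1 < ln Y" by real_asymp
  with threshold_le eventually_compose_filterlim[OF eventually_gt_at_top[of 0] filterlim_threshold]
    eventually_gt_at_top[of 1]
  show "\<forall>\<^sub>F Y in at_top. ln (real (threshold Y)) \<le> (ln Y + 4 * ln (ln Y)) / 2"
  proof eventually_elim
    case (elim Y)
    have "ln (real (threshold Y)) \<le> ln (sqrt Y * (ln Y)\<^sup>2)" using elim(1,2) by (intro ln_mono)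
    also have "\<dots> = (ln Y + 4 * ln (ln Y)) / 2" using elim(3,4) by (simp add: ln_mult ln_sqrt ln_realpow)
    finally show ?case .
  qed
qed

lemma greedy_value_lower:
  obtains K where "\<forall>\<^sub>F Y in at_top. knapsack_value Y - K * knapsack_error Y \<le>
    (\<Sum>q\<in>base (threshold Y). ln (real (copies (threshold Y) q) + 1))"
proof -
  let ?gain = "\<lambda>Y. \<Sum>q\<in>base (threshold Y). ln (real (copies (threshold Y) q) + 1)"
  define a where "a = \<kappa> * gain_sq_sum"
  have a: "a > 0" using kappa_pos gain_sq_sum_pos by (simp add: a_def)
  obtain C where C: "C > 0"
    "\<forall>\<^sub>F T in at_top. a * (T\<^sup>2 / ln T) - C * (T\<^sup>2 / (ln T)\<^sup>2) + cost (T + 1) \<le> dual 0 T + cost T"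
    using dual_add_cost_lower unfolding a_def .
  define \<eta> where "\<eta> = 4 * C / a"
  let ?bound = "\<lambda>Y. (1 - \<eta> / ln Y) * (2 * sqrt (2 * a) * sqrt (Y / (ln Y + 4 * ln (ln Y))))"
  have "(\<lambda>Y. 2 * sqrt (2 * a) * sqrt (Y / ln Y) - ?bound Y) \<in> O(knapsack_error)"
    using a by (intro greedy_bound_asymp) simp
  then obtain K where K: "\<forall>\<^sub>F Y in at_top. norm (2 * sqrt (2 * a) * sqrt (Y / ln Y) - ?bound Y) \<le> K * norm (knapsack_error Y)"
    by (elim landau_o.bigE)
  have logs: "\<forall>\<^sub>F Y::real in at_top. \<eta> \<le> ln Y" "\<forall>\<^sub>F Y::real in at_top. 1 < ln Y" by real_asymp+
  show ?thesis
  proof (rule that)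
    show "\<forall>\<^sub>F Y in at_top. knapsack_value Y - K * knapsack_error Y \<le> ?gain Y"
      using eventually_compose_filterlim[OF C(2) filterlim_threshold] ln_threshold_ge ln_threshold_le K
        knapsack_error_nonneg logs eventually_gt_at_top[of 1]
        eventually_compose_filterlim[OF eventually_gt_at_top[of 1] filterlim_threshold]
    proof eventually_elim
      case (elim Y)
      define t where "t = real (threshold Y)"
      have t_gt_1: "t > 1" using elim(9) by (simp only: t_def)
      have "t * ?gain Y = dual 0 t + cost t" using greedy_value[of t] t_gt_1 by (simp add: t_def)
      then have "a * (t\<^sup>2 / ln t) - C * (t\<^sup>2 / (ln t)\<^sup>2) + Y \<le> t * ?gain Y"
        using elim(1,8) less_cost_threshold[of Y] by (simp add: t_def)
      from balanced_value_ge[OF a C(1) _ _ _ elim(3,2)[folded t_def] _ _ this]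
      have "(1 - \<eta> / ln Y) * (2 * sqrt (a * Y / ((ln Y + 4 * ln (ln Y)) / 2))) \<le> ?gain Y"
        using elim(6-8) t_gt_1 by (simp add: \<eta>_def)
      also have "sqrt (a * Y / ((ln Y + 4 * ln (ln Y)) / 2)) = sqrt (2 * a) * sqrt (Y / (ln Y + 4 * ln (ln Y)))"
        unfolding real_sqrt_mult[symmetric] by (simp add: mult_ac)
      finally have "?bound Y \<le> ?gain Y" by (simp add: mult.assoc)
      moreover have "knapsack_value Y - ?bound Y \<le> K * knapsack_error Y"
        using elim(4,5) by (simp add: knapsack_value_def a_def mult.assoc abs_le_iff)
      ultimately show ?case by linarith
    qed
  qed
qed

theorem knapsack_lower:
  obtains K where "\<forall>\<^sub>F Y in at_top. \<exists>B b. finite B \<and> B \<subseteq> P \<and>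
    (\<Sum>q\<in>B. real (b q) * real q) \<le> Y \<and> (\<Sum>q\<in>B. real (b q)) \<le> sqrt Y * (ln Y) ^ 4 \<and>
    knapsack_value Y - K * knapsack_error Y \<le> (\<Sum>q\<in>B. ln (real (b q) + 1))"
proof -
  obtain K where K: "\<forall>\<^sub>F Y in at_top. knapsack_value Y - K * knapsack_error Y \<le>
    (\<Sum>q\<in>base (threshold Y). ln (real (copies (threshold Y) q) + 1))"
    by (rule greedy_value_lower)
  have ln_bound: "\<forall>\<^sub>F Y::real in at_top. ln (sqrt Y * (ln Y)\<^sup>2 + 1) \<le> (ln Y)\<^sup>2" by real_asymp
  show ?thesis
  proof (rule that)
    show "\<forall>\<^sub>F Y in at_top. \<exists>B b. finite B \<and> B \<subseteq> P \<and>
      (\<Sum>q\<in>B. real (b q) * real q) \<le> Y \<and> (\<Sum>q\<in>B. real (b q)) \<le> sqrt Y * (ln Y) ^ 4 \<and>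
      knapsack_value Y - K * knapsack_error Y \<le> (\<Sum>q\<in>B. ln (real (b q) + 1))"
      using K ln_bound threshold_le
        eventually_compose_filterlim[OF eventually_gt_at_top[of 0] filterlim_threshold] eventually_ge_at_top[of 0]
    proof (eventually_elim, intro exI conjI)
      fix Y
      assume Y: "ln (sqrt Y * (ln Y)\<^sup>2 + 1) \<le> (ln Y)\<^sup>2" "real (threshold Y) \<le> sqrt Y * (ln Y)\<^sup>2"
        "0 < real (threshold Y)" "0 \<le> Y"

      show "(\<Sum>q\<in>base (threshold Y). real (copies (threshold Y) q) * real q) \<le> Y"
        using cost_threshold_le[OF Y(4)] by (simp add: cost_def)
      have "(\<Sum>q\<in>base (threshold Y). real (copies (threshold Y) q)) \<le> real (threshold Y) * ln (real (threshold Y) + 1)"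
        using Y(3) by (intro sum_copies_le) simp
      also have "\<dots> \<le> sqrt Y * (ln Y)\<^sup>2 * (ln Y)\<^sup>2"
      proof (rule mult_mono[OF Y(2)])
        have "ln (real (threshold Y) + 1) \<le> ln (sqrt Y * (ln Y)\<^sup>2 + 1)" using Y(2,3) by simp
        then show "ln (real (threshold Y) + 1) \<le> (ln Y)\<^sup>2" using Y(1) by linarith
      qed (use Y in auto)
      finally show "(\<Sum>q\<in>base (threshold Y). real (copies (threshold Y) q)) \<le> sqrt Y * (ln Y) ^ 4"
        by (simp add: mult.assoc power_add[symmetric])
    qed (auto simp: base_subset)
  qed
qed

end

section \<open>Primes congruent to 1 modulo 4\<close>

interpretation split: price_set primes_1mod4
  by unfold_locales (use primes_1mod4_gt_2 in force)

definition higher_prime_powers :: "real \<Rightarrow> nat set" where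
  "higher_prime_powers x = {n \<in> {1..nat \<lfloor>x\<rfloor>}. primepow n \<and> \<not> prime n}"

lemma finite_higher_prime_powers [simp]: "finite (higher_prime_powers x)"
  by (simp add: higher_prime_powers_def)

lemma higher_prime_powers_subset:
  assumes "x \<ge> 1"
  shows "higher_prime_powers x \<subseteq> (\<lambda>(p, k). p ^ k) ` ({1..nat \<lfloor>sqrt x\<rfloor>} \<times> {1..nat \<lfloor>log 2 x\<rfloor>})"
proof
  fix n assume n: "n \<in> higher_prime_powers x"
  then obtain p k where pk: "prime p" "k > 0" "n = p ^ k" by (auto simp: higher_prime_powers_def primepow_def)
  have p_ge_2: "p \<ge> 2" using pk(1) by (rule prime_ge_2_nat)
  have "k \<noteq> 1" using n pk by (auto simp: higher_prime_powers_def)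
  then have k_ge_2: "k \<ge> 2" using pk(2) by simp
  have "n \<le> nat \<lfloor>x\<rfloor>" using n by (simp add: higher_prime_powers_def)
  then have "real n \<le> x" using assms by (simp add: le_nat_iff le_floor_iff)
  then have n_le: "real p ^ k \<le> x" by (simp add: pk(3))
  have "(real p)\<^sup>2 \<le> real p ^ k" using p_ge_2 k_ge_2 by (intro power_increasing) auto
  then have "real p \<le> sqrt x" using n_le by (intro real_le_rsqrt) simp
  moreover have "(2::real) ^ k \<le> real p ^ k" using p_ge_2 by (intro power_mono) auto
  then have "real k \<le> log 2 x" using n_le assms by (simp add: le_log_iff powr_realpow)
  ultimately show "n \<in> (\<lambda>(p, k). p ^ k) ` ({1..nat \<lfloor>sqrt x\<rfloor>} \<times> {1..nat \<lfloor>log 2 x\<rfloor>})"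
    using pk(2,3) p_ge_2 by (auto simp: le_nat_floor intro!: image_eqI[of _ _ "(p, k)"])
qed

lemma card_higher_prime_powers_le:
  assumes "x \<ge> 1"
  shows "real (card (higher_prime_powers x)) \<le> sqrt x * log 2 x"
proof -
  have "card (higher_prime_powers x) \<le> card ({1..nat \<lfloor>sqrt x\<rfloor>} \<times> {1..nat \<lfloor>log 2 x\<rfloor>})"
    by (rule surj_card_le[OF _ higher_prime_powers_subset[OF assms]]) simp
  then have "real (card (higher_prime_powers x)) \<le> real (nat \<lfloor>sqrt x\<rfloor>) * real (nat \<lfloor>log 2 x\<rfloor>)"
    by (simp flip: of_nat_mult)
  also have "\<dots> \<le> sqrt x * log 2 x" using assms by (intro mult_mono of_nat_floor) auto
  finally show ?thesis .
qed

lemma dedekind_mangoldt_le: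
  assumes "n > 0"
  shows "dedekind_mangoldt n \<le> 2 * ln (real n)"
  unfolding dedekind_mangoldt_def
  using mangoldt_le[OF assms] mangoldt_nonneg[of n] by (intro mult_mono) (auto simp: chi4_def)

lemma dedekind_mangoldt_prime:
  assumes "prime p"
  shows "dedekind_mangoldt p = (if p \<in> primes_1mod4 then 2 * ln (real p) else if p = 2 then ln 2 else 0)"
proof -
  have "p mod 4 = 3" if "p \<notin> primes_1mod4" "p \<noteq> 2"
    using prime_mod_4_cases[OF assms] that assms by (auto simp: primes_1mod4_def)
  then show ?thesis using assms by (auto simp: dedekind_mangoldt_def primes_1mod4_def chi4_def)
qed

lemma dedekind_mangoldt_eq_0:
  assumes "n \<in> {1..nat \<lfloor>x\<rfloor>}" "n \<notin> split.segment x" "n \<notin> insert 2 (higher_prime_powers x)"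
  shows "dedekind_mangoldt n = 0"
proof (cases "prime n")
  case True
  have "real n \<le> x" using assms(1) by simp linarith
  then show ?thesis using True assms(2,3) by (auto simp: split.segment_def dedekind_mangoldt_prime)
next
  case False
  then have "\<not> primepow n" using assms(1,3) by (auto simp: higher_prime_powers_def)
  then show ?thesis by (simp add: dedekind_mangoldt_def mangoldt_def)
qed

lemma cesaro_dedekind_mangoldt_minus_theta:
  assumes "x \<ge> 2"
  shows "\<bar>(\<Sum>n\<in>{1..nat \<lfloor>x\<rfloor>}. dedekind_mangoldt n * (1 - real n / x)) - 2 * split.theta x\<bar> \<le>
    2 * ln x * (sqrt x * log 2 x + 1)"
proof -
  define N where "N = {1..nat \<lfloor>x\<rfloor>}"
  define E where "E = N \<inter> insert 2 (higher_prime_powers x) - split.segment x"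
  let ?f = "\<lambda>n. dedekind_mangoldt n * (1 - real n / x)"
  have N: "real n \<le> x" "n > 0" if "n \<in> N" for n
    using that assms by (auto simp: N_def le_nat_iff le_floor_iff)
  have "(\<Sum>n\<in>N. ?f n) = (\<Sum>n\<in>split.segment x \<union> E. ?f n)"
    using split.segment_subset by (intro sum.mono_neutral_right) (auto simp: N_def E_def dedekind_mangoldt_eq_0[of _ x])
  also have "\<dots> = (\<Sum>n\<in>split.segment x. ?f n) + (\<Sum>n\<in>E. ?f n)"
    by (rule sum.union_disjoint) (auto simp: E_def N_def)
  also have "(\<Sum>n\<in>split.segment x. ?f n) = 2 * split.theta x"
    unfolding split.theta_def sum_distrib_left
    by (intro sum.cong) (auto simp: split.segment_def dedekind_mangoldt_prime primes_1mod4_prime)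
  finally have "(\<Sum>n\<in>N. ?f n) - 2 * split.theta x = (\<Sum>n\<in>E. ?f n)" by simp
  also have "\<bar>\<dots>\<bar> \<le> (\<Sum>n\<in>E. 2 * ln x)"
  proof (rule order.trans[OF sum_abs sum_mono])
    fix n assume "n \<in> E"
    then have n: "real n \<le> x" "n > 0" using N by (auto simp: E_def)
    then have "dedekind_mangoldt n \<le> 2 * ln x" using dedekind_mangoldt_le[of n] by (simp add: order.trans)
    moreover have "0 \<le> 1 - real n / x" "1 - real n / x \<le> 1" using n by (auto simp: field_simps)
    ultimately have "?f n \<le> 2 * ln x * 1"
      using assms dedekind_mangoldt_nonneg[of n] by (intro mult_mono) auto
    then show "\<bar>?f n\<bar> \<le> 2 * ln x"
      using dedekind_mangoldt_nonneg[of n] \<open>0 \<le> 1 - real n / x\<close> by simp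
  qed
  also have "\<dots> = 2 * ln x * real (card E)" by simp
  also have "\<dots> \<le> 2 * ln x * (sqrt x * log 2 x + 1)"
  proof (rule mult_left_mono)
    have "card E \<le> card (insert 2 (higher_prime_powers x))" by (intro card_mono) (auto simp: E_def)
    also have "\<dots> \<le> card (higher_prime_powers x) + 1" by (simp add: card_insert_if)
    finally show "real (card E) \<le> sqrt x * log 2 x + 1"
      using card_higher_prime_powers_le[of x] assms by linarith
  qed (use assms in auto)
  finally show ?thesis unfolding N_def .
qed

lemma cesaro_one:
  assumes "x \<ge> 1"
  shows "\<bar>(\<Sum>n\<in>{1..nat \<lfloor>x\<rfloor>}. 1 - real n / x) - x / 2\<bar> \<le> 1"
proof -
  define m where "m = nat \<lfloor>x\<rfloor>"
  define d where "d = x - real m"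
  have d: "0 \<le> d" "d < 1" using assms unfolding d_def m_def by linarith+
  have gauss: "(\<Sum>n\<in>{1..m}. real n) = real m * (real m + 1) / 2"
    by (induction m) (auto simp: field_simps)
  have "(\<Sum>n\<in>{1..m}. 1 - real n / x) = real m - (\<Sum>n\<in>{1..m}. real n) / x"
    by (simp add: sum_subtractf flip: sum_divide_distrib)
  also have "\<dots> = real m - real m * (real m + 1) / (2 * x)" unfolding gauss by simp
  also have "\<dots> = x / 2 + (d - d\<^sup>2 - x) / (2 * x)"
    using assms unfolding d_def by (simp add: field_simps power2_eq_square)
  finally have deviation: "(\<Sum>n\<in>{1..m}. 1 - real n / x) - x / 2 = (d - d\<^sup>2 - x) / (2 * x)" by simp
  have "\<bar>d - d\<^sup>2 - x\<bar> \<le> 2 * x"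
    using d assms power_le_one[OF d(1), of 2] zero_le_power2[of d] by linarith
  then show ?thesis unfolding m_def[symmetric] deviation using assms by (simp add: abs_divide divide_simps)
qed

theorem split_theta_asymp: "(\<lambda>x. split.theta x - 1/4 * x) \<in> O(\<lambda>x. x / ln x)"
proof -
  define M where "M = (\<lambda>x. \<Sum>n\<in>{1..nat \<lfloor>x\<rfloor>}. dedekind_mangoldt n * (1 - real n / x))"
  define U where "U = (\<lambda>x. \<Sum>n\<in>{1..nat \<lfloor>x\<rfloor>}. 1 - real n / x)"
  have centered: "(\<lambda>x. M x - U x) \<in> O(\<lambda>x. x / ln x)"
    using cesaro_sum_bound[OF abs_conv_gt1_centered_mangoldt _ vertical_growth_centered_mangoldt]
    by (simp add: M_def U_def centered_mangoldt_def left_diff_distrib sum_subtractf)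
  have "(\<lambda>x. U x - x / 2) \<in> O(\<lambda>x. 1)"
    using cesaro_one by (intro bigoI[of _ 1] eventually_mono[OF eventually_ge_at_top[of 1]]) (simp add: U_def)
  also have "(\<lambda>x::real. 1::real) \<in> O(\<lambda>x. x / ln x)" by real_asymp
  finally have one: "(\<lambda>x. U x - x / 2) \<in> O(\<lambda>x. x / ln x)" .
  have "(\<lambda>x. M x - 2 * split.theta x) \<in> O(\<lambda>x. 2 * ln x * (sqrt x * log 2 x + 1))"
  proof (intro bigoI[of _ 1] eventually_mono[OF eventually_ge_at_top[of 2]])
    fix x :: real assume "x \<ge> 2"
    from cesaro_dedekind_mangoldt_minus_theta[OF this]
    show "norm (M x - 2 * split.theta x) \<le> 1 * norm (2 * ln x * (sqrt x * log 2 x + 1))" by (simp add: M_def)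
  qed
  also have "(\<lambda>x::real. 2 * ln x * (sqrt x * log 2 x + 1)) \<in> O(\<lambda>x. x / ln x)" by real_asymp
  finally have theta: "(\<lambda>x. M x - 2 * split.theta x) \<in> O(\<lambda>x. x / ln x)" .
  have "(\<lambda>x. (M x - U x) + (U x - x / 2) - (M x - 2 * split.theta x)) \<in> O(\<lambda>x. x / ln x)"
    by (intro sum_in_bigo centered one theta)
  also have "(\<lambda>x. (M x - U x) + (U x - x / 2) - (M x - 2 * split.theta x)) = (\<lambda>x. 2 * (split.theta x - 1/4 * x))"
    by (simp add: fun_eq_iff)
  finally show ?thesis by (rule landau_o.big.cmult_in_iff[THEN iffD1, rotated]) simp
qed

interpretation split: dense_price_set primes_1mod4 "1/4"
  by unfold_locales (simp, rule split_theta_asymp)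

section \<open>The maximal order of the iterated divisor count\<close>

lemma sum_multiplicity_ln_le:
  assumes "k > 0" "finite A" "\<And>q. q \<in> A \<Longrightarrow> prime (q::nat)"
  shows "(\<Sum>q\<in>A. real (multiplicity q k) * ln (real q)) \<le> ln (real k)"
proof -
  have pos: "q > 0" if "q \<in> A" for q using assms(3)[OF that] by (rule prime_gt_0_nat)
  have "(\<Sum>q\<in>A. real (multiplicity q k) * ln (real q)) = ln (\<Prod>q\<in>A. real q ^ multiplicity q k)"
    using pos assms(2) by (simp add: ln_prod ln_realpow)
  also have "(\<Prod>q\<in>A. real q ^ multiplicity q k) = real (\<Prod>q\<in>A. q ^ multiplicity q k)" by simp
  also have "ln \<dots> \<le> ln (real k)"
  proof (rule ln_mono)
    show "real (\<Prod>q\<in>A. q ^ multiplicity q k) \<le> real k"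
      using prod_prime_powers_multiplicity_le[OF assms] by (simp only: of_nat_le_iff)
    show "0 < real (\<Prod>q\<in>A. q ^ multiplicity q k)" using pos by (simp add: prod_pos)
  qed
  finally show ?thesis .
qed

lemma Bernoulli_inequality_prod:
  fixes e :: "nat \<Rightarrow> nat"
  assumes "finite A" "\<And>q. q \<in> A \<Longrightarrow> q \<ge> 1"
  shows "1 + (\<Sum>q\<in>A. real (e q) * (real q - 1)) \<le> real (\<Prod>q\<in>A. q ^ e q)"
  using assms
proof (induction A rule: finite_induct)
  case (insert q A)
  define s where "s = (\<Sum>q\<in>A. real (e q) * (real q - 1))"
  define a where "a = real (e q) * (real q - 1)"
  have nonneg: "s \<ge> 0" "a \<ge> 0" unfolding s_def a_def using insert.prems by (auto intro!: sum_nonneg)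
  have "1 + a \<le> real q ^ e q"
    using Bernoulli_inequality[of "real q - 1" "e q"] insert.prems by (simp add: a_def)
  moreover have "1 + s \<le> real (\<Prod>q\<in>A. q ^ e q)" using insert by (simp add: s_def)
  ultimately have "(1 + a) * (1 + s) \<le> real q ^ e q * real (\<Prod>q\<in>A. q ^ e q)"
    using nonneg by (intro mult_mono) auto
  moreover have "1 + (a + s) \<le> (1 + a) * (1 + s)"
    using mult_nonneg_nonneg[OF nonneg] by (simp add: algebra_simps)
  ultimately show ?case using insert.hyps by (simp add: s_def a_def)
qed simp

lemma sum_multiplicity_minus_one_le:
  assumes "k > 0" "finite A" "\<And>q. q \<in> A \<Longrightarrow> prime (q::nat)"
  shows "(\<Sum>q\<in>A. real (multiplicity q k) * (real q - 1)) \<le> real k - 1"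
proof -
  have "1 + (\<Sum>q\<in>A. real (multiplicity q k) * (real q - 1)) \<le> real (\<Prod>q\<in>A. q ^ multiplicity q k)"
    by (rule Bernoulli_inequality_prod) (use assms prime_ge_1_nat in auto)
  also have "\<dots> \<le> real k"
    using prod_prime_powers_multiplicity_le[OF assms] by (simp only: of_nat_le_iff)
  finally show ?thesis by simp
qed

lemma sum_multiplicity_prod_minus_one_le:
  fixes k :: "'i \<Rightarrow> nat"
  assumes "finite I" "\<And>i. i \<in> I \<Longrightarrow> k i > 0" and A: "finite A" "\<And>q. q \<in> A \<Longrightarrow> prime q"
  shows "(\<Sum>q\<in>A. real (multiplicity q (\<Prod>i\<in>I. k i)) * (real q - 1)) \<le> (\<Sum>i\<in>I. real (k i) - 1)"
proof -
  have "(\<Sum>q\<in>A. real (multiplicity q (\<Prod>i\<in>I. k i)) * (real q - 1)) =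
    (\<Sum>q\<in>A. \<Sum>i\<in>I. real (multiplicity q (k i)) * (real q - 1))"
  proof (rule sum.cong[OF refl])
    fix q assume "q \<in> A"
    moreover have "0 \<notin> k ` I" using assms(2) by force
    ultimately have "multiplicity q (\<Prod>i\<in>I. k i) = (\<Sum>i\<in>I. multiplicity q (k i))"
      using A(2) assms(1) by (intro prime_elem_multiplicity_prod_distrib) auto
    then show "real (multiplicity q (\<Prod>i\<in>I. k i)) * (real q - 1) =
      (\<Sum>i\<in>I. real (multiplicity q (k i)) * (real q - 1))"
      by (simp add: sum_distrib_right)
  qed
  also have "\<dots> = (\<Sum>i\<in>I. \<Sum>q\<in>A. real (multiplicity q (k i)) * (real q - 1))" by (rule sum.swap)
  also have "\<dots> \<le> (\<Sum>i\<in>I. real (k i) - 1)"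
    using assms by (intro sum_mono sum_multiplicity_minus_one_le) auto
  finally show ?thesis .
qed

definition small_count :: "real \<Rightarrow> nat \<Rightarrow> nat" where
  "small_count y n = (\<Prod>p | p \<in> prime_factors n \<inter> primes_1mod4 \<and> real p \<le> y. multiplicity p n + 1)"

definition large_count :: "real \<Rightarrow> nat \<Rightarrow> nat" where
  "large_count y n = (\<Prod>p | p \<in> prime_factors n \<inter> primes_1mod4 \<and> \<not> real p \<le> y. multiplicity p n + 1)"

lemma small_count_pos: "small_count y n > 0"
  unfolding small_count_def by (intro prod_pos) auto

lemma large_count_pos: "large_count y n > 0"
  unfolding large_count_def by (intro prod_pos) auto

lemma split_divisor_count_eq_small_large: "split_divisor_count n = small_count y n * large_count y n"
  unfolding split_divisor_count_def small_count_def large_count_def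
  by (subst prod.union_disjoint[symmetric]) (auto intro!: prod.cong)

lemma multiplicity_le_ln:
  assumes "n > 0" "p \<in> primes_1mod4"
  shows "real (multiplicity p n) \<le> ln (real n)"
proof -
  have "exp 1 \<le> real p" using exp_le primes_1mod4_gt_2[OF assms(2)] by linarith
  then have "1 \<le> ln (real p)" using primes_1mod4_gt_2[OF assms(2)] by (subst ln_ge_iff) auto
  then have "real (multiplicity p n) * 1 \<le> real (multiplicity p n) * ln (real p)" by (intro mult_left_mono) auto
  also have "\<dots> \<le> ln (real n)"
    using sum_multiplicity_ln_le[of n "{p}"] assms primes_1mod4_prime by simp
  finally show ?thesis by simp
qed

lemma ln_small_count_le:
  assumes "n > 0" "y \<ge> 0" "ln (real n) \<le> X"
  shows "ln (real (small_count y n)) \<le> y * ln (X + 1)"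
proof -
  define Q where "Q = {p. p \<in> prime_factors n \<inter> primes_1mod4 \<and> real p \<le> y}"
  have "ln (real (small_count y n)) = (\<Sum>p\<in>Q. ln (real (multiplicity p n) + 1))"
    by (simp add: small_count_def Q_def ln_prod add_pos_nonneg add.commute)
  also have "\<dots> \<le> (\<Sum>p\<in>Q. ln (X + 1))"
    using multiplicity_le_ln[OF assms(1)] assms(3)
    by (intro sum_mono ln_mono) (auto simp: Q_def add_nonneg_pos intro: order.trans)
  also have "\<dots> = real (card Q) * ln (X + 1)" by simp
  also have "\<dots> \<le> y * ln (X + 1)"
  proof (rule mult_right_mono)
    have "card Q \<le> card (split.segment y)" by (intro card_mono split.finite_segment) (auto simp: Q_def split.segment_def)
    then show "real (card Q) \<le> y" using split.card_segment_le[OF assms(2)] by simp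
    have "0 \<le> ln (real n)" using assms(1) by (simp add: Suc_le_eq)
    then show "0 \<le> ln (X + 1)" using assms(3) by (intro ln_ge_zero) linarith
  qed
  finally show ?thesis .
qed

lemma sum_multiplicity_large_count_le:
  assumes n: "n > 0" "ln (real n) \<le> X" and y: "y > 1" and A: "finite A" "\<And>q. q \<in> A \<Longrightarrow> prime q"
  shows "(\<Sum>q\<in>A. real (multiplicity q (large_count y n)) * (real q - 1)) \<le> X / ln y"
proof -
  define Q where "Q = {p. p \<in> prime_factors n \<inter> primes_1mod4 \<and> \<not> real p \<le> y}"
  have "(\<Sum>q\<in>A. real (multiplicity q (large_count y n)) * (real q - 1)) \<le> (\<Sum>p\<in>Q. real (multiplicity p n + 1) - 1)"
    unfolding large_count_def Q_def using A by (intro sum_multiplicity_prod_minus_one_le) auto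
  also have "\<dots> \<le> (\<Sum>p\<in>Q. real (multiplicity p n) * ln (real p) / ln y)"
  proof (rule sum_mono)
    fix p assume "p \<in> Q"
    then have "real (multiplicity p n) * ln y \<le> real (multiplicity p n) * ln (real p)"
      using y by (intro mult_left_mono) (auto simp: Q_def)
    then show "real (multiplicity p n + 1) - 1 \<le> real (multiplicity p n) * ln (real p) / ln y"
      using y by (simp add: field_simps)
  qed
  also have "\<dots> = (\<Sum>p\<in>Q. real (multiplicity p n) * ln (real p)) / ln y" by (simp add: sum_divide_distrib)
  also have "\<dots> \<le> X / ln y"
  proof (rule divide_right_mono)
    have "(\<Sum>p\<in>Q. real (multiplicity p n) * ln (real p)) \<le> ln (real n)"
      using n primes_1mod4_prime by (intro sum_multiplicity_ln_le) (auto simp: Q_def)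
    then show "(\<Sum>p\<in>Q. real (multiplicity p n) * ln (real p)) \<le> X" using n(2) by linarith
  qed (use y in simp)
  finally show ?thesis .
qed

definition ln_delta_delta :: "nat \<Rightarrow> real" where
  "ln_delta_delta n = ln (real_of_rat (delta_delta n))"

lemma ln_delta_delta_eq:
  assumes "n > 0" "delta n = of_nat m" "m > 0" "delta m \<noteq> 0 \<or> prime_factors m \<subseteq> primes_1mod4"
  shows "ln_delta_delta n = ln (real (split_divisor_count m))"
  using delta_eq_split_divisor_count[OF assms(3,4)] assms(2) by (simp add: ln_delta_delta_def delta_delta_def)

lemma ln_delta_delta_le_0:
  assumes "delta n = 0"
  shows "ln_delta_delta n \<le> 0"
proof -
  have "sq_reps 0 = {(0, 0)}" by (auto simp: sum_power2_eq_zero_iff)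
  then have "delta_delta n = 1 / 4" using assms by (simp add: delta_delta_def delta_sq_reps)
  then show ?thesis by (simp add: ln_delta_delta_def of_rat_divide ln_div)
qed

lemma ln_delta_delta_le:
  assumes n: "n > 0" "ln (real n) \<le> X" "delta_delta n > 0" and y: "y > 1"
  obtains A b where "finite A" "A \<subseteq> primes_1mod4"
    "(\<Sum>q\<in>A. real (b q) * (real q - 1)) \<le> X / ln y"
    "ln_delta_delta n \<le> y * ln (X + 1) + (\<Sum>q\<in>A. ln (real (b q) + 1))"
proof (cases "delta n = 0")
  case True
  have "0 \<le> ln (real n)" using n(1) by (simp add: Suc_le_eq)
  then have "0 \<le> X" using n(2) by linarith
  then have "0 \<le> y * ln (X + 1)" using y by (intro mult_nonneg_nonneg ln_ge_zero) auto
  with ln_delta_delta_le_0[OF True] have "ln_delta_delta n \<le> y * ln (X + 1)" by linarith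
  then show ?thesis using \<open>0 \<le> X\<close> y by (intro that[of "{}"]) auto
next
  case False
  define m where "m = split_divisor_count n"
  have delta: "delta n = of_nat m"
    unfolding m_def using n(1) False by (intro delta_eq_split_divisor_count) auto
  define A where "A = prime_factors (large_count y n) \<inter> primes_1mod4"
  define b where "b = (\<lambda>q. multiplicity q (large_count y n))"
  have "split_divisor_count m \<le> split_divisor_count (small_count y n) * split_divisor_count (large_count y n)"
    unfolding m_def split_divisor_count_eq_small_large[of n y]
    by (intro split_divisor_count_mult_le small_count_pos large_count_pos)
  also have "\<dots> \<le> small_count y n * split_divisor_count (large_count y n)"
    by (intro mult_right_mono split_divisor_count_le small_count_pos) simp
  finally have count: "real (split_divisor_count m) \<le> real (small_count y n) * real (split_divisor_count (large_count y n))"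
    by (simp flip: of_nat_mult)
  have "ln_delta_delta n = ln (real (split_divisor_count m))"
    using n delta split_divisor_count_pos[of n]
    by (intro ln_delta_delta_eq) (auto simp: m_def delta_delta_def)
  also have "\<dots> \<le> ln (real (small_count y n)) + ln (real (split_divisor_count (large_count y n)))"
    using ln_mono[OF count] split_divisor_count_pos small_count_pos by (simp add: ln_mult)
  also have "ln (real (small_count y n)) \<le> y * ln (X + 1)"
    using n y by (intro ln_small_count_le) auto
  also have "ln (real (split_divisor_count (large_count y n))) = (\<Sum>q\<in>A. ln (real (b q) + 1))"
    by (simp add: split_divisor_count_def A_def b_def ln_prod add_pos_nonneg add.commute)
  finally show ?thesis
    using sum_multiplicity_large_count_le[OF n(1,2) y, of A]
    by (intro that[of A b]) (auto simp: A_def b_def)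
qed

text \<open>
  Each of the \<open>b q\<close> prime factors \<open>q\<close> of the prescribed value is produced by a separate prime with exponent \<open>q - 1\<close>.
\<close>

lemma exists_split_divisor_count_eq:
  fixes b :: "nat \<Rightarrow> nat"
  assumes B: "finite B" "B \<subseteq> primes_1mod4" and z: "z > 1" "(\<Sum>q\<in>B. b q) \<le> card (split.segment z)"
  obtains n where "n > 0" "prime_factors n \<subseteq> primes_1mod4" "split_divisor_count n = (\<Prod>q\<in>B. q ^ b q)"
    "ln (real n) \<le> (\<Sum>q\<in>B. real (b q) * real q) * ln z"
proof -
  define I where "I = Sigma B (\<lambda>q. {..<b q})"
  have I: "finite I" "card I = (\<Sum>q\<in>B. b q)" using B(1) by (auto simp: I_def)
  obtain A where A: "A \<subseteq> split.segment z" "card A = card I" "finite A"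
    using obtain_subset_with_card_n[of "card I" "split.segment z"] z(2) I(2) by auto
  then obtain g where g: "bij_betw g A I" using finite_same_card_bij[OF _ I(1)] by blast
  have g_pos: "fst (g p) > 0" if "p \<in> A" for p
    using bij_betwE[OF g] that B(2) primes_1mod4_gt_2 by (force simp: I_def)
  have A_split: "A \<subseteq> primes_1mod4" using A(1) by (auto simp: split.segment_def)
  have A_bounds: "real p > 0" "real p \<le> z" if "p \<in> A" for p
    using split.segmentD(2,3)[of p z] A(1) that by auto
  define n where "n = (\<Prod>p\<in>A. p ^ (fst (g p) - 1))"
  show ?thesis
  proof (rule that)
    show "n > 0" unfolding n_def by (rule prod_prime_powers_pos[OF A_split])
    show "prime_factors n \<subseteq> primes_1mod4"
      unfolding n_def by (rule order.trans[OF prime_factors_prod_split_primes[OF A(3) A_split] A_split])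
    have "split_divisor_count n = (\<Prod>p\<in>A. fst (g p) - 1 + 1)"
      unfolding n_def by (rule split_divisor_count_prod_split_primes[OF A(3) A_split])
    also have "\<dots> = (\<Prod>p\<in>A. fst (g p))" using g_pos by (intro prod.cong) force+
    also have "\<dots> = (\<Prod>i\<in>I. fst i)" by (rule prod.reindex_bij_betw[OF g])
    also have "\<dots> = (\<Prod>q\<in>B. \<Prod>l<b q. q)" unfolding I_def using B(1) by (subst prod.Sigma) (auto intro!: prod.cong)
    finally show "split_divisor_count n = (\<Prod>q\<in>B. q ^ b q)" by simp
    have "ln (real n) = (\<Sum>p\<in>A. real (fst (g p) - 1) * ln (real p))"
      using A(3) A_bounds by (simp add: n_def ln_prod ln_realpow)
    also have "\<dots> \<le> (\<Sum>p\<in>A. real (fst (g p)) * ln z)"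
      using A_bounds z(1) by (intro sum_mono mult_mono ln_mono) (auto simp: Suc_le_eq)
    also have "\<dots> = (\<Sum>i\<in>I. real (fst i) * ln z)"
      by (rule sum.reindex_bij_betw[OF g, of "\<lambda>i. real (fst i) * ln z"])
    also have "\<dots> = (\<Sum>q\<in>B. \<Sum>l<b q. real q * ln z)"
      unfolding I_def using B(1) by (subst sum.Sigma) (auto intro!: sum.cong)
    finally show "ln (real n) \<le> (\<Sum>q\<in>B. real (b q) * real q) * ln z"
      by (simp add: sum_distrib_right mult.assoc)
  qed
qed

lemma exists_ln_delta_delta_eq:
  assumes B: "finite B" "B \<subseteq> primes_1mod4" and z: "z > 1"
    and cost: "(\<Sum>q\<in>B. real (b q) * real q) \<le> X / ln z"
    and count: "(\<Sum>q\<in>B. real (b q)) \<le> real (card (split.segment z))"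
  obtains n where "n > 0" "delta_delta n > 0" "ln (real n) \<le> X"
    "ln_delta_delta n = (\<Sum>q\<in>B. ln (real (b q) + 1))"
proof -
  define m where "m = (\<Prod>q\<in>B. q ^ b q)"
  have "(\<Sum>q\<in>B. b q) \<le> card (split.segment z)" using count by (simp flip: of_nat_sum)
  then obtain n where n: "n > 0" "prime_factors n \<subseteq> primes_1mod4" "split_divisor_count n = m"
    and ln_n: "ln (real n) \<le> (\<Sum>q\<in>B. real (b q) * real q) * ln z"
    unfolding m_def by (rule exists_split_divisor_count_eq[OF B z])
  have m: "m > 0" "prime_factors m \<subseteq> primes_1mod4" "split_divisor_count m = (\<Prod>q\<in>B. b q + 1)"
    unfolding m_def using prod_prime_powers_pos[OF B(2)] prime_factors_prod_split_primes[OF B] B(2)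
      split_divisor_count_prod_split_primes[OF B] by blast+
  have delta: "delta n = of_nat m" "delta m = of_nat (split_divisor_count m)"
    using delta_eq_split_divisor_count[of n] delta_eq_split_divisor_count[of m] n m by auto
  have "ln_delta_delta n = ln (real (split_divisor_count m))"
    using n m delta by (intro ln_delta_delta_eq) auto
  also have "\<dots> = (\<Sum>q\<in>B. ln (real (b q) + 1))"
    unfolding m(3) using B(1) by (simp add: ln_prod add_pos_nonneg add.commute)
  finally have attained: "ln_delta_delta n = (\<Sum>q\<in>B. ln (real (b q) + 1))" .
  have "(\<Sum>q\<in>B. real (b q) * real q) * ln z \<le> X" using cost z by (simp add: pos_le_divide_eq)
  then have "ln (real n) \<le> X" using ln_n by linarith
  with attained show ?thesis
    using n(1) delta split_divisor_count_pos[of m] by (intro that) (auto simp: delta_delta_def)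
qed

definition main_term :: "real \<Rightarrow> real" where
  "main_term X = 2 * sqrt gain_sq_sum * (sqrt X / ln X)"

definition error_term :: "real \<Rightarrow> real" where
  "error_term X = sqrt X / ln X * (ln (ln X) / ln X)"

lemma error_term_nonneg: "\<forall>\<^sub>F X in at_top. error_term X \<ge> 0"
  unfolding error_term_def by real_asymp

lemma split_knapsack_value_eq: "split.knapsack_value Y = sqrt gain_sq_sum * sqrt (2 * (Y / ln Y))"
proof -
  have "2 * sqrt (2 * (1/4) * gain_sq_sum) = sqrt gain_sq_sum * sqrt 2"
    by (simp add: real_sqrt_divide field_simps)
  then show ?thesis unfolding split.knapsack_value_def by (simp only: real_sqrt_mult mult.assoc)
qed

lemma ln_delta_delta_upper:
  obtains K where "\<forall>\<^sub>F X in at_top. \<forall>n>0. ln (real n) \<le> X \<longrightarrow> delta_delta n > 0 \<longrightarrow>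
    ln_delta_delta n \<le> main_term X + K * error_term X"
proof -
  define y where "y = (\<lambda>X::real. sqrt X / (ln X) ^ 3)"
  define Y where "Y = (\<lambda>X. X / ln (y X))"
  obtain K where K: "\<forall>\<^sub>F Y in at_top. \<forall>A b. finite A \<longrightarrow> A \<subseteq> primes_1mod4 \<longrightarrow>
    (\<Sum>q\<in>A. real (b q) * (real q - 1)) \<le> Y \<longrightarrow>
    (\<Sum>q\<in>A. ln (real (b q) + 1)) \<le> split.knapsack_value Y + K * knapsack_error Y"
    by (rule split.knapsack_upper)
  let ?bound = "\<lambda>X. y X * ln (X + 1) + (split.knapsack_value (Y X) + K * knapsack_error (Y X))"
  have "(\<lambda>X. ?bound X - main_term X) \<in> O(error_term)"
    unfolding split_knapsack_value_eq Y_def y_def main_term_def[abs_def] error_term_def[abs_def] knapsack_error_def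
    using gain_sq_sum_pos by real_asymp
  then obtain K' where K': "\<forall>\<^sub>F X in at_top. norm (?bound X - main_term X) \<le> K' * norm (error_term X)"
    by (elim landau_o.bigE)
  have limit: "filterlim Y at_top at_top" unfolding Y_def y_def by real_asymp
  have y_gt_1: "\<forall>\<^sub>F X in at_top. y X > 1" unfolding y_def by real_asymp
  show ?thesis
  proof (rule that)
    show "\<forall>\<^sub>F X in at_top. \<forall>n>0. ln (real n) \<le> X \<longrightarrow> delta_delta n > 0 \<longrightarrow>
      ln_delta_delta n \<le> main_term X + K' * error_term X"
      using eventually_compose_filterlim[OF K limit] K' y_gt_1 error_term_nonneg
    proof eventually_elim
      case (elim X)
      show ?case
      proof (intro allI impI)
        fix n assume n: "n > 0" "ln (real n) \<le> X" "delta_delta n > 0"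
        obtain A b where A: "finite A" "A \<subseteq> primes_1mod4"
          "(\<Sum>q\<in>A. real (b q) * (real q - 1)) \<le> Y X"
          and le: "ln_delta_delta n \<le> y X * ln (X + 1) + (\<Sum>q\<in>A. ln (real (b q) + 1))"
          unfolding Y_def by (rule ln_delta_delta_le[OF n elim(3)])
        from A have "(\<Sum>q\<in>A. ln (real (b q) + 1)) \<le> split.knapsack_value (Y X) + K * knapsack_error (Y X)"
          using elim(1) by blast
        with le have "ln_delta_delta n \<le> ?bound X" by linarith
        also have "\<dots> \<le> main_term X + K' * error_term X" using elim(2,4) by (simp add: abs_le_iff)
        finally show "ln_delta_delta n \<le> main_term X + K' * error_term X" .
      qed
    qed
  qed
qed

lemma ln_delta_delta_lower:
  obtains K where "\<forall>\<^sub>F X in at_top. \<exists>n>0. ln (real n) \<le> X \<and> delta_delta n > 0 \<and>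
    main_term X - K * error_term X \<le> ln_delta_delta n"
proof -
  define z where "z = (\<lambda>X::real. sqrt X * (ln X) ^ 5)"
  define Y where "Y = (\<lambda>X. X / ln (z X))"
  obtain K where K: "\<forall>\<^sub>F Y in at_top. \<exists>B b. finite B \<and> B \<subseteq> primes_1mod4 \<and>
    (\<Sum>q\<in>B. real (b q) * real q) \<le> Y \<and> (\<Sum>q\<in>B. real (b q)) \<le> sqrt Y * (ln Y) ^ 4 \<and>
    split.knapsack_value Y - K * knapsack_error Y \<le> (\<Sum>q\<in>B. ln (real (b q) + 1))"
    by (rule split.knapsack_lower)
  let ?bound = "\<lambda>X. split.knapsack_value (Y X) - K * knapsack_error (Y X)"
  have "(\<lambda>X. ?bound X - main_term X) \<in> O(error_term)"
    unfolding split_knapsack_value_eq Y_def z_def main_term_def[abs_def] error_term_def[abs_def] knapsack_error_def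
    using gain_sq_sum_pos by real_asymp
  then obtain K' where K': "\<forall>\<^sub>F X in at_top. norm (?bound X - main_term X) \<le> K' * norm (error_term X)"
    by (elim landau_o.bigE)
  have limits: "filterlim Y at_top at_top" "filterlim z at_top at_top" unfolding Y_def z_def by real_asymp+
  have enough: "\<forall>\<^sub>F X in at_top. sqrt (Y X) * (ln (Y X)) ^ 4 \<le> 1/4 / 2 * (z X / ln (z X))"
    and z_gt_1: "\<forall>\<^sub>F X in at_top. z X > 1" unfolding Y_def z_def by real_asymp+
  show ?thesis
  proof (rule that)
    show "\<forall>\<^sub>F X in at_top. \<exists>n>0. ln (real n) \<le> X \<and> delta_delta n > 0 \<and>
      main_term X - K' * error_term X \<le> ln_delta_delta n"
      using eventually_compose_filterlim[OF K limits(1)] K' enough z_gt_1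
        eventually_compose_filterlim[OF split.card_segment_lower limits(2)] error_term_nonneg
    proof eventually_elim
      case (elim X)
      obtain B b where B: "finite B" "B \<subseteq> primes_1mod4" "(\<Sum>q\<in>B. real (b q) * real q) \<le> Y X"
        "(\<Sum>q\<in>B. real (b q)) \<le> sqrt (Y X) * (ln (Y X)) ^ 4" "?bound X \<le> (\<Sum>q\<in>B. ln (real (b q) + 1))"
        using elim(1) by blast
      have "(\<Sum>q\<in>B. real (b q)) \<le> real (card (split.segment (z X)))" using B(4) elim(3,5) by linarith
      then obtain n where n: "n > 0" "delta_delta n > 0" "ln (real n) \<le> X"
        "ln_delta_delta n = (\<Sum>q\<in>B. ln (real (b q) + 1))"
        using exists_ln_delta_delta_eq[OF B(1,2) elim(4)] B(3) unfolding Y_def by metis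
      moreover have "main_term X - K' * error_term X \<le> ln_delta_delta n"
        using elim(2,6) B(5) n(4) by (simp add: abs_le_iff)
      ultimately show ?case by blast
    qed
  qed
qed

definition max_ln_delta_delta :: "real \<Rightarrow> real" where
  "max_ln_delta_delta x = Max {ln_delta_delta n | n. n \<ge> 1 \<and> real n \<le> x \<and> delta_delta n > 0}"

theorem max_ln_delta_delta_asymp:
  "(\<lambda>x. max_ln_delta_delta x - main_term (ln x)) \<in> O(\<lambda>x. error_term (ln x))"
proof -
  define S where "S = (\<lambda>x. {ln_delta_delta n | n. n > 0 \<and> real n \<le> x \<and> delta_delta n > 0})"
  have finite: "finite (S x)" for x
    by (rule finite_subset[of _ "ln_delta_delta ` {..nat \<lfloor>x\<rfloor>}"]) (auto simp: S_def le_nat_floor)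
  have max_eq: "max_ln_delta_delta x = Max (S x)" for x
    by (simp add: max_ln_delta_delta_def S_def Suc_le_eq)
  obtain K1 where upper: "\<forall>\<^sub>F X in at_top. \<forall>n>0. ln (real n) \<le> X \<longrightarrow> delta_delta n > 0 \<longrightarrow>
    ln_delta_delta n \<le> main_term X + K1 * error_term X"
    by (rule ln_delta_delta_upper)
  obtain K2 where lower: "\<forall>\<^sub>F X in at_top. \<exists>n>0. ln (real n) \<le> X \<and> delta_delta n > 0 \<and>
    main_term X - K2 * error_term X \<le> ln_delta_delta n"
    by (rule ln_delta_delta_lower)
  show ?thesis
  proof (rule bigoI)
    show "\<forall>\<^sub>F x in at_top. norm (max_ln_delta_delta x - main_term (ln x)) \<le> max K1 K2 * norm (error_term (ln x))"
      using upper[THEN eventually_compose_filterlim[OF _ ln_at_top]]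
        lower[THEN eventually_compose_filterlim[OF _ ln_at_top]]
        error_term_nonneg[THEN eventually_compose_filterlim[OF _ ln_at_top]] eventually_gt_at_top[of 0]
    proof eventually_elim
      case (elim x)
      obtain n where "n > 0" "ln (real n) \<le> ln x" "delta_delta n > 0"
        and le: "main_term (ln x) - K2 * error_term (ln x) \<le> ln_delta_delta n"
        using elim(2) by blast
      then have n: "ln_delta_delta n \<in> S x" using elim(4) by (auto simp: S_def)
      then have "Max (S x) \<in> S x" using finite by (intro Max_in) auto
      then have "Max (S x) \<le> main_term (ln x) + K1 * error_term (ln x)"
        using elim(1,4) by (auto simp: S_def)
      moreover have "main_term (ln x) - K2 * error_term (ln x) \<le> Max (S x)"
        using Max_ge[OF finite n] le by linarith
      moreover have "K1 * error_term (ln x) \<le> max K1 K2 * error_term (ln x)"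
        "K2 * error_term (ln x) \<le> max K1 K2 * error_term (ln x)"
        using elim(3) by (auto intro!: mult_right_mono)
      ultimately show ?case using elim(3) by (simp add: max_eq abs_le_iff)
    qed
  qed
qed

theorem theorem2p1:
  fixes c :: real
  assumes "c = sqrt (8 * (\<Sum>l. (ln (1 + 1 / real (Suc l)))\<^sup>2))"
  shows "\<exists>E \<in> O[at_top](\<lambda>x :: real. ln (ln (ln x)) / ln (ln x)).
    \<forall>\<^sub>F x in at_top.
      Max {ln (real_of_rat (delta_delta n)) | n. n \<ge> 1 \<and> real n \<le> x \<and> delta_delta n > 0}
        = sqrt (ln x) / ln (ln x) * (c / sqrt 2 + E x)"
proof -
  define scale where "scale = (\<lambda>x::real. sqrt (ln x) / ln (ln x))"
  define E where "E = (\<lambda>x. max_ln_delta_delta x / scale x - c / sqrt 2)"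
  have "c = sqrt (8 * gain_sq_sum)" using assms by (simp add: gain_sq_sum_def gain_def)
  then have c: "c / sqrt 2 = 2 * sqrt gain_sq_sum"
    using real_sqrt_mult[of 4 gain_sq_sum] by (simp add: real_sqrt_divide[symmetric])
  have scale_pos: "\<forall>\<^sub>F x in at_top. scale x > 0" unfolding scale_def by real_asymp
  have main: "main_term (ln x) = c / sqrt 2 * scale x" for x by (simp add: c main_term_def scale_def)
  have "\<forall>\<^sub>F x in at_top. E x = (max_ln_delta_delta x - main_term (ln x)) * (1 / scale x)"
    using scale_pos by eventually_elim (simp add: E_def main field_simps)
  then have "E \<in> O(\<lambda>x. error_term (ln x) * (1 / scale x))"
    using landau_o.big.mult_right[OF max_ln_delta_delta_asymp] by (rule landau_o.big.in_cong[THEN iffD2])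
  also have "(\<lambda>x. error_term (ln x) * (1 / scale x)) \<in> O(\<lambda>x. ln (ln (ln x)) / ln (ln x))"
    unfolding error_term_def scale_def by real_asymp
  finally have "E \<in> O(\<lambda>x. ln (ln (ln x)) / ln (ln x))" .
  moreover have "\<forall>\<^sub>F x in at_top. max_ln_delta_delta x = scale x * (c / sqrt 2 + E x)"
    using scale_pos by eventually_elim (simp add: E_def)
  ultimately show ?thesis by (auto simp: max_ln_delta_delta_def ln_delta_delta_def scale_def)
qed

end
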